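(* Assume that $a_{ij}>0$ for all $i\in N$, $j\in M$ (MAC). Then each face on the Pareto boundary of $IPS$ is identified by one of the following six characterizations, where, when several goods lie on a single disputing segment of $\beta$, these can be replaced by a single good obtained by summing up their utilities for each player, and the situation is thereby traced back to one of the cases listed. (f1) Faces corresponding to any $\beta\in\mathring{RNS}$ coinciding with an item $a^n_j$, $j\in M$, and no other goods on the disputing segments. In such case item $j$ can be assigned to any of the three players, while the other items are univocally assigned according to the Pareto rule $PAR(\beta)$. The face is a triangle, each vertex corresponding to a different assignment of item $j$. (f2) Faces corresponding to any $\beta\in\mathring{RNS}$ lying at the intersection of the supporting segments of two s-independent items $a^n_j,a^n_k$, $j,k\in M$, and no other goods in that intersection. Each of the items $j$ and $k$ can be shared between two players (with only one player participating in the dispute of both items). The face is a parallelogram, with each vertex corresponding to a different allocation of the pair of contested goods. (f3) Faces corresponding to any $\beta\in\mathring{RNS}$ lying at the intersection of the supporting segments of three s-independent items $a^n_j,a^n_k,a^n_\ell$, $j,k,\ell\in M$, and no other goods in that intersection. Each of the items $j,k,\ell$ can be shared between two players (with each player participating in two disputes out of the three). The face is a hexagon with opposite sides parallel and of equal length; 6 out of the 8 points (values of the integer allocations) are vertices of the hexagon, while the remaining two points lie in the interior of the face. (f4) Faces corresponding to any $\beta\in\mathring{RNS}$ coinciding with any item $a^n_j$, $j\in M$, and a second item $a^n_k$, $k\in M$, that lies on a disputing segment of $\beta$. The six different integer allocations produce a trapezoid, with the two extra points lying on its larger base. (f5) Faces corresponding to any $\beta\in\mathring{RNS}$ lying at the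 intersection of the supporting segments of two s-independent items $a^n_j,a^n_k$, $j,k\in M$, and an additional item $a^n_h$, $h\in M$, located in the same position as $\beta$. The 12 different integer allocations produce a face with 5 vertices and with two pairs of parallel edges of unequal length. The largest edge of each pair contains two additional points, while the remaining three points are in the interior of the face. (f6) Faces corresponding to any $\beta\in\mathring{RNS}$ lying at the intersection of the supporting segments of three s-independent items $a^n_j,a^n_k,a^n_\ell$, $j,k,\ell\in M$, and an additional item $a^n_h$, $h\in M$, located in the same position as $\beta$. The 24 different integer allocations produce a hexagon with parallel opposite sides of unequal length. The largest edge of each pair contains two additional points, while the remaining 12 points are in the interior of the face.
   Context: Setting. $N=\{1,2,3\}$ is the set of players and $M=\{1,\dots,m\}$ the set of divisible homogeneous goods (items). $a_{ij}$ is the value of good $j$ to player $i$, with $\sum_{j\in M}a_{ij}=1$ for each $i$. An allocation is a matrix $\mathbf X=(x_{ij})_{i\in N,j\in M}$ with $x_{ij}\ge0$ and $\sum_{i\in N}x_{ij}=1$ for all $j$; it is integer if all $x_{ij}\in\{0,1\}$. Put $a_i(\mathbf X)=\sum_{j}a_{ij}x_{ij}$ and $a(\mathbf X)=(a_i(\mathbf X))_{i\in N}\in\mathbb R^3$. $\mathbf X$ is Pareto optimal if no allocation $\mathbf X'$ has $a_i(\mathbf X')\ge a_i(\mathbf X)$ for all $i$ with at least one strict inequality. $IPS=\{a(\mathbf X):\mathbf X\text{ an allocation}\}$ is the convex hull of the values $a(\cdot)$ of the integer allocations. The Pareto boundary is the upper surface of $IPS$, made of the values of the Pareto optimal allocations;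 it is composed of (two-dimensional) faces, called Pareto faces. $\Delta_2=\{x\in\mathbb R^3: x_i\ge0,\ x_1+x_2+x_3=1\}$, and $\mathring\Delta_2$ is the subset with all $x_i>0$. For nonzero $x\in\mathbb R^3_+$, $N(x)=x/(x_1+x_2+x_3)$. For $x\in\mathring\Delta_2$, $RD(x)=N(1/x_1,1/x_2,1/x_3)$. For $\gamma\in\mathring\Delta_2$, $\mathcal H(\gamma)=\{x:\sum_i\gamma_ix_i=\max_{y\in IPS}\sum_i\gamma_iy_i\}$ is the supporting hyperplane of $IPS$ with coefficients $\gamma$. $RNS$ is the simplex $\Delta_2$, whose vertex $e_i$ represents player $i$, and in which each good $j$ is plotted at $a^n_j=N(a_{1j},a_{2j},a_{3j})$; $\mathring{RNS}=\mathring\Delta_2$. For $\beta\in RNS$, the disputing segments of $\beta$ are the three half-open segments on the lines joining $\beta$ with each vertex, going from $\beta$ (excluded) to the side opposite to that vertex. For $\beta\in\mathring{RNS}$ they divide the simplex into three parts, each a neighborhood of a vertex; the Pareto Allocation Rule $PAR(\beta)$ assigns the goods in each part to the player of its vertex. A good on a disputing segment can be assigned to either of the two corresponding players or split between them, and a good located at $\beta$ can be assigned to any of the three players. The face corresponding to $\beta$ is the set of points at which the hyperplane $\mathcal H(RD(\beta))$ supports $IPS$. The "integer allocations" (and the "points", their values) mentioned in the cases are those compatible with $PAR(\beta)$. The supporting segments of a good $j$ are the three segments joining $a^n_j$ to the three vertices. Two goods $j,k$ are s-independent if neither of $a^n_j,a^n_k$ lies on a supporting segment of the other good; three goods are called s-independent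 if every two of them are.
   Formalization: Several goods located exactly at β are also replaced by a single good (otherwise f1 fails, e.g. two identical goods at β), and each case, including f4–f6, requires that no goods other than those listed lie at β or on its disputing segments; points are counted per integer allocation. *)

theory Defs
  imports "HOL-Analysis.Analysis"
begin

text \<open>
  The three players are the elements of the type \<^typ>\<open>3\<close>. A division problem is given by a
  finite set \<open>M\<close> of goods and the values \<open>a i j\<close> of good \<open>j\<close> to player \<open>i\<close>. The type of goods is
  a parameter, because replacing several goods by a single one leads to a problem whose goods are
  sets of the original goods.
\<close>

text \<open>Entries outside \<open>M\<close> are fixed to 0, so that these functions correspond one-to-one to
  matrices indexed by players and goods, and integer allocations can be counted.\<close>

definition allocation :: "'g set \<Rightarrow> (3 \<Rightarrow> 'g \<Rightarrow> real) \<Rightarrow> bool" where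
  "allocation M x \<longleftrightarrow>
     (\<forall>i. \<forall>j\<in>M. 0 \<le> x i j) \<and> (\<forall>j\<in>M. (\<Sum>i\<in>UNIV. x i j) = 1) \<and> (\<forall>i j. j \<notin> M \<longrightarrow> x i j = 0)"

definition integer_allocation :: "'g set \<Rightarrow> (3 \<Rightarrow> 'g \<Rightarrow> real) \<Rightarrow> bool" where
  "integer_allocation M x \<longleftrightarrow> allocation M x \<and> (\<forall>i. \<forall>j\<in>M. x i j \<in> {0, 1})"

definition util :: "'g set \<Rightarrow> (3 \<Rightarrow> 'g \<Rightarrow> real) \<Rightarrow> (3 \<Rightarrow> 'g \<Rightarrow> real) \<Rightarrow> real ^ 3" where
  "util M a x = (\<chi> i. \<Sum>j\<in>M. a i j * x i j)"

definition pareto_optimal :: "'g set \<Rightarrow> (3 \<Rightarrow> 'g \<Rightarrow> real) \<Rightarrow> (3 \<Rightarrow> 'g \<Rightarrow> real) \<Rightarrow> bool" where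
  "pareto_optimal M a x \<longleftrightarrow> allocation M x \<and>
     \<not> (\<exists>x'. allocation M x' \<and> (\<forall>i. util M a x' $ i \<ge> util M a x $ i)
           \<and> (\<exists>i. util M a x' $ i > util M a x $ i))"

definition IPS :: "'g set \<Rightarrow> (3 \<Rightarrow> 'g \<Rightarrow> real) \<Rightarrow> (real ^ 3) set" where
  "IPS M a = util M a ` {x. allocation M x}"

definition pareto_boundary :: "'g set \<Rightarrow> (3 \<Rightarrow> 'g \<Rightarrow> real) \<Rightarrow> (real ^ 3) set" where
  "pareto_boundary M a = util M a ` {x. pareto_optimal M a x}"

definition pareto_face :: "'g set \<Rightarrow> (3 \<Rightarrow> 'g \<Rightarrow> real) \<Rightarrow> (real ^ 3) set \<Rightarrow> bool" where
  "pareto_face M a F \<longleftrightarrow> F face_of IPS M a \<and> aff_dim F = 2 \<and> F \<subseteq> pareto_boundary M a"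


definition simplex2 :: "(real ^ 3) set" where
  "simplex2 = {x. (\<forall>i. 0 \<le> x $ i) \<and> (\<Sum>i\<in>UNIV. x $ i) = 1}"

definition open_simplex2 :: "(real ^ 3) set" where
  "open_simplex2 = {x \<in> simplex2. \<forall>i. 0 < x $ i}"

definition vertex :: "3 \<Rightarrow> real ^ 3" where
  "vertex i = axis i 1"

definition to_simplex :: "real ^ 3 \<Rightarrow> real ^ 3" where
  "to_simplex x = x /\<^sub>R (\<Sum>i\<in>UNIV. x $ i)"

definition RD :: "real ^ 3 \<Rightarrow> real ^ 3" where
  "RD x = to_simplex (\<chi> i. 1 / x $ i)"

text \<open>\<open>IPS M a\<close> is compact and nonempty, so the supremum is the maximum.\<close>

definition support_plane :: "'g set \<Rightarrow> (3 \<Rightarrow> 'g \<Rightarrow> real) \<Rightarrow> real ^ 3 \<Rightarrow> (real ^ 3) set" where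
  "support_plane M a \<gamma> = {x. \<gamma> \<bullet> x = (SUP y\<in>IPS M a. \<gamma> \<bullet> y)}"

definition face_at :: "'g set \<Rightarrow> (3 \<Rightarrow> 'g \<Rightarrow> real) \<Rightarrow> real ^ 3 \<Rightarrow> (real ^ 3) set" where
  "face_at M a \<beta> = support_plane M a (RD \<beta>) \<inter> IPS M a"


definition loc :: "(3 \<Rightarrow> 'g \<Rightarrow> real) \<Rightarrow> 'g \<Rightarrow> real ^ 3" where
  "loc a j = to_simplex (\<chi> i. a i j)"

text \<open>The disputing segment on the line through \<open>\<beta>\<close> and \<open>vertex i\<close>; it separates the parts of the
  two players other than \<open>i\<close>.\<close>

definition disputing_segment :: "real ^ 3 \<Rightarrow> 3 \<Rightarrow> (real ^ 3) set" where
  "disputing_segment \<beta> i = {\<beta> + t *\<^sub>R (\<beta> - vertex i) | t. 0 < t} \<inter> simplex2"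

definition part_of_vertex :: "real ^ 3 \<Rightarrow> 3 \<Rightarrow> (real ^ 3) set" where
  "part_of_vertex \<beta> i =
     connected_component_set (simplex2 - insert \<beta> (\<Union>k. disputing_segment \<beta> k)) (vertex i)"

text \<open>The allocations compatible with the Pareto Allocation Rule. Goods located at \<open>\<beta>\<close> are
  unconstrained.\<close>

definition PAR :: "'g set \<Rightarrow> (3 \<Rightarrow> 'g \<Rightarrow> real) \<Rightarrow> real ^ 3 \<Rightarrow> (3 \<Rightarrow> 'g \<Rightarrow> real) \<Rightarrow> bool" where
  "PAR M a \<beta> x \<longleftrightarrow> allocation M x \<and>
     (\<forall>j\<in>M. \<forall>i. (loc a j \<in> part_of_vertex \<beta> i \<longrightarrow> x i j = 1) \<and>
                (loc a j \<in> disputing_segment \<beta> i \<longrightarrow> x i j = 0))"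

definition int_PAR :: "'g set \<Rightarrow> (3 \<Rightarrow> 'g \<Rightarrow> real) \<Rightarrow> real ^ 3 \<Rightarrow> (3 \<Rightarrow> 'g \<Rightarrow> real) set" where
  "int_PAR M a \<beta> = {x. PAR M a \<beta> x \<and> integer_allocation M x}"

definition supporting_segments :: "(3 \<Rightarrow> 'g \<Rightarrow> real) \<Rightarrow> 'g \<Rightarrow> (real ^ 3) set" where
  "supporting_segments a j = (\<Union>i. closed_segment (loc a j) (vertex i))"

definition s_independent :: "(3 \<Rightarrow> 'g \<Rightarrow> real) \<Rightarrow> 'g \<Rightarrow> 'g \<Rightarrow> bool" where
  "s_independent a j k \<longleftrightarrow>
     loc a j \<notin> supporting_segments a k \<and> loc a k \<notin> supporting_segments a j"

text \<open>No good outside \<open>C\<close> is located at \<open>\<beta>\<close> or on a disputing segment of \<open>\<beta>\<close>.\<close>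

definition no_others :: "'g set \<Rightarrow> (3 \<Rightarrow> 'g \<Rightarrow> real) \<Rightarrow> real ^ 3 \<Rightarrow> 'g set \<Rightarrow> bool" where
  "no_others M a \<beta> C \<longleftrightarrow> (\<forall>h\<in>M - C. loc a h \<noteq> \<beta> \<and> (\<forall>i. loc a h \<notin> disputing_segment \<beta> i))"


definition config1 :: "'g set \<Rightarrow> (3 \<Rightarrow> 'g \<Rightarrow> real) \<Rightarrow> real ^ 3 \<Rightarrow> 'g \<Rightarrow> bool" where
  "config1 M a \<beta> j \<longleftrightarrow> \<beta> \<in> open_simplex2 \<and> j \<in> M \<and> \<beta> = loc a j \<and> no_others M a \<beta> {j}"

definition config2 :: "'g set \<Rightarrow> (3 \<Rightarrow> 'g \<Rightarrow> real) \<Rightarrow> real ^ 3 \<Rightarrow> 'g \<Rightarrow> 'g \<Rightarrow> bool" where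
  "config2 M a \<beta> j k \<longleftrightarrow> \<beta> \<in> open_simplex2 \<and> j \<in> M \<and> k \<in> M \<and> s_independent a j k \<and>
     \<beta> \<in> supporting_segments a j \<inter> supporting_segments a k \<and> no_others M a \<beta> {j, k}"

definition config3 ::
  "'g set \<Rightarrow> (3 \<Rightarrow> 'g \<Rightarrow> real) \<Rightarrow> real ^ 3 \<Rightarrow> 'g \<Rightarrow> 'g \<Rightarrow> 'g \<Rightarrow> bool" where
  "config3 M a \<beta> j k l \<longleftrightarrow> \<beta> \<in> open_simplex2 \<and> j \<in> M \<and> k \<in> M \<and> l \<in> M \<and>
     s_independent a j k \<and> s_independent a j l \<and> s_independent a k l \<and>
     \<beta> \<in> supporting_segments a j \<inter> supporting_segments a k \<inter> supporting_segments a l \<and>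
     no_others M a \<beta> {j, k, l}"

definition config4 :: "'g set \<Rightarrow> (3 \<Rightarrow> 'g \<Rightarrow> real) \<Rightarrow> real ^ 3 \<Rightarrow> 'g \<Rightarrow> 'g \<Rightarrow> bool" where
  "config4 M a \<beta> j k \<longleftrightarrow> \<beta> \<in> open_simplex2 \<and> j \<in> M \<and> k \<in> M \<and> \<beta> = loc a j \<and>
     (\<exists>i. loc a k \<in> disputing_segment \<beta> i) \<and> no_others M a \<beta> {j, k}"

definition config5 ::
  "'g set \<Rightarrow> (3 \<Rightarrow> 'g \<Rightarrow> real) \<Rightarrow> real ^ 3 \<Rightarrow> 'g \<Rightarrow> 'g \<Rightarrow> 'g \<Rightarrow> bool" where
  "config5 M a \<beta> j k h \<longleftrightarrow> \<beta> \<in> open_simplex2 \<and> j \<in> M \<and> k \<in> M \<and> h \<in> M \<and>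
     s_independent a j k \<and> \<beta> \<in> supporting_segments a j \<inter> supporting_segments a k \<and>
     \<beta> = loc a h \<and> no_others M a \<beta> {j, k, h}"

definition config6 ::
  "'g set \<Rightarrow> (3 \<Rightarrow> 'g \<Rightarrow> real) \<Rightarrow> real ^ 3 \<Rightarrow> 'g \<Rightarrow> 'g \<Rightarrow> 'g \<Rightarrow> 'g \<Rightarrow> bool" where
  "config6 M a \<beta> j k l h \<longleftrightarrow> \<beta> \<in> open_simplex2 \<and> j \<in> M \<and> k \<in> M \<and> l \<in> M \<and> h \<in> M \<and>
     s_independent a j k \<and> s_independent a j l \<and> s_independent a k l \<and>
     \<beta> \<in> supporting_segments a j \<inter> supporting_segments a k \<inter> supporting_segments a l \<and>
     \<beta> = loc a h \<and> no_others M a \<beta> {j, k, l, h}"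

definition some_config :: "'g set \<Rightarrow> (3 \<Rightarrow> 'g \<Rightarrow> real) \<Rightarrow> real ^ 3 \<Rightarrow> bool" where
  "some_config M a \<beta> \<longleftrightarrow>
     (\<exists>j. config1 M a \<beta> j) \<or> (\<exists>j k. config2 M a \<beta> j k) \<or> (\<exists>j k l. config3 M a \<beta> j k l) \<or>
     (\<exists>j k. config4 M a \<beta> j k) \<or> (\<exists>j k h. config5 M a \<beta> j k h) \<or>
     (\<exists>j k l h. config6 M a \<beta> j k l h)"


text \<open>\<open>F\<close> is a convex polygon whose vertices, in cyclic order, are listed in \<open>vs\<close>.\<close>

definition side :: "(real ^ 3) list \<Rightarrow> nat \<Rightarrow> (real ^ 3) set" where
  "side vs p = closed_segment (vs ! p) (vs ! (Suc p mod length vs))"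

definition open_side :: "(real ^ 3) list \<Rightarrow> nat \<Rightarrow> (real ^ 3) set" where
  "open_side vs p = open_segment (vs ! p) (vs ! (Suc p mod length vs))"

definition side_length :: "(real ^ 3) list \<Rightarrow> nat \<Rightarrow> real" where
  "side_length vs p = dist (vs ! p) (vs ! (Suc p mod length vs))"

definition polygon :: "(real ^ 3) set \<Rightarrow> (real ^ 3) list \<Rightarrow> bool" where
  "polygon F vs \<longleftrightarrow> distinct vs \<and> set vs = {v. v extreme_point_of F} \<and> F = convex hull set vs \<and>
     aff_dim F = 2 \<and> (\<forall>p<length vs. side vs p edge_of F)"

definition parallel_sides :: "(real ^ 3) list \<Rightarrow> nat \<Rightarrow> nat \<Rightarrow> bool" where
  "parallel_sides vs p q \<longleftrightarrow>
     affine_parallel (affine hull side vs p) (affine hull side vs q)"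

text \<open>Number of compatible integer allocations whose value lies in \<open>S\<close>. The values listed by the
  classification are counted per allocation: for exceptional data, two allocations whose values
  are not vertices of the face have the same value.\<close>

definition int_count :: "'g set \<Rightarrow> (3 \<Rightarrow> 'g \<Rightarrow> real) \<Rightarrow> real ^ 3 \<Rightarrow> (real ^ 3) set \<Rightarrow> nat" where
  "int_count M a \<beta> S = card {x \<in> int_PAR M a \<beta>. util M a x \<in> S}"

definition vertices_once :: "'g set \<Rightarrow> (3 \<Rightarrow> 'g \<Rightarrow> real) \<Rightarrow> real ^ 3 \<Rightarrow> (real ^ 3) list \<Rightarrow> bool" where
  "vertices_once M a \<beta> vs \<longleftrightarrow>
     bij_betw (util M a) {x \<in> int_PAR M a \<beta>. util M a x \<in> set vs} (set vs)"

definition shared_between ::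
  "'g set \<Rightarrow> (3 \<Rightarrow> 'g \<Rightarrow> real) \<Rightarrow> real ^ 3 \<Rightarrow> 'g \<Rightarrow> 3 set \<Rightarrow> bool" where
  "shared_between M a \<beta> j C \<longleftrightarrow>
     (\<forall>x. PAR M a \<beta> x \<longrightarrow> (\<forall>i. i \<notin> C \<longrightarrow> x i j = 0)) \<and>
     (\<exists>x. PAR M a \<beta> x \<and> (\<forall>i\<in>C. 0 < x i j))"


definition outcome1 :: "'g set \<Rightarrow> (3 \<Rightarrow> 'g \<Rightarrow> real) \<Rightarrow> real ^ 3 \<Rightarrow> 'g \<Rightarrow> bool" where
  "outcome1 M a \<beta> j \<longleftrightarrow>
     (\<forall>i. \<exists>!x. x \<in> int_PAR M a \<beta> \<and> x i j = 1) \<and>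
     (\<forall>h\<in>M - {j}. \<exists>!i. \<forall>x. PAR M a \<beta> x \<longrightarrow> x i h = 1) \<and>
     (\<exists>vs. polygon (face_at M a \<beta>) vs \<and> length vs = 3 \<and>
           bij_betw (util M a) (int_PAR M a \<beta>) (set vs))"

definition outcome2 :: "'g set \<Rightarrow> (3 \<Rightarrow> 'g \<Rightarrow> real) \<Rightarrow> real ^ 3 \<Rightarrow> 'g \<Rightarrow> 'g \<Rightarrow> bool" where
  "outcome2 M a \<beta> j k \<longleftrightarrow>
     (\<exists>C D. shared_between M a \<beta> j C \<and> shared_between M a \<beta> k D \<and>
            card C = 2 \<and> card D = 2 \<and> card (C \<inter> D) = 1) \<and>
     (\<exists>vs. polygon (face_at M a \<beta>) vs \<and> length vs = 4 \<and>
           parallel_sides vs 0 2 \<and> parallel_sides vs 1 3 \<and>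
           bij_betw (util M a) (int_PAR M a \<beta>) (set vs)) \<and>
     inj_on (\<lambda>x i. (x i j, x i k)) (int_PAR M a \<beta>)"

definition outcome3 ::
  "'g set \<Rightarrow> (3 \<Rightarrow> 'g \<Rightarrow> real) \<Rightarrow> real ^ 3 \<Rightarrow> 'g \<Rightarrow> 'g \<Rightarrow> 'g \<Rightarrow> bool" where
  "outcome3 M a \<beta> j k l \<longleftrightarrow>
     (\<exists>C D E. shared_between M a \<beta> j C \<and> shared_between M a \<beta> k D \<and> shared_between M a \<beta> l E \<and>
            card C = 2 \<and> card D = 2 \<and> card E = 2 \<and>
            (\<forall>i. of_bool (i \<in> C) + of_bool (i \<in> D) + of_bool (i \<in> E) = (2::nat))) \<and>
     card (int_PAR M a \<beta>) = 8 \<and>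
     (\<exists>vs. polygon (face_at M a \<beta>) vs \<and> length vs = 6 \<and> vertices_once M a \<beta> vs \<and>
           (\<forall>p<3. parallel_sides vs p (p + 3) \<and> side_length vs p = side_length vs (p + 3)) \<and>
           int_count M a \<beta> (rel_interior (face_at M a \<beta>)) = 2)"

definition outcome4 :: "'g set \<Rightarrow> (3 \<Rightarrow> 'g \<Rightarrow> real) \<Rightarrow> real ^ 3 \<Rightarrow> bool" where
  "outcome4 M a \<beta> \<longleftrightarrow>
     card (int_PAR M a \<beta>) = 6 \<and>
     (\<exists>vs. polygon (face_at M a \<beta>) vs \<and> length vs = 4 \<and> vertices_once M a \<beta> vs \<and>
           parallel_sides vs 0 2 \<and> \<not> parallel_sides vs 1 3 \<and>
           side_length vs 2 < side_length vs 0 \<and>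
           int_count M a \<beta> (open_side vs 0) = 2)"

definition outcome5 :: "'g set \<Rightarrow> (3 \<Rightarrow> 'g \<Rightarrow> real) \<Rightarrow> real ^ 3 \<Rightarrow> bool" where
  "outcome5 M a \<beta> \<longleftrightarrow>
     card (int_PAR M a \<beta>) = 12 \<and>
     (\<exists>vs. polygon (face_at M a \<beta>) vs \<and> length vs = 5 \<and> vertices_once M a \<beta> vs \<and>
           (\<exists>p q r s. distinct [p, q, r, s] \<and> {p, q, r, s} \<subseteq> {..<5} \<and>
              parallel_sides vs p q \<and> side_length vs q < side_length vs p \<and>
              parallel_sides vs r s \<and> side_length vs s < side_length vs r \<and>
              int_count M a \<beta> (open_side vs p) = 2 \<and> int_count M a \<beta> (open_side vs r) = 2) \<and>
           int_count M a \<beta> (rel_interior (face_at M a \<beta>)) = 3)"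

definition outcome6 :: "'g set \<Rightarrow> (3 \<Rightarrow> 'g \<Rightarrow> real) \<Rightarrow> real ^ 3 \<Rightarrow> bool" where
  "outcome6 M a \<beta> \<longleftrightarrow>
     card (int_PAR M a \<beta>) = 24 \<and>
     (\<exists>vs. polygon (face_at M a \<beta>) vs \<and> length vs = 6 \<and> vertices_once M a \<beta> vs \<and>
           (\<forall>i<3. \<exists>p q. {p, q} = {i, i + 3} \<and>
              parallel_sides vs p q \<and> side_length vs q < side_length vs p \<and>
              int_count M a \<beta> (open_side vs p) = 2) \<and>
           int_count M a \<beta> (rel_interior (face_at M a \<beta>)) = 12)"

definition outcomes :: "'g set \<Rightarrow> (3 \<Rightarrow> 'g \<Rightarrow> real) \<Rightarrow> real ^ 3 \<Rightarrow> bool" where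
  "outcomes M a \<beta> \<longleftrightarrow>
     (some_config M a \<beta> \<longrightarrow> pareto_face M a (face_at M a \<beta>)) \<and>
     (\<forall>j. config1 M a \<beta> j \<longrightarrow> outcome1 M a \<beta> j) \<and>
     (\<forall>j k. config2 M a \<beta> j k \<longrightarrow> outcome2 M a \<beta> j k) \<and>
     (\<forall>j k l. config3 M a \<beta> j k l \<longrightarrow> outcome3 M a \<beta> j k l) \<and>
     (\<forall>j k. config4 M a \<beta> j k \<longrightarrow> outcome4 M a \<beta>) \<and>
     (\<forall>j k h. config5 M a \<beta> j k h \<longrightarrow> outcome5 M a \<beta>) \<and>
     (\<forall>j k l h. config6 M a \<beta> j k l h \<longrightarrow> outcome6 M a \<beta>)"


text \<open>
  The problem in which all goods on a common disputing segment of \<open>\<beta>\<close> (and all goods located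
  exactly at \<open>\<beta>\<close>) are replaced by a single good, the set of these goods. A good that is not
  contested is only replaced by its singleton.
\<close>

definition same_dispute :: "'g set \<Rightarrow> (3 \<Rightarrow> 'g \<Rightarrow> real) \<Rightarrow> real ^ 3 \<Rightarrow> ('g \<times> 'g) set" where
  "same_dispute M a \<beta> = {(j, k) \<in> M \<times> M. j = k \<or> (loc a j = \<beta> \<and> loc a k = \<beta>) \<or>
     (\<exists>i. loc a j \<in> disputing_segment \<beta> i \<and> loc a k \<in> disputing_segment \<beta> i)}"

definition merged_goods :: "'g set \<Rightarrow> (3 \<Rightarrow> 'g \<Rightarrow> real) \<Rightarrow> real ^ 3 \<Rightarrow> 'g set set" where
  "merged_goods M a \<beta> = M // same_dispute M a \<beta>"

definition merged_val :: "(3 \<Rightarrow> 'g \<Rightarrow> real) \<Rightarrow> 3 \<Rightarrow> 'g set \<Rightarrow> real" where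
  "merged_val a i B = (\<Sum>j\<in>B. a i j)"

end

theory Submission
  imports Defs
begin

text \<open>
  Divide the utility of player \<open>i\<close> by \<open>\<beta> $ i\<close>. Goods are then worth equally much, say \<open>w j\<close>, to all
  players who may receive them, so that on the face of \<open>\<beta>\<close> a contested good is a weight \<open>w j\<close> moved
  between the players in \<open>E j\<close>, where \<open>E j\<close> misses one player on a disputing segment and no player
  at \<open>\<beta>\<close>. Hence the face is the base of a polymatroid on three elements: if \<open>d i\<close> is the weight on
  the disputing segment of \<open>i\<close> and \<open>s\<close> the total contested weight, it consists of the \<open>Y\<close> with
  \<open>0 \<le> Y i \<le> s - d i\<close> and sum \<open>s\<close>, a hexagon with sides in the three directions of the triangle, some
  of which may vanish. Its vertices are the greedy allocations, each attained once. The six cases are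
  the ways in which sides can vanish without the dimension dropping, and the positions of the
  remaining integer allocations are read off from the coordinates. Merging goods changes
  neither \<open>d\<close> nor \<open>s\<close>. Conversely, a supporting functional at a relative interior point of a Pareto
  face has positive coefficients, since a zero coefficient for player \<open>i\<close> would force utility zero
  for \<open>i\<close> on the whole face.
\<close>

section \<open>Polygons cut out by supporting planes\<close>

text \<open>Why exactly six cases: measured in shares, the side where player \<open>i\<close> gets
  nothing has length \<open>s\<close> minus the two other values of \<open>d\<close>, and the
  parallel side where \<open>i\<close> takes the maximum has length \<open>d i\<close>. The two
  differ by \<open>s\<close> minus the sum of \<open>d\<close>, which is the weight
  \<open>cc\<close> of the goods at \<beta>. Up to renaming players, the shape depends only on how
  many \<open>d i\<close> are positive and on whether \<open>cc\<close> is. Of these eight patterns,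
  the two with \<open>cc = 0\<close> and at most one positive \<open>d i\<close> give a point or a
  segment; the other six are the cases, with equal opposite sides when \<open>cc = 0\<close> and
  unequal ones otherwise. Membership in the hull and in the relative interior is tested with linear
  functionals, which are minimal at a greedy vertex, so no point of the region has to be written as
  an explicit convex combination. After merging, a contested good is determined by the set of
  players who may receive it. At most four such goods remain, and counting integer allocations means
  evaluating at most 24 assignments.\<close>

lemma convex_hull_Int_supporting_plane:
  fixes n :: "'a::euclidean_space"
  assumes "finite S" "a \<in> S" "b \<in> S" "n \<bullet> a = m" "n \<bullet> b = m"
    and above: "\<And>v. v \<in> S \<Longrightarrow> v \<noteq> a \<Longrightarrow> v \<noteq> b \<Longrightarrow> m < n \<bullet> v"
  shows "convex hull S \<inter> {x. n \<bullet> x = m} = closed_segment a b"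
    and "closed_segment a b face_of convex hull S"
proof -
  have "n \<bullet> v \<ge> m" if "v \<in> S" for v
    using assms that by (metis less_eq_real_def)
  then have "convex hull S \<subseteq> {x. n \<bullet> x \<ge> m}"
    by (intro hull_minimal convex_halfspace_ge) auto
  then have face: "convex hull S \<inter> {x. n \<bullet> x = m} face_of convex hull S" (is "?T face_of _")
    by (intro face_of_Int_supporting_hyperplane_ge) auto
  \<comment> \<open>A face of the hull of a finite set is the hull of some of its points, here only
    of points in the plane, that is of \<open>a\<close> and \<open>b\<close>.\<close>
  then obtain S' where S': "S' \<subseteq> S" "?T = convex hull S'"
    using face_of_convex_hull_subset[OF finite_imp_compact[OF \<open>finite S\<close>]] by metis
  have "S' \<subseteq> ?T" using S'(2) hull_subset by metis
  then have "S' \<subseteq> {a, b}" using S'(1) above by fastforce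
  then have "?T \<subseteq> closed_segment a b"
    unfolding S'(2) segment_convex_hull by (rule hull_mono)
  moreover have "closed_segment a b \<subseteq> ?T"
  proof (rule closed_segment_subset)
    show "convex ?T" using face face_of_imp_convex by blast
  qed (use assms in \<open>auto intro: hull_inc\<close>)
  ultimately show eq: "?T = closed_segment a b" by blast
  show "closed_segment a b face_of convex hull S" using face unfolding eq .
qed

text \<open>The common plane bounds the dimension by two. The functional for two neighbours makes
  their segment a face, and endpoints of such faces are extreme points of \<open>F\<close>. Thus the
  cyclic order is verified without any angles.\<close>

lemma polygonI:
  assumes "distinct vs" "3 \<le> length vs"
    and F: "F = convex hull set vs"
    and plane: "g \<noteq> 0" "\<And>v. v \<in> set vs \<Longrightarrow> g \<bullet> v = k"
    and sides: "\<And>p. p < length vs \<Longrightarrow> \<exists>n m. n \<bullet> vs ! p = m \<and> n \<bullet> vs ! (Suc p mod length vs) = m \<and>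
      (\<forall>v\<in>set vs - {vs ! p, vs ! (Suc p mod length vs)}. m < n \<bullet> v)"
  shows "polygon F vs"
proof -
  let ?l = "length vs"
  have next_less: "Suc p mod ?l < ?l" for p using assms(2) by (intro mod_less_divisor) linarith
  have next_neq: "Suc p mod ?l \<noteq> p" if "p < ?l" for p
    using that assms(2) by (cases "Suc p = ?l") auto
  have face: "side vs p face_of F" if "p < ?l" for p
    using sides[OF that] that next_less[of p] unfolding side_def F
    by (metis (no_types, lifting) Diff_iff List.finite_set convex_hull_Int_supporting_plane(2)
        empty_iff insert_iff nth_mem)
  have edge: "side vs p edge_of F" if "p < ?l" for p
  proof -
    have "vs ! p \<noteq> vs ! (Suc p mod ?l)"
      using that next_less next_neq assms(1) by (metis nth_eq_iff_index_eq)
    then have "aff_dim (side vs p) = 1"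
      unfolding side_def segment_convex_hull by (simp add: aff_dim_convex_hull)
    then show ?thesis using face[OF that] by (simp add: edge_of_def)
  qed
  have "{v. v extreme_point_of F} \<subseteq> set vs"
    unfolding F using extreme_point_of_convex_hull by blast
  moreover have "vs ! p extreme_point_of F" if "p < ?l" for p
  proof -
    have "vs ! p extreme_point_of side vs p"
      unfolding side_def by (simp add: extreme_point_of_segment)
    then show ?thesis using extreme_point_of_face face[OF that] by blast
  qed
  ultimately have extreme: "set vs = {v. v extreme_point_of F}"
    by (auto simp: in_set_conv_nth)
  have "F \<subseteq> {x. g \<bullet> x = k}"
    unfolding F by (intro hull_minimal convex_hyperplane) (use plane in auto)
  then have "aff_dim F \<le> aff_dim {x. g \<bullet> x = k}" by (rule aff_dim_subset)
  also have "\<dots> = 2" using plane(1) by simp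
  finally have upper: "aff_dim F \<le> 2" .
  \<comment> \<open>A third vertex keeps the first side from filling \<open>F\<close>, so the
    dimension of \<open>F\<close> exceeds that of an edge.\<close>
  have "side vs 0 \<noteq> F"
  proof
    assume eq: "side vs 0 = F"
    have "vs ! 2 extreme_point_of side vs 0"
      unfolding eq using extreme assms(2) by (metis (no_types, lifting) Suc_1 Suc_le_lessD
          eval_nat_numeral(3) mem_Collect_eq nth_mem)
    then have "vs ! 2 = vs ! 0 \<or> vs ! 2 = vs ! (1 mod ?l)"
      unfolding side_def by (simp add: extreme_point_of_segment)
    moreover have "1 mod ?l = 1" using assms(2) by simp
    moreover have "0 < ?l" "1 < ?l" "2 < ?l" using assms(2) by linarith+
    ultimately show False
      using nth_eq_iff_index_eq[OF assms(1), of 2 0] nth_eq_iff_index_eq[OF assms(1), of 2 1] by simp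
  qed
  moreover have "side vs 0 edge_of F" using edge assms(2) by fastforce
  ultimately have "1 < aff_dim F"
    using face_of_aff_dim_lt[of F "side vs 0"] unfolding edge_of_def F
    by (simp add: convex_convex_hull)
  then have "aff_dim F = 2" using upper by simp
  then show ?thesis unfolding polygon_def using assms(1) extreme F edge by blast
qed

lemma affine_parallel_segments:
  fixes a b c d :: "'a::euclidean_space"
  assumes "a \<noteq> b" "c \<noteq> d"
  shows "affine_parallel (affine hull closed_segment a b) (affine hull closed_segment c d)
    \<longleftrightarrow> (\<exists>t. d - c = t *\<^sub>R (b - a))"
proof
  assume "affine_parallel (affine hull closed_segment a b) (affine hull closed_segment c d)"
  then obtain z where z: "affine hull {c, d} = (+) z ` (affine hull {a, b})"
    by (auto simp: affine_parallel_def)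
  have "c \<in> affine hull {c, d}" "d \<in> affine hull {c, d}" by (auto intro: hull_inc)
  then obtain u v where c: "c = z + (a + u *\<^sub>R (b - a))" and d: "d = z + (a + v *\<^sub>R (b - a))"
    unfolding z unfolding affine_hull_2_alt by blast
  have "d - c = (v - u) *\<^sub>R (b - a)" unfolding c d by (simp add: scaleR_left_diff_distrib)
  then show "\<exists>t. d - c = t *\<^sub>R (b - a)" ..
next
  assume "\<exists>t. d - c = t *\<^sub>R (b - a)"
  then obtain t where t: "d - c = t *\<^sub>R (b - a)" ..
  with assms have "t \<noteq> 0" by auto
  have "affine hull {c, d} = (+) (c - a) ` (affine hull {a, b})"
    unfolding affine_hull_2_alt t
  proof (intro set_eqI iffI)
    fix x assume "x \<in> range (\<lambda>u. c + u *\<^sub>R t *\<^sub>R (b - a))"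
    then obtain u where "x = c + u *\<^sub>R t *\<^sub>R (b - a)" ..
    then have "x = (c - a) + (a + (u * t) *\<^sub>R (b - a))" by simp
    then show "x \<in> (+) (c - a) ` range (\<lambda>u. a + u *\<^sub>R (b - a))" by blast
  next
    fix x assume "x \<in> (+) (c - a) ` range (\<lambda>u. a + u *\<^sub>R (b - a))"
    then obtain u where "x = (c - a) + (a + u *\<^sub>R (b - a))" by blast
    then have "x = c + (u / t) *\<^sub>R t *\<^sub>R (b - a)" using \<open>t \<noteq> 0\<close> by simp
    then show "x \<in> range (\<lambda>u. c + u *\<^sub>R t *\<^sub>R (b - a))" by blast
  qed
  then show "affine_parallel (affine hull closed_segment a b) (affine hull closed_segment c d)"
    unfolding affine_parallel_def by auto
qed

section \<open>Three players\<close>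

text \<open>Gives the players variable names, so that a case is proved once up to symmetry and the
  remaining instances arise by rotating the names.\<close>

definition three :: "3 \<Rightarrow> 3 \<Rightarrow> 3 \<Rightarrow> bool" where
  "three p q r \<longleftrightarrow> p \<noteq> q \<and> p \<noteq> r \<and> q \<noteq> r"

lemma threeD:
  assumes "three p q r"
  shows "p \<noteq> q" "p \<noteq> r" "q \<noteq> r" "q \<noteq> p" "r \<noteq> p" "r \<noteq> q"
  using assms by (auto simp: three_def)

lemma three_UNIV: assumes "three p q r" shows "UNIV = {p, q, r}"
proof -
  have "card {p, q, r} = CARD(3)" using threeD[OF assms] by simp
  then show ?thesis by (metis card_subset_eq finite subset_UNIV)
qed

lemma three_cases: "three p q r \<Longrightarrow> i = p \<or> i = q \<or> i = r"
  using three_UNIV by blast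

lemma three_all: "three p q r \<Longrightarrow> (\<forall>i. P i) \<longleftrightarrow> P p \<and> P q \<and> P r"
  by (metis three_cases)

lemma three_sum:
  fixes f :: "3 \<Rightarrow> 'a::comm_monoid_add"
  assumes "three p q r" shows "(\<Sum>i\<in>UNIV. f i) = f p + f q + f r"
  unfolding three_UNIV[OF assms] using threeD[OF assms] by (simp add: add.assoc)

lemma three_fun_eq: "three p q r \<Longrightarrow> f = g \<longleftrightarrow> f p = g p \<and> f q = g q \<and> f r = g r"
  unfolding fun_eq_iff by (rule three_all)

lemma ex_three: "\<exists>q r. three p q r"
proof -
  have "card (UNIV - {p}) = 2" by (simp add: card_Diff_subset)
  then obtain q r where "UNIV - {p} = {q, r}" "q \<noteq> r" unfolding card_2_iff by blast
  then show ?thesis unfolding three_def by blast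
qed

lemma ex_three2: "p \<noteq> q \<Longrightarrow> \<exists>r. three p q r"
  using ex_three[of p] unfolding three_def by metis

lemma ex_three_sorted: "\<exists>p q r. three p q r \<and> b p \<le> b q \<and> b q \<le> (b r :: real)"
proof -
  obtain p q r where "three p q r" using ex_three by blast
  then show ?thesis unfolding three_def by (metis linorder_le_cases)
qed

section \<open>The hexagon\<close>

text \<open>Turns shares measured in weights back into utilities. In the application
  \<open>b\<close> collects the goods whose receiver is forced.\<close>

definition point :: "real^3 \<Rightarrow> real^3 \<Rightarrow> (3 \<Rightarrow> real) \<Rightarrow> real^3" where
  "point b \<beta> Y = (\<chi> i. b $ i + \<beta> $ i * Y i)"

text \<open>The vertex at which player \<open>p\<close> takes as much as possible and \<open>q\<close> comes second.\<close>

definition vert :: "real \<Rightarrow> (3 \<Rightarrow> real) \<Rightarrow> 3 \<Rightarrow> 3 \<Rightarrow> 3 \<Rightarrow> real" where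
  "vert s d p q = (\<lambda>i. if i = p then s - d p else if i = q then d p else 0)"

definition region :: "real \<Rightarrow> (3 \<Rightarrow> real) \<Rightarrow> (3 \<Rightarrow> real) set" where
  "region s d = {Y. (\<forall>i. 0 \<le> Y i \<and> Y i \<le> s - d i) \<and> (\<Sum>i\<in>UNIV. Y i) = s}"

lemma inner_point: "n \<bullet> point b \<beta> Y = n \<bullet> b + (\<Sum>i\<in>UNIV. n $ i * \<beta> $ i * Y i)"
  by (simp add: point_def inner_vec_def sum.distrib algebra_simps)

text \<open>Greedy maximization over a polymatroid: summation by parts along the order \<open>p, q, r\<close>.\<close>

lemma vert_minimal:
  assumes "three p q r" "Y \<in> region s d" "e p \<le> e q" "e q \<le> e r"
  shows "(\<Sum>i\<in>UNIV. e i * vert s d p q i) \<le> (\<Sum>i\<in>UNIV. e i * Y i)"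
    and "\<lbrakk>0 < Y r; Y p < s - d p; e p \<noteq> e r\<rbrakk> \<Longrightarrow>
      (\<Sum>i\<in>UNIV. e i * vert s d p q i) < (\<Sum>i\<in>UNIV. e i * Y i)"
proof -
  have s: "Y p + Y q + Y r = s" and Y: "0 \<le> Y r" "Y p \<le> s - d p"
    using assms(2) by (auto simp: region_def three_sum[OF assms(1)])
  have "(\<Sum>i\<in>UNIV. e i * Y i) - (\<Sum>i\<in>UNIV. e i * vert s d p q i)
      = (e q - e p) * (s - d p - Y p) + (e r - e q) * Y r"
    using s[symmetric] threeD[OF assms(1)]
    by (simp add: three_sum[OF assms(1)] vert_def algebra_simps)
  moreover have "0 \<le> (e q - e p) * (s - d p - Y p)" "0 \<le> (e r - e q) * Y r"
    using assms(3,4) Y by auto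
  moreover have "0 < (e q - e p) * (s - d p - Y p) \<or> 0 < (e r - e q) * Y r"
    if "0 < Y r" "Y p < s - d p" "e p \<noteq> e r"
    using that assms(3,4) by (auto simp: zero_less_mult_iff)
  ultimately show "(\<Sum>i\<in>UNIV. e i * vert s d p q i) \<le> (\<Sum>i\<in>UNIV. e i * Y i)"
    and "\<lbrakk>0 < Y r; Y p < s - d p; e p \<noteq> e r\<rbrakk> \<Longrightarrow>
      (\<Sum>i\<in>UNIV. e i * vert s d p q i) < (\<Sum>i\<in>UNIV. e i * Y i)"
    by linarith+
qed

text \<open>In the application, the slack in \<open>d_le\<close> is the weight of the goods located
  at \<beta>. Equality and zeros are allowed, so the hexagon may degenerate.\<close>

locale hexagon =
  fixes b \<beta> :: "real^3" and s :: real and d :: "3 \<Rightarrow> real"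
  assumes \<beta>_pos: "0 < \<beta> $ i" and d_nonneg: "0 \<le> d i" and d_le: "(\<Sum>i\<in>UNIV. d i) \<le> s"
begin

abbreviation "V \<equiv> vert s d"
abbreviation "P \<equiv> point b \<beta>"
definition "hex = P ` region s d"

lemma P_inj [simp]: "P Y = P Z \<longleftrightarrow> Y = Z"
  using \<beta>_pos by (auto simp: point_def vec_eq_iff fun_eq_iff less_imp_neq[symmetric])

lemma d_le3: "three p q r \<Longrightarrow> d p + d q + d r \<le> s"
  using d_le by (simp add: three_sum)

lemma V_region: assumes "p \<noteq> q" shows "V p q \<in> region s d"
proof -
  obtain r where r: "three p q r" using ex_three2[OF assms] by blast
  show ?thesis
    using d_le3[OF r] d_nonneg[of p] d_nonneg[of q] d_nonneg[of r] threeD[OF r]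
    by (auto simp: region_def vert_def three_sum[OF r] three_all[OF r])
qed

lemma convex_hex: "convex hex"
proof (rule convexI)
  fix x y and u v :: real
  assume "x \<in> hex" "y \<in> hex" and uv: "0 \<le> u" "0 \<le> v" "u + v = 1"
  then obtain Y Z where x: "x = P Y" "Y \<in> region s d" and y: "y = P Z" "Z \<in> region s d"
    by (auto simp: hex_def)
  have u: "u = 1 - v" using uv by simp
  have "u *\<^sub>R x + v *\<^sub>R y = P (\<lambda>i. u * Y i + v * Z i)"
    unfolding x y u by (simp add: point_def vec_eq_iff algebra_simps)
  moreover have "(\<lambda>i. u * Y i + v * Z i) \<in> region s d"
  proof -
    have "u * Y i + v * Z i \<le> s - d i" for i
      using convex_bound_le[of "Y i" "s - d i" "Z i" u v] x y uv by (simp add: region_def)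
    moreover have "(\<Sum>i\<in>UNIV. u * Y i + v * Z i) = s"
      using x y uv by (simp add: region_def sum.distrib flip: sum_distrib_left distrib_right)
    ultimately show ?thesis using x y uv by (simp add: region_def)
  qed
  ultimately show "u *\<^sub>R x + v *\<^sub>R y \<in> hex" by (auto simp: hex_def)
qed

text \<open>Sorting the players by the coefficients \<open>n $ i * \<beta> $ i\<close> gives the
  greedy order: the player with the smallest coefficient takes as much as possible.\<close>

lemma V_minimal:
  assumes "Y \<in> region s d"
  shows "\<exists>p q. p \<noteq> q \<and> n \<bullet> P (V p q) \<le> n \<bullet> P Y"
proof -
  obtain p q r where r: "three p q r"
    and "n $ p * \<beta> $ p \<le> n $ q * \<beta> $ q" "n $ q * \<beta> $ q \<le> n $ r * \<beta> $ r"
    using ex_three_sorted[of "\<lambda>i. n $ i * \<beta> $ i"] by auto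
  then have "n \<bullet> P (V p q) \<le> n \<bullet> P Y"
    using vert_minimal(1)[OF r assms, of "\<lambda>i. n $ i * \<beta> $ i"] by (simp add: inner_point)
  then show ?thesis using threeD[OF r] by blast
qed

text \<open>A functional separating a point of \<open>hex\<close> from \<open>K\<close> would be
  smaller at that point than on all of \<open>K\<close>, but it is at least as small at some greedy
  vertex, which lies in \<open>K\<close>.\<close>

lemma hex_subset:
  assumes "convex K" "closed K" "\<And>p q. p \<noteq> q \<Longrightarrow> P (V p q) \<in> K"
  shows "hex \<subseteq> K"
proof
  fix x assume "x \<in> hex"
  then obtain Y where Y: "x = P Y" "Y \<in> region s d" by (auto simp: hex_def)
  show "x \<in> K"
  proof (rule ccontr)
    assume "x \<notin> K"
    then obtain n k where "n \<bullet> x < k" "\<And>y. y \<in> K \<Longrightarrow> k < n \<bullet> y"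
      using separating_hyperplane_closed_point[OF assms(1,2)] by metis
    moreover obtain p q where "p \<noteq> q" "n \<bullet> P (V p q) \<le> n \<bullet> x"
      using V_minimal[OF Y(2)] Y(1) by blast
    ultimately show False using assms(3) by fastforce
  qed
qed

lemma hex_eq_hull:
  assumes "three p q r"
  shows "hex = convex hull P ` {V p q, V q p, V q r, V r q, V r p, V p r}" (is "_ = convex hull ?S")
proof
  have "P (V p' q') \<in> ?S" if "p' \<noteq> q'" for p' q'
    using that three_cases[OF assms, of p'] three_cases[OF assms, of q'] by auto
  then have "P (V p' q') \<in> convex hull ?S" if "p' \<noteq> q'" for p' q'
    using that hull_inc by metis
  moreover have "closed (convex hull ?S)"
    by (intro compact_imp_closed finite_imp_compact_convex_hull) simp
  ultimately show "hex \<subseteq> convex hull ?S" by (intro hex_subset convex_convex_hull)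
  show "convex hull ?S \<subseteq> hex"
    using V_region threeD[OF assms] by (intro hull_minimal convex_hex) (auto simp: hex_def)
qed

text \<open>Since \<open>d i < s\<close>, every inequality is strict at some vertex, so a tight one
  puts the point on a proper face. Conversely, where no inequality is tight, a functional supporting
  \<open>hex\<close> would be beaten by its greedy vertex, unless it is constant on
  \<open>hex\<close>.\<close>

lemma P_rel_interior:
  assumes "Y \<in> region s d" "\<And>i. d i < s"
  shows "P Y \<in> rel_interior hex \<longleftrightarrow> (\<forall>i. 0 < Y i \<and> Y i < s - d i)"
proof
  assume *: "\<forall>i. 0 < Y i \<and> Y i < s - d i"
  show "P Y \<in> rel_interior hex"
  proof (rule ccontr)
    assume "P Y \<notin> rel_interior hex"
    moreover have "P Y \<in> hex" using assms(1) by (simp add: hex_def)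
    ultimately obtain n where n: "\<And>y. y \<in> hex \<Longrightarrow> n \<bullet> P Y \<le> n \<bullet> y"
      "\<And>y. y \<in> rel_interior hex \<Longrightarrow> n \<bullet> P Y < n \<bullet> y"
      using supporting_hyperplane_rel_boundary[OF convex_hex, of "P Y"] by metis
    have "rel_interior hex \<noteq> {}"
      using rel_interior_eq_empty[OF convex_hex] \<open>P Y \<in> hex\<close> by blast
    then obtain y where y: "y \<in> rel_interior hex" by blast
    then have "y \<in> hex" using rel_interior_subset by blast
    then obtain Z where Z: "y = P Z" "Z \<in> region s d" unfolding hex_def by blast
    let ?e = "\<lambda>i. n $ i * \<beta> $ i"
    obtain p q r where r: "three p q r" and le: "?e p \<le> ?e q" "?e q \<le> ?e r"
      using ex_three_sorted[of ?e] by auto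
    show False
    proof (cases "?e p = ?e r")
      \<comment> \<open>Equal coefficients make the functional a multiple of the total share, which
        is \<open>s\<close> throughout the region. This contradicts the strict inequality at
        \<open>y\<close>.\<close>
      case True
      then have "?e q = ?e p" "?e r = ?e p" using le by linarith+
      then have const: "?e i = ?e p" for i using three_cases[OF r, of i] by (elim disjE) simp_all
      have "(\<Sum>i\<in>UNIV. ?e i * W i) = ?e p * s" if "W \<in> region s d" for W
      proof -
        have "(\<Sum>i\<in>UNIV. ?e i * W i) = (\<Sum>i\<in>UNIV. ?e p * W i)"
          by (intro sum.cong refl arg_cong2[of _ _ _ _ "(*)"] const)
        then show ?thesis using that by (simp add: region_def flip: sum_distrib_left)
      qed
      then show ?thesis using n(2)[OF y] Z assms(1) by (simp add: inner_point)
    next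
      case False
      then have "n \<bullet> P (V p q) < n \<bullet> P Y"
        using vert_minimal(2)[OF r assms(1), of ?e] le * by (simp add: inner_point)
      moreover have "P (V p q) \<in> hex" using V_region threeD[OF r] by (auto simp: hex_def)
      ultimately show ?thesis using n(1) by fastforce
    qed
  qed
next
  assume int: "P Y \<in> rel_interior hex"
  \<comment> \<open>A supporting plane that misses a vertex cuts out a proper face, and proper faces
    avoid the relative interior.\<close>
  have False if "n \<bullet> P Y = m" "\<And>Z. Z \<in> region s d \<Longrightarrow> m \<le> n \<bullet> P Z" "p \<noteq> q" "n \<bullet> P (V p q) \<noteq> m"
    for n m p q
  proof -
    have "hex \<inter> {x. n \<bullet> x = m} face_of hex"
      using that(2) by (intro face_of_Int_supporting_hyperplane_ge convex_hex) (auto simp: hex_def)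
    moreover have "P (V p q) \<in> hex" using V_region that(3) by (auto simp: hex_def)
    ultimately have "hex \<inter> {x. n \<bullet> x = m} \<inter> rel_interior hex = {}"
      using face_of_disjoint_rel_interior that(4) by blast
    then show False using int that(1) rel_interior_subset by blast
  qed
  note no_side = this
  show "\<forall>i. 0 < Y i \<and> Y i < s - d i"
  proof (rule allI, rule ccontr)
    fix i
    obtain q r where r: "three i q r" using ex_three by blast
    note iq = threeD[OF r]
    have axis: "axis i c \<bullet> P Z = c * (b $ i + \<beta> $ i * Z i)" for c Z
      by (simp add: inner_axis' point_def)
    assume "\<not> (0 < Y i \<and> Y i < s - d i)"
    moreover have "0 \<le> Y i" "Y i \<le> s - d i" using assms(1) by (simp_all add: region_def)
    ultimately consider "Y i = 0" | "Y i = s - d i" by linarith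
    then show False
    proof cases
      case 1
      \<comment> \<open>The missed vertex is \<open>V i q\<close>, whose coordinate
        \<open>s - d i\<close> is positive.\<close>
      show False
        by (rule no_side[of "axis i 1" "b $ i" i q])
          (use 1 iq assms(2)[of i] \<beta>_pos[of i] in \<open>auto simp: axis region_def vert_def\<close>)
    next
      case 2
      \<comment> \<open>The negative axis turns the upper bound into a lower one. The missed vertex
        is \<open>V q r\<close>, whose coordinate at \<open>i\<close> is 0.\<close>
      show False
        by (rule no_side[of "axis i (-1)" "- (b $ i + \<beta> $ i * (s - d i))" q r])
          (use 2 iq assms(2)[of i] \<beta>_pos[of i] in
            \<open>auto simp: axis region_def vert_def mult_le_cancel_left\<close>)
    qed
  qed
qed

text \<open>A side is cut off by one coordinate \<open>i\<close> and a factor \<open>c\<close>,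
  positive where the coordinate is smallest and negative where it is largest.\<close>

lemma polygon_points:
  assumes hull: "hex = convex hull P ` set Ys" and "distinct Ys" "3 \<le> length Ys"
    and "set Ys \<subseteq> region s d"
    and sides: "\<And>k. k < length Ys \<Longrightarrow> \<exists>i c. c * (Ys ! k) i = c * (Ys ! (Suc k mod length Ys)) i \<and>
      (\<forall>Y\<in>set Ys - {Ys ! k, Ys ! (Suc k mod length Ys)}. c * (Ys ! k) i < c * Y i)"
  shows "polygon hex (map P Ys)"
proof (rule polygonI)
  show "distinct (map P Ys)" using assms(2) by (simp add: distinct_map inj_on_def)
  show "3 \<le> length (map P Ys)" using assms(3) by simp
  show "hex = convex hull set (map P Ys)" using hull by simp
  \<comment> \<open>Pairing with the reciprocals of \<beta> recovers the total share up to a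
    constant, so this is a normal vector of the plane of the face.\<close>
  let ?g = "(\<chi> i. 1 / \<beta> $ i) :: real^3"
  have "?g $ 1 \<noteq> 0" using \<beta>_pos[of 1] by simp
  then show "?g \<noteq> 0" by (metis zero_index)
  fix v assume "v \<in> set (map P Ys)"
  then obtain Y where "Y \<in> region s d" "v = P Y" using assms(4) by auto
  moreover have "?g $ i * \<beta> $ i * Y i = Y i" for i using \<beta>_pos[of i] by simp
  ultimately show "?g \<bullet> v = ?g \<bullet> b + s" by (simp only: inner_point) (simp add: region_def)
next
  fix k assume "k < length (map P Ys)"
  then have k: "k < length Ys" by simp
  have k': "Suc k mod length Ys < length Ys" using assms(3) by (intro mod_less_divisor) linarith
  obtain i c where ic: "c * (Ys ! k) i = c * (Ys ! (Suc k mod length Ys)) i"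
      "\<forall>Y\<in>set Ys - {Ys ! k, Ys ! (Suc k mod length Ys)}. c * (Ys ! k) i < c * Y i"
    using sides[OF k] by blast
  let ?n = "axis i (c / \<beta> $ i) :: real^3"
  have n: "?n \<bullet> P Y = c / \<beta> $ i * b $ i + c * Y i" for Y
    using \<beta>_pos[of i] by (simp add: inner_axis' point_def field_simps)
  show "\<exists>n m. n \<bullet> map P Ys ! k = m \<and> n \<bullet> map P Ys ! (Suc k mod length (map P Ys)) = m \<and>
      (\<forall>v\<in>set (map P Ys) - {map P Ys ! k, map P Ys ! (Suc k mod length (map P Ys))}. m < n \<bullet> v)"
    using ic k k' by (intro exI[of _ ?n] exI[of _ "?n \<bullet> P (Ys ! k)"]) (auto simp: n)
qed

text \<open>Restricted to sides on which a coordinate vanishes: these are the longer sides of the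
  parallel pairs, on which the additional integer values are counted.\<close>

lemma open_side_points:
  assumes hull: "hex = convex hull P ` set Ys" and "k < length Ys" "Suc k mod length Ys < length Ys"
    and "(Ys ! k) i = 0" "(Ys ! (Suc k mod length Ys)) i = 0"
    and "\<forall>Y\<in>set Ys - {Ys ! k, Ys ! (Suc k mod length Ys)}. 0 < Y i" and Y: "Y \<in> region s d"
  shows "P Y \<in> open_side (map P Ys) k \<longleftrightarrow>
    Y i = 0 \<and> Y \<noteq> Ys ! k \<and> Y \<noteq> Ys ! (Suc k mod length Ys)"
proof -
  let ?n = "axis i 1 :: real^3"
  have n: "?n \<bullet> P Y = b $ i + \<beta> $ i * Y i" for Y by (simp add: inner_axis' point_def)
  have "convex hull (P ` set Ys) \<inter> {x. ?n \<bullet> x = b $ i}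
      = closed_segment (P (Ys ! k)) (P (Ys ! (Suc k mod length Ys)))"
    by (rule convex_hull_Int_supporting_plane(1)) (use assms(2-6) \<beta>_pos[of i] in \<open>auto simp: n\<close>)
  moreover have "P Y \<in> convex hull (P ` set Ys)" using Y by (simp add: hex_def flip: hull)
  ultimately have "P Y \<in> closed_segment (P (Ys ! k)) (P (Ys ! (Suc k mod length Ys)))
      \<longleftrightarrow> ?n \<bullet> P Y = b $ i"
    by blast
  also have "\<dots> \<longleftrightarrow> Y i = 0" using \<beta>_pos[of i] by (simp add: n)
  finally have "P Y \<in> closed_segment (P (Ys ! k)) (P (Ys ! (Suc k mod length Ys))) \<longleftrightarrow> Y i = 0" .
  then show ?thesis using assms(2,3) by (auto simp: open_side_def open_segment_def)
qed

lemma parallel_sides_points: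
  assumes "distinct Ys" "k < length Ys" "l < length Ys" "2 \<le> length Ys"
  shows "parallel_sides (map P Ys) k l \<longleftrightarrow> (\<exists>t. \<forall>i.
    (Ys ! (Suc l mod length Ys)) i - (Ys ! l) i = t * ((Ys ! (Suc k mod length Ys)) i - (Ys ! k) i))"
proof -
  let ?n = "\<lambda>k. Suc k mod length Ys"
  have less: "?n k < length Ys" for k using assms(4) by (intro mod_less_divisor) linarith
  have neq: "Ys ! k \<noteq> Ys ! ?n k" if "k < length Ys" for k
  proof -
    have "?n k \<noteq> k" using that assms(4) by (cases "Suc k = length Ys") auto
    then show ?thesis using assms(1) less[of k] that by (simp add: nth_eq_iff_index_eq)
  qed
  have "P Y' - P Y = t *\<^sub>R (P Z' - P Z) \<longleftrightarrow> (\<forall>i. Y' i - Y i = t * (Z' i - Z i))" for Y Y' Z Z' t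
    using \<beta>_pos by (simp add: vec_eq_iff point_def mult.left_commute[of t] less_imp_neq[symmetric]
      flip: right_diff_distrib)
  then show ?thesis
    using assms(2,3) less neq
    by (simp add: parallel_sides_def side_def affine_parallel_segments
      del: affine_hull_closed_segment)
qed

text \<open>\<open>P\<close> scales the axes differently and so distorts lengths, but segments with
  the same direction are stretched by the same factor. Only ratios of parallel sides can therefore
  be read off from shares.\<close>

lemma side_length_points:
  assumes "k < length Ys" "l < length Ys" "2 \<le> length Ys"
    and "\<And>i. (Ys ! (Suc l mod length Ys)) i - (Ys ! l) i
      = t * ((Ys ! (Suc k mod length Ys)) i - (Ys ! k) i)"
  shows "side_length (map P Ys) l = \<bar>t\<bar> * side_length (map P Ys) k"
proof -
  let ?n = "\<lambda>k. Suc k mod length Ys"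
  have less: "?n k < length Ys" for k using assms(3) by (intro mod_less_divisor) linarith
  have "P (Ys ! ?n l) - P (Ys ! l) = t *\<^sub>R (P (Ys ! ?n k) - P (Ys ! k))"
    using assms(4) by (simp add: vec_eq_iff point_def mult.left_commute[of t]
      flip: right_diff_distrib)
  then have "norm (P (Ys ! ?n l) - P (Ys ! l)) = \<bar>t\<bar> * norm (P (Ys ! ?n k) - P (Ys ! k))"
    by simp
  then show ?thesis
    using assms(1,2) less by (simp add: side_length_def dist_norm norm_minus_commute)
qed

end

lemma vert_apply [simp]:
  "vert s d p q p = s - d p" "p \<noteq> q \<Longrightarrow> vert s d p q q = d p"
  "i \<noteq> p \<Longrightarrow> i \<noteq> q \<Longrightarrow> vert s d p q i = 0"
  by (auto simp: vert_def)

section \<open>The hexagon, its degenerate shapes, and the comparison of opposite sides\<close>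

context hexagon begin

text \<open>\<open>ds\<close> lists, for each side, the coordinate that cuts it off and a sign: 1
  where this coordinate vanishes, -1 where it attains its upper bound. With a numeral for
  \<open>n\<close>, the condition on all sides expands into finitely many comparisons.\<close>

lemma polygon_directions:
  assumes "hex = convex hull P ` set Ys" "distinct Ys" "set Ys \<subseteq> region s d"
    and "length Ys = n" "3 \<le> n"
    and "\<forall>k\<in>{..<n}. snd (ds ! k) * (Ys ! k) (fst (ds ! k)) =
        snd (ds ! k) * (Ys ! (Suc k mod n)) (fst (ds ! k)) \<and>
      (\<forall>Y\<in>set Ys - {Ys ! k, Ys ! (Suc k mod n)}.
        snd (ds ! k) * (Ys ! k) (fst (ds ! k)) < snd (ds ! k) * Y (fst (ds ! k)))"
  shows "polygon hex (map P Ys)"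
proof (rule polygon_points)
  fix k assume "k < length Ys"
  then show "\<exists>i c. c * (Ys ! k) i = c * (Ys ! (Suc k mod length Ys)) i \<and>
      (\<forall>Y\<in>set Ys - {Ys ! k, Ys ! (Suc k mod length Ys)}. c * (Ys ! k) i < c * Y i)"
    using assms(4,6) by (intro exI[of _ "fst (ds ! k)"] exI[of _ "snd (ds ! k)"]) blast
qed (use assms in simp_all)

lemma atMost_numerals:
  "{..<3::nat} = {0, 1, 2}" "{..<4::nat} = {0, 1, 2, 3}" "{..<5::nat} = {0, 1, 2, 3, 4}"
  "{..<6::nat} = {0, 1, 2, 3, 4, 5}"
  by auto

text \<open>Going around, sides where one player gets nothing alternate with sides where one player
  takes the maximum: exchanging the two indices of \<open>V\<close> moves along the former,
  exchanging the second index for the third player along the latter.\<close>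

lemma polygon_hexagon:
  assumes pqr: "three p q r" and pos: "0 < d p" "0 < d q" "0 < d r"
  shows "polygon hex (map P [V p q, V q p, V q r, V r q, V r p, V p r])"
proof (rule polygon_directions[where n = 6 and
    ds = "[(r, 1), (q, -1), (p, 1), (r, -1), (q, 1), (p, -1)]"])
  show "hex = convex hull P ` set [V p q, V q p, V q r, V r q, V r p, V p r]"
    using hex_eq_hull[OF pqr] by simp
qed (use pos d_le3[OF pqr] V_region in
      \<open>auto simp: threeD[OF pqr] three_fun_eq[OF pqr] atMost_numerals\<close>)

text \<open>If \<open>d r = 0\<close>, the side where \<open>r\<close> takes the maximum shrinks to
  the point \<open>V r p = V r q\<close>. In the trapezoid and the triangle below, this happens for
  two and for three players.\<close>

lemma polygon_pentagon:
  assumes pqr: "three p q r" and pos: "0 < d p" "0 < d q" "d r = 0" "d p + d q < s"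
  shows "polygon hex (map P [V p q, V q p, V q r, V r q, V p r])"
proof (rule polygon_directions[where n = 5 and
    ds = "[(r, 1), (q, -1), (p, 1), (q, 1), (p, -1)]"])
  have "V r p = V r q" using pos by (simp add: threeD[OF pqr] three_fun_eq[OF pqr])
  then show "hex = convex hull P ` set [V p q, V q p, V q r, V r q, V p r]"
    using hex_eq_hull[OF pqr] by simp
qed (use pos d_le3[OF pqr] V_region in
      \<open>auto simp: threeD[OF pqr] three_fun_eq[OF pqr] atMost_numerals\<close>)

lemma polygon_trapezoid:
  assumes pqr: "three p q r" and pos: "0 < d p" "d q = 0" "d r = 0" "d p < s"
  shows "polygon hex (map P [V q r, V r q, V p r, V p q])"
proof (rule polygon_directions[where n = 4 and
    ds = "[(p, 1), (q, 1), (p, -1), (r, 1)]"])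
  have "V r p = V r q" "V q p = V q r" using pos by (simp_all add: threeD[OF pqr] three_fun_eq[OF pqr])
  then show "hex = convex hull P ` set [V q r, V r q, V p r, V p q]"
    using hex_eq_hull[OF pqr] by (simp add: insert_commute)
qed (use pos d_le3[OF pqr] V_region in
      \<open>auto simp: threeD[OF pqr] three_fun_eq[OF pqr] atMost_numerals\<close>)

text \<open>Without slack in \<open>d_le\<close>, a vanishing \<open>d r\<close> shrinks both sides
  of one direction: the one where \<open>r\<close> takes the maximum and the one where
  \<open>r\<close> gets nothing.\<close>

lemma polygon_parallelogram:
  assumes pqr: "three p q r" and pos: "0 < d p" "0 < d q" "d r = 0" "s = d p + d q"
  shows "polygon hex (map P [V p q, V q r, V r q, V p r])"
proof (rule polygon_directions[where n = 4 and
    ds = "[(q, -1), (p, 1), (q, 1), (p, -1)]"])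
  have "V r p = V r q" "V q p = V p q" using pos by (simp_all add: threeD[OF pqr] three_fun_eq[OF pqr])
  then show "hex = convex hull P ` set [V p q, V q r, V r q, V p r]"
    using hex_eq_hull[OF pqr] by (simp add: insert_commute)
qed (use pos d_le3[OF pqr] V_region in
      \<open>auto simp: threeD[OF pqr] three_fun_eq[OF pqr] atMost_numerals\<close>)

lemma polygon_triangle:
  assumes pqr: "three p q r" and pos: "d p = 0" "d q = 0" "d r = 0" "0 < s"
  shows "polygon hex (map P [V p q, V q r, V r p])"
proof (rule polygon_directions[where n = 3 and ds = "[(r, 1), (p, 1), (q, 1)]"])
  have "V p r = V p q" "V r p = V r q" "V q p = V q r"
    using pos by (simp_all add: threeD[OF pqr] three_fun_eq[OF pqr])
  then show "hex = convex hull P ` set [V p q, V q r, V r p]"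
    using hex_eq_hull[OF pqr] by (simp add: insert_commute)
qed (use pos d_le3[OF pqr] V_region in
      \<open>auto simp: threeD[OF pqr] three_fun_eq[OF pqr] atMost_numerals\<close>)

text \<open>Along both sides only \<open>p\<close> and \<open>q\<close> exchange weight:
  \<open>s - d p - d q\<close> where \<open>r\<close> gets nothing, and only \<open>d r\<close>
  where \<open>r\<close> takes the maximum.\<close>

lemma opposite_sides:
  assumes pqr: "three p q r" and pos: "0 < s - d p - d q"
  shows "V r p i - V r q i = - (d r / (s - d p - d q)) * (V q p i - V p q i)"
proof -
  have "\<forall>i. (V r p i - V r q i) * (s - d p - d q) = - d r * (V q p i - V p q i)"
    by (simp add: three_all[OF pqr] threeD[OF pqr] algebra_simps)
  then have "(V r p i - V r q i) * (s - d p - d q) = - d r * (V q p i - V p q i)" by blast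
  then have "V r p i - V r q i = - d r * (V q p i - V p q i) / (s - d p - d q)"
    by (rule eq_divide_imp[rotated]) (use pos in simp)
  then show ?thesis by simp
qed

text \<open>A cyclic list traverses opposite sides in opposite senses, hence the factor
  \<open>- t\<close>.\<close>

lemma antiparallel_sides:
  assumes "distinct Ys" "k < length Ys" "l < length Ys" "2 \<le> length Ys"
    and "\<And>i. (Ys ! (Suc l mod length Ys)) i - (Ys ! l) i
      = - t * ((Ys ! (Suc k mod length Ys)) i - (Ys ! k) i)"
    and "0 \<le> t"
  shows "parallel_sides (map P Ys) k l" "side_length (map P Ys) l = t * side_length (map P Ys) k"
    and "0 < side_length (map P Ys) k"
proof -
  show "parallel_sides (map P Ys) k l"
    unfolding parallel_sides_points[OF assms(1-4)] using assms(5) by blast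
  show "side_length (map P Ys) l = t * side_length (map P Ys) k"
    using side_length_points[OF assms(2-4), of "- t"] assms(5,6) by simp
  have "Suc k mod length Ys < length Ys" using assms(4) by (intro mod_less_divisor) linarith
  moreover have "Suc k mod length Ys \<noteq> k" using assms(2,4) by (cases "Suc k = length Ys") auto
  ultimately show "0 < side_length (map P Ys) k"
    using assms(1,2) by (simp add: side_length_def nth_eq_iff_index_eq)
qed

text \<open>On side \<open>k\<close> player \<open>r\<close> gets nothing, on side \<open>l\<close>
  the maximum; by \<open>d_le\<close>, side \<open>k\<close> is never the shorter one. The other
  pairs of sides are obtained by rotating \<open>p\<close>, \<open>q\<close>,
  \<open>r\<close>.\<close>

lemma opposite_sides_points:
  assumes "distinct Ys" "k < length Ys" "l < length Ys" "2 \<le> length Ys" "three p q r"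
    and "0 < s - d p - d q"
    and "Ys ! k = V p q" "Ys ! (Suc k mod length Ys) = V q p"
    and "Ys ! l = V r q" "Ys ! (Suc l mod length Ys) = V r p"
  shows "parallel_sides (map P Ys) k l"
    and "d r = s - d p - d q \<Longrightarrow> side_length (map P Ys) l = side_length (map P Ys) k"
    and "d r < s - d p - d q \<Longrightarrow> side_length (map P Ys) l < side_length (map P Ys) k"
proof -
  note sides = antiparallel_sides[OF assms(1-4), of "d r / (s - d p - d q)"]
  have "(Ys ! (Suc l mod length Ys)) i - (Ys ! l) i =
      - (d r / (s - d p - d q)) * ((Ys ! (Suc k mod length Ys)) i - (Ys ! k) i)" for i
    unfolding assms(7-10) by (rule opposite_sides[OF assms(5,6)])
  note sides = sides[OF this]
  have nonneg: "0 \<le> d r / (s - d p - d q)" using d_nonneg assms(6) by simp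
  show "parallel_sides (map P Ys) k l" by (rule sides(1)[OF nonneg])
  show "side_length (map P Ys) l = side_length (map P Ys) k" if "d r = s - d p - d q"
    using sides(2)[OF nonneg] that assms(6) by simp
  show "side_length (map P Ys) l < side_length (map P Ys) k" if "d r < s - d p - d q"
  proof -
    have "d r / (s - d p - d q) < 1" using that assms(6) by simp
    from mult_strict_right_mono[OF this sides(3)[OF nonneg]] show ?thesis
      unfolding sides(2)[OF nonneg] by simp
  qed
qed

end

section \<open>The position of a good relative to \<open>\<beta>\<close>\<close>

text \<open>The players to whom a functional with coefficients proportional to
  \<open>RD \<beta>\<close> prefers to give a good located at \<open>z\<close>. This set encodes the
  position of \<open>z\<close> relative to \<beta>: at \<beta> it contains all players, on a
  disputing segment two, inside a part one.\<close>

definition argmax :: "real^3 \<Rightarrow> real^3 \<Rightarrow> 3 set" where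
  "argmax \<beta> z = {i. \<forall>k. z $ k / \<beta> $ k \<le> z $ i / \<beta> $ i}"

lemma argmax_cases:
  obtains (all) "argmax \<beta> z = UNIV" | (two) i where "argmax \<beta> z = UNIV - {i}"
    | (one) i where "argmax \<beta> z = {i}"
proof -
  obtain p q r where pqr: "three p q r" and
    le: "z $ p / \<beta> $ p \<le> z $ q / \<beta> $ q" "z $ q / \<beta> $ q \<le> z $ r / \<beta> $ r"
    using ex_three_sorted[of "\<lambda>i. z $ i / \<beta> $ i"] by auto
  note arg = argmax_def three_all[OF pqr] set_eq_iff three_def
  consider "z $ p / \<beta> $ p = z $ r / \<beta> $ r"
    | "z $ p / \<beta> $ p < z $ r / \<beta> $ r" "z $ q / \<beta> $ q = z $ r / \<beta> $ r"
    | "z $ p / \<beta> $ p < z $ r / \<beta> $ r" "z $ q / \<beta> $ q < z $ r / \<beta> $ r"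
    using le by linarith
  then show ?thesis
  proof cases
    case 1
    have "argmax \<beta> z = UNIV" using 1 le by (auto simp: arg)
    then show ?thesis by (rule all)
  next
    case 2
    have "argmax \<beta> z = UNIV - {p}" using 2 le pqr by (auto simp: arg)
    then show ?thesis by (rule two)
  next
    case 3
    have "argmax \<beta> z = {r}" using 3 le pqr by (auto simp: arg)
    then show ?thesis by (rule one)
  qed
qed

lemma argmax_two_iff:
  "argmax \<beta> z = UNIV - {i} \<longleftrightarrow> (\<exists>c. \<forall>k. if k = i then z $ k / \<beta> $ k < c else z $ k / \<beta> $ k = c)"
proof -
  obtain q r where "three i q r" using ex_three by blast
  then show ?thesis by (auto simp: argmax_def three_all set_eq_iff threeD)
qed

lemma argmax_one_iff:
  "argmax \<beta> z = {i} \<longleftrightarrow> (\<forall>k. k \<noteq> i \<longrightarrow> z $ k / \<beta> $ k < z $ i / \<beta> $ i)"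
proof -
  obtain q r where "three i q r" using ex_three by blast
  then show ?thesis by (auto simp: argmax_def three_all set_eq_iff threeD)
qed

lemma three_sets_distinct [simp]:
  "UNIV - {i} \<noteq> {k :: 3}" "{k :: 3} \<noteq> UNIV - {i}" "UNIV \<noteq> {k :: 3}" "{k :: 3} \<noteq> UNIV"
proof -
  have "card (UNIV - {i}) = 2" "card (UNIV :: 3 set) = 3" "card {k} = 1"
    by (simp_all add: card_Diff_subset)
  then show "UNIV - {i} \<noteq> {k :: 3}" "{k :: 3} \<noteq> UNIV - {i}" "UNIV \<noteq> {k :: 3}" "{k :: 3} \<noteq> UNIV"
    by (metis numeral_eq_one_iff semiring_norm(85,86) num.distinct)+
qed

lemma UNIV_minus_inj [simp]: "UNIV - {i} = UNIV - {k} \<longleftrightarrow> i = k" "UNIV \<noteq> UNIV - {i}"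
  "UNIV - {i} \<noteq> UNIV"
  by auto

lemma argmax_scale: "0 < c \<Longrightarrow> argmax \<beta> (c *\<^sub>R z) = argmax \<beta> z"
  by (simp add: argmax_def mult_le_cancel_left_pos flip: times_divide_eq_right)

lemma ray_in_closed_segment:
  fixes u v :: "'a::real_vector"
  assumes "0 \<le> x" "x \<le> y"
  shows "u + x *\<^sub>R (u - v) \<in> closed_segment (u + y *\<^sub>R (u - v)) v"
proof -
  \<comment> \<open>Comparing the coefficients of \<open>u\<close> in the desired identity gives
    \<open>(1 - w) * (1 + y) = 1 + x\<close>.\<close>
  define w where "w = (y - x) / (1 + y)"
  have w: "(1 - w) * (1 + y) = 1 + x" "0 \<le> w" "w \<le> 1"
    using assms by (simp_all add: w_def field_simps)
  have "(1 - w) *\<^sub>R (u + y *\<^sub>R (u - v)) + w *\<^sub>R v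
      = ((1 - w) * (1 + y)) *\<^sub>R u - ((1 - w) * (1 + y) - 1) *\<^sub>R v"
    by (simp add: algebra_simps)
  also have "\<dots> = u + x *\<^sub>R (u - v)" unfolding w(1) by (simp add: algebra_simps)
  finally show ?thesis using w unfolding in_segment by (intro exI[of _ w]) simp
qed

lemma vertex_nth: "vertex i $ k = (if k = i then 1 else 0)"
  by (simp add: vertex_def axis_def)

context
  fixes \<beta> :: "real^3"
  assumes \<beta>: "\<beta> \<in> open_simplex2"
begin

lemma \<beta>_pos: "0 < \<beta> $ i"
  using \<beta> by (simp add: open_simplex2_def)

lemma \<beta>_sum: "(\<Sum>i\<in>UNIV. \<beta> $ i) = 1"
  using \<beta> by (simp add: open_simplex2_def simplex2_def)

text \<open>If all ratios agree, \<open>z\<close> is a multiple of \<beta>, and the coordinate sums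
  force the factor 1.\<close>

lemma argmax_UNIV_iff:
  assumes "z \<in> simplex2" shows "argmax \<beta> z = UNIV \<longleftrightarrow> z = \<beta>"
proof
  assume "argmax \<beta> z = UNIV"
  then have "\<forall>i k. z $ k / \<beta> $ k = z $ i / \<beta> $ i"
    by (auto simp: argmax_def set_eq_iff intro: order_antisym)
  then obtain c where c0: "z $ k / \<beta> $ k = c" for k by blast
  have c: "z $ k = c * \<beta> $ k" for k
    using c0[of k, symmetric] \<beta>_pos[of k] by simp
  have "1 = (\<Sum>k\<in>UNIV. c * \<beta> $ k)" using assms c by (simp add: simplex2_def)
  also have "\<dots> = c" using \<beta>_sum by (simp flip: sum_distrib_left)
  finally show "z = \<beta>" using c by (simp add: vec_eq_iff)
next
  assume "z = \<beta>" then show "argmax \<beta> z = UNIV"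
    using \<beta>_pos by (auto simp: argmax_def less_imp_neq[symmetric])
qed

text \<open>Moving away from vertex \<open>i\<close> by \<open>t\<close> multiplies every coordinate
  except \<open>i\<close> by \<open>1 + t\<close>. Conversely \<open>t\<close> is
  \<open>c - 1\<close>, where \<open>c\<close> is the common ratio of the two other players; it
  exceeds 1 because both coordinate sums are 1 and the ratio of \<open>i\<close> is smaller.\<close>

lemma argmax_disputing_segment:
  assumes "z \<in> simplex2"
  shows "z \<in> disputing_segment \<beta> i \<longleftrightarrow> argmax \<beta> z = UNIV - {i}"
proof
  assume "z \<in> disputing_segment \<beta> i"
  then obtain t where t: "0 < t" "z = \<beta> + t *\<^sub>R (\<beta> - vertex i)"
    by (auto simp: disputing_segment_def)
  have "z $ k / \<beta> $ k = (if k = i then 1 + t - t / \<beta> $ i else 1 + t)" for k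
    unfolding t using \<beta>_pos[of k] by (cases "k = i") (simp_all add: vertex_nth field_simps)
  then show "argmax \<beta> z = UNIV - {i}"
    unfolding argmax_two_iff using t(1) \<beta>_pos[of i] by (intro exI[of _ "1 + t"]) auto
next
  assume "argmax \<beta> z = UNIV - {i}"
  then obtain c where c: "\<And>k. k \<noteq> i \<Longrightarrow> z $ k / \<beta> $ k = c" "z $ i / \<beta> $ i < c"
    unfolding argmax_two_iff by metis
  obtain q r where qr: "three i q r" using ex_three by blast
  have "z $ k = c * \<beta> $ k" if "k \<noteq> i" for k
    using c(1)[OF that, symmetric] \<beta>_pos[of k] by simp
  then have q: "z $ q = c * \<beta> $ q" and r: "z $ r = c * \<beta> $ r" using threeD[OF qr] by blast+
  have i: "z $ i < c * \<beta> $ i" using c(2) \<beta>_pos[of i] by (simp add: pos_divide_less_eq)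
  have \<beta>1: "\<beta> $ i = 1 - \<beta> $ q - \<beta> $ r" using \<beta>_sum by (simp add: three_sum[OF qr])
  have z1: "z $ i = 1 - c * \<beta> $ q - c * \<beta> $ r"
    using assms q r by (simp add: simplex2_def three_sum[OF qr])
  then have "1 < c" using i \<beta>1 by (simp add: algebra_simps)
  moreover have "z $ i = \<beta> $ i + (c - 1) * (\<beta> $ i - 1)"
    unfolding z1 \<beta>1 by (simp add: algebra_simps)
  then have "z = \<beta> + (c - 1) *\<^sub>R (\<beta> - vertex i)"
    using q r by (simp add: vec_eq_iff three_all[OF qr] threeD[OF qr] vertex_nth algebra_simps)
  ultimately show "z \<in> disputing_segment \<beta> i"
    using assms unfolding disputing_segment_def by (intro IntI CollectI exI[of _ "c - 1"]) auto
qed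

text \<open>The sets \<open>W i\<close> are open and disjoint and cover the simplex without \<beta>
  and its disputing segments, so a connected set containing vertex \<open>i\<close> stays in
  \<open>W i\<close>. Conversely, \<open>W i\<close> meets the simplex in a convex, hence connected,
  set containing this vertex.\<close>

lemma argmax_part_of_vertex:
  assumes "z \<in> simplex2"
  shows "z \<in> part_of_vertex \<beta> i \<longleftrightarrow> argmax \<beta> z = {i}"
proof
  define T where "T = simplex2 - insert \<beta> (\<Union>k. disputing_segment \<beta> k)"
  define W where "W i = {z. argmax \<beta> z = {i}}" for i
  have T: "y \<in> T \<longleftrightarrow> y \<in> simplex2 \<and> (\<exists>i. y \<in> W i)" for y
    using argmax_UNIV_iff[of y] argmax_disputing_segment[of y]
    unfolding T_def W_def by (cases rule: argmax_cases[of \<beta> y]) auto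
  have W_eq: "W i = (\<Inter>k\<in>-{i}. {z. (axis k (1 / \<beta> $ k) - axis i (1 / \<beta> $ i)) \<bullet> z < 0})" for i
    unfolding argmax_one_iff W_def by (auto simp: inner_diff_left inner_axis')
  have open_W: "open (W i)" for i
    unfolding W_eq by (intro open_INT ballI open_halfspace_lt) simp
  have vertex: "vertex i \<in> W i" "vertex i \<in> simplex2"
    using \<beta>_pos by (auto simp: W_def argmax_one_iff vertex_nth simplex2_def)
  {
    assume "z \<in> part_of_vertex \<beta> i"
    then obtain C where C: "connected C" "C \<subseteq> T" "vertex i \<in> C" "z \<in> C"
      unfolding part_of_vertex_def connected_component_def T_def by auto
    have CW: "C \<subseteq> W i \<union> (\<Union>k\<in>-{i}. W k)"
    proof
      fix y assume "y \<in> C"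
      then have "y \<in> T" using C(2) by (rule set_mp[rotated])
      then obtain k where "y \<in> W k" unfolding T by (elim conjE exE)
      then show "y \<in> W i \<union> (\<Union>k\<in>-{i}. W k)" by (cases "k = i") auto
    qed
    moreover have "W i \<inter> (\<Union>k\<in>-{i}. W k) \<inter> C = {}" by (auto simp: W_def)
    moreover have "open (\<Union>k\<in>-{i}. W k)" using open_W by blast
    ultimately have "W i \<inter> C = {} \<or> (\<Union>k\<in>-{i}. W k) \<inter> C = {}"
      using open_W[of i] by (intro connectedD[OF C(1)])
    then have "(\<Union>k\<in>-{i}. W k) \<inter> C = {}" using C(3) vertex(1) by blast
    then have "z \<in> W i" using C(4) CW by blast
    then show "argmax \<beta> z = {i}" by (simp add: W_def)
  next
    assume z: "argmax \<beta> z = {i}"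
    have simplex: "simplex2 = (\<Inter>k. {z. axis k 1 \<bullet> z \<ge> 0}) \<inter> {z. (\<chi> k. 1) \<bullet> z = 1}"
      by (auto simp: simplex2_def inner_axis' inner_vec_def[of "\<chi> k. 1"])
    have "convex simplex2"
      unfolding simplex by (intro convex_Int convex_INT convex_halfspace_ge convex_hyperplane)
    moreover have "convex (W i)" unfolding W_eq by (intro convex_INT convex_halfspace_lt)
    ultimately have "connected (W i \<inter> simplex2)" by (intro convex_connected convex_Int)
    moreover have "W i \<inter> simplex2 \<subseteq> T" using T by blast
    moreover have "vertex i \<in> W i \<inter> simplex2" using vertex by blast
    ultimately have "W i \<inter> simplex2 \<subseteq> part_of_vertex \<beta> i"
      unfolding part_of_vertex_def T_def by (intro connected_component_maximal)
    then show "z \<in> part_of_vertex \<beta> i" using z assms by (auto simp: W_def)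
  }
qed

lemma in_closed_segment_vertex_iff:
  assumes "z \<in> simplex2"
  shows "\<beta> \<in> closed_segment z (vertex i) \<longleftrightarrow> z = \<beta> \<or> z \<in> disputing_segment \<beta> i"
proof
  assume "\<beta> \<in> closed_segment z (vertex i)"
  then obtain u where u: "0 \<le> u" "u \<le> 1" "\<beta> = (1 - u) *\<^sub>R z + u *\<^sub>R vertex i"
    by (auto simp: in_segment)
  obtain q r where qr: "three i q r" using ex_three by blast
  \<comment> \<open>Otherwise \<beta> would be a vertex of the simplex, which has zero
    coordinates.\<close>
  have "u \<noteq> 1" using u(3) \<beta>_pos[of q] threeD[OF qr] by (auto simp: vertex_nth)
  show "z = \<beta> \<or> z \<in> disputing_segment \<beta> i"
  proof (cases "u = 0")
    case True then show ?thesis using u(3) by simp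
  next
    case False
    have t: "u / (1 - u) * (1 - u) = u" using \<open>u \<noteq> 1\<close> by simp
    \<comment> \<open>This is the convex combination for \<beta> solved for \<open>z\<close>, with
      the parameter of the disputing segment equal to \<open>u / (1 - u)\<close>.\<close>
    have "z = \<beta> + (u / (1 - u)) *\<^sub>R (\<beta> - vertex i)"
    proof (rule vec_eq_iff[THEN iffD2, rule_format])
      fix k
      have "(1 - u) * (\<beta> $ k + u / (1 - u) * (\<beta> $ k - vertex i $ k))
          = (1 - u) * \<beta> $ k + (u / (1 - u) * (1 - u)) * (\<beta> $ k - vertex i $ k)"
        by (simp only: algebra_simps)
      also have "\<dots> = \<beta> $ k - u * vertex i $ k" unfolding t by (simp add: algebra_simps)
      also have "\<dots> = (1 - u) * z $ k"
        using arg_cong[OF u(3), of "\<lambda>x. x $ k"] by simp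
      finally show "z $ k = (\<beta> + (u / (1 - u)) *\<^sub>R (\<beta> - vertex i)) $ k"
        using \<open>u \<noteq> 1\<close> by simp
    qed
    moreover have "0 < u / (1 - u)" using u False \<open>u \<noteq> 1\<close> by simp
    ultimately show ?thesis using assms unfolding disputing_segment_def by blast
  qed
next
  assume "z = \<beta> \<or> z \<in> disputing_segment \<beta> i"
  then show "\<beta> \<in> closed_segment z (vertex i)"
  proof
    assume "z \<in> disputing_segment \<beta> i"
    then obtain t where t: "0 < t" "z = \<beta> + t *\<^sub>R (\<beta> - vertex i)"
      by (auto simp: disputing_segment_def)
    then show ?thesis using ray_in_closed_segment[of 0 t \<beta> "vertex i"] by simp
  qed simp
qed

text \<open>Both points lie on the ray from \<beta> away from vertex \<open>i\<close>, so the nearer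
  one is between the other and the vertex. This is why goods on one disputing segment are not
  s-independent.\<close>

lemma same_disputing_segment:
  assumes "z \<in> disputing_segment \<beta> i" "z' \<in> disputing_segment \<beta> i"
  shows "z \<in> closed_segment z' (vertex i) \<or> z' \<in> closed_segment z (vertex i)"
proof -
  obtain t where t: "0 < t" "z = \<beta> + t *\<^sub>R (\<beta> - vertex i)"
    using assms(1) by (auto simp: disputing_segment_def)
  obtain t' where t': "0 < t'" "z' = \<beta> + t' *\<^sub>R (\<beta> - vertex i)"
    using assms(2) by (auto simp: disputing_segment_def)
  show ?thesis
    unfolding t(2) t'(2) using t(1) t'(1) ray_in_closed_segment[of t t'] ray_in_closed_segment[of t' t]
    by (cases "t \<le> t'") auto
qed

text \<open>Moving toward vertex \<open>k\<close> multiplies the ratios of the two other players by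
  the same factor \<open>1 - u\<close>, which cannot change their order. But \<open>p\<close> is
  strictly last at \<open>z\<close> with the others tied, and \<open>q\<close> at \<open>z'\<close>,
  so for any \<open>k\<close> the two others disagree. If \<open>k = p\<close>, the tie at
  \<open>z\<close> would force \<open>u = 1\<close>, that is \<open>z = vertex p\<close>, where the
  ratio of \<open>p\<close> is not the smallest.\<close>

lemma disputing_segments_independent:
  assumes "z \<in> disputing_segment \<beta> p" "z' \<in> disputing_segment \<beta> q" "p \<noteq> q"
  shows "z \<notin> closed_segment z' (vertex k)"
proof
  assume "z \<in> closed_segment z' (vertex k)"
  then obtain u where u: "0 \<le> u" "u \<le> 1" "z = (1 - u) *\<^sub>R z' + u *\<^sub>R vertex k"
    by (auto simp: in_segment)
  obtain r where pqr: "three p q r" using ex_three2[OF assms(3)] by blast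
  let ?f = "\<lambda>z i. z $ i / \<beta> $ i"
  have sim: "z \<in> simplex2" "z' \<in> simplex2" using assms by (auto simp: disputing_segment_def)
  obtain c where c: "\<And>i. if i = p then ?f z i < c else ?f z i = c"
    using assms(1) argmax_disputing_segment[OF sim(1)] unfolding argmax_two_iff by blast
  obtain c' where c': "\<And>i. if i = q then ?f z' i < c' else ?f z' i = c'"
    using assms(2) argmax_disputing_segment[OF sim(2)] unfolding argmax_two_iff by blast
  have z: "?f z p < c" "?f z q = c" "?f z r = c" and z': "?f z' p = c'" "?f z' q < c'" "?f z' r = c'"
    using c[of p] c[of q] c[of r] c'[of p] c'[of q] c'[of r] threeD[OF pqr] by auto
  have f: "?f z i = (1 - u) * ?f z' i" if "i \<noteq> k" for i
    using that unfolding u(3) by (simp add: vertex_nth)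
  have "(1 - u) * ?f z' q \<le> (1 - u) * c'" using u z' by (intro mult_left_mono) auto
  moreover have "?f z k > 0" if "u = 1" unfolding u(3) using that \<beta>_pos by (simp add: vertex_nth)
  ultimately show False
  proof -
    consider "k = p" | "k = q" | "k = r" using three_cases[OF pqr] by blast
    then show False
    proof cases
      case 1
      then have "(1 - u) * ?f z' q = (1 - u) * c'" using f[of q] f[of r] z z' threeD[OF pqr] by simp
      then have "1 - u = 0 \<or> ?f z' q = c'" by (simp only: mult_cancel_left)
      then have "u = 1" using z' by simp
      then show False using f[of q] z 1 \<open>u = 1 \<Longrightarrow> ?f z k > 0\<close> threeD[OF pqr] by simp
    next
      case 2
      then show False using f[of p] f[of r] z z' threeD[OF pqr] by simp
    next
      case 3
      then show False
        using f[of p] f[of q] z z' threeD[OF pqr] \<open>(1 - u) * ?f z' q \<le> (1 - u) * c'\<close> by simp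
    qed
  qed
qed

end

section \<open>The face of \<open>\<beta>\<close>\<close>

lemma simplex_to_simplex:
  assumes "\<And>i. 0 < x $ i"
  shows "to_simplex x \<in> simplex2" and "to_simplex x = (1 / (\<Sum>i\<in>UNIV. x $ i)) *\<^sub>R x"
    and "0 < (\<Sum>i\<in>UNIV. x $ i)"
proof -
  show pos: "0 < (\<Sum>i\<in>UNIV. x $ i)" using assms by (intro sum_pos) auto
  then have "(\<Sum>i\<in>UNIV. x $ i / (\<Sum>i\<in>UNIV. x $ i)) = 1" by (simp flip: sum_divide_distrib)
  then show "to_simplex x \<in> simplex2"
    using assms pos by (simp add: to_simplex_def simplex2_def less_imp_le field_simps)
  show "to_simplex x = (1 / (\<Sum>i\<in>UNIV. x $ i)) *\<^sub>R x"
    by (simp add: to_simplex_def inverse_eq_divide)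
qed

lemma util_convex_combination:
  "util M a (\<lambda>i j. u * x i j + v * y i j) = u *\<^sub>R util M a x + v *\<^sub>R util M a y"
  by (simp add: util_def vec_eq_iff sum.distrib sum_distrib_left algebra_simps)

lemma allocation_convex_combination:
  assumes "allocation M x" "allocation M y" "0 \<le> u" "0 \<le> v" "u + v = 1"
  shows "allocation M (\<lambda>i j. u * x i j + v * y i j)"
  using assms by (simp add: allocation_def sum.distrib flip: sum_distrib_left)

lemma convex_IPS: "convex (IPS M a)"
proof (rule convexI)
  fix x y u v assume "x \<in> IPS M a" "y \<in> IPS M a" and uv: "0 \<le> u" "0 \<le> v" "u + v = (1::real)"
  then obtain x' y' where x': "x = util M a x'" "allocation M x'" "y = util M a y'" "allocation M y'"
    by (auto simp: IPS_def)
  then have "u *\<^sub>R x + v *\<^sub>R y = util M a (\<lambda>i j. u * x' i j + v * y' i j)"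
    by (simp only: util_convex_combination)
  then show "u *\<^sub>R x + v *\<^sub>R y \<in> IPS M a"
    using allocation_convex_combination[OF x'(2,4) uv] by (auto simp: IPS_def)
qed

text \<open>The type of goods stays arbitrary because the locale is interpreted a second time for
  the merged problem, whose goods are sets.\<close>

locale division =
  fixes M :: "'g set" and a :: "3 \<Rightarrow> 'g \<Rightarrow> real" and \<beta> :: "real^3"
  assumes finite_M: "finite M" and a_pos: "j \<in> M \<Longrightarrow> 0 < a i j" and \<beta>: "\<beta> \<in> open_simplex2"
begin

definition E :: "'g \<Rightarrow> 3 set" where "E j = argmax \<beta> (\<chi> i. a i j)"
definition w :: "'g \<Rightarrow> real" where "w j = Max (range (\<lambda>i. a i j / \<beta> $ i))"
definition contested :: "'g set" where "contested = {j\<in>M. \<forall>i. E j \<noteq> {i}}"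
definition base :: "real^3" where "base = (\<chi> i. \<Sum>j | j \<in> M \<and> E j = {i}. a i j)"
definition dd :: "3 \<Rightarrow> real" where "dd i = (\<Sum>j | j \<in> M \<and> E j = UNIV - {i}. w j)"
definition cc :: real where "cc = (\<Sum>j | j \<in> M \<and> E j = UNIV. w j)"
definition ss :: real where "ss = cc + (\<Sum>i\<in>UNIV. dd i)"

lemmas \<beta>_pos = \<beta>_pos[OF \<beta>]

lemma ratio_le: "a i j / \<beta> $ i \<le> w j"
  unfolding w_def by (intro Max_ge) auto

lemma a_le: "a i j \<le> \<beta> $ i * w j"
  using ratio_le[of i j] \<beta>_pos[of i] by (simp add: field_simps)

lemma E_iff: "i \<in> E j \<longleftrightarrow> a i j = \<beta> $ i * w j"
proof -
  have "i \<in> E j \<longleftrightarrow> w j \<le> a i j / \<beta> $ i"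
    unfolding E_def argmax_def w_def by (subst Max_le_iff) auto
  also have "\<dots> \<longleftrightarrow> \<beta> $ i * w j \<le> a i j" using \<beta>_pos[of i] by (simp add: field_simps)
  finally show ?thesis using a_le[of i j] by auto
qed

lemma w_pos: "j \<in> M \<Longrightarrow> 0 < w j"
  using a_le[of 1 j] a_pos[of j 1] \<beta>_pos[of 1] by (metis less_le_trans zero_less_mult_pos)

lemma w_nonneg: "j \<in> M \<Longrightarrow> 0 \<le> w j"
  using w_pos by (rule less_imp_le)

lemma E_cases:
  obtains (all) "E j = UNIV" | (two) i where "E j = UNIV - {i}" | (one) i where "E j = {i}"
  using argmax_cases unfolding E_def by metis

lemma E_nonempty: "E j \<noteq> {}"
proof -
  have "w j \<in> range (\<lambda>i. a i j / \<beta> $ i)" unfolding w_def by (intro Max_in) auto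
  then obtain i where "w j = a i j / \<beta> $ i" by blast
  then have "i \<in> E j" using \<beta>_pos[of i] by (simp add: E_iff)
  then show ?thesis by blast
qed

lemma loc_simplex: "j \<in> M \<Longrightarrow> loc a j \<in> simplex2"
  unfolding loc_def by (intro simplex_to_simplex) (simp add: a_pos)

lemma argmax_loc: assumes "j \<in> M" shows "argmax \<beta> (loc a j) = E j"
proof -
  have "0 < (\<chi> i. a i j) $ i" for i using a_pos[OF assms] by simp
  from simplex_to_simplex(2,3)[OF this] show ?thesis
    unfolding loc_def E_def by (simp only: argmax_scale zero_less_divide_1_iff)
qed

lemma loc_iff:
  assumes "j \<in> M"
  shows "loc a j = \<beta> \<longleftrightarrow> E j = UNIV" and "loc a j \<in> disputing_segment \<beta> i \<longleftrightarrow> E j = UNIV - {i}"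
    and "loc a j \<in> part_of_vertex \<beta> i \<longleftrightarrow> E j = {i}"
  using argmax_UNIV_iff[OF \<beta> loc_simplex[OF assms]] argmax_part_of_vertex[OF \<beta> loc_simplex[OF assms]]
    argmax_disputing_segment[OF \<beta> loc_simplex[OF assms]]
  unfolding argmax_loc[OF assms] by simp_all

lemma allocation_eq_1_iff:
  assumes "allocation M x" "j \<in> M"
  shows "x i j = 1 \<longleftrightarrow> (\<forall>k. k \<noteq> i \<longrightarrow> x k j = 0)"
proof -
  obtain q r where qr: "three i q r" using ex_three by blast
  have "x i j + x q j + x r j = 1" "0 \<le> x q j" "0 \<le> x r j"
    using assms by (auto simp: allocation_def three_sum[OF qr])
  then show ?thesis using threeD[OF qr] by (auto simp: three_all[OF qr])
qed

text \<open>Inside a part two players are excluded, on a disputing segment one, at \<beta> none. In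
  terms of \<open>E\<close> these rules have a single form.\<close>

lemma PAR_iff: "PAR M a \<beta> x \<longleftrightarrow> allocation M x \<and> (\<forall>j\<in>M. \<forall>i. i \<notin> E j \<longrightarrow> x i j = 0)"
proof -
  have "(\<forall>i. (E j = {i} \<longrightarrow> x i j = 1) \<and> (E j = UNIV - {i} \<longrightarrow> x i j = 0)) \<longleftrightarrow>
      (\<forall>i. i \<notin> E j \<longrightarrow> x i j = 0)" if "allocation M x" "j \<in> M" for j
    using allocation_eq_1_iff[OF that] by (cases rule: E_cases[of j]) auto
  then show ?thesis unfolding PAR_def by (auto simp: loc_iff)
qed

lemma allocation_le_1: "allocation M x \<Longrightarrow> j \<in> M \<Longrightarrow> x i j \<le> 1"
  using member_le_sum[of i UNIV "\<lambda>i. x i j"] by (auto simp: allocation_def)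

definition share :: "(3 \<Rightarrow> 'g \<Rightarrow> real) \<Rightarrow> 3 \<Rightarrow> real" where
  "share x i = (\<Sum>j\<in>contested. w j * x i j)"

lemma finite_contested: "finite contested" and contested_subset: "contested \<subseteq> M"
  using finite_M by (auto simp: contested_def)

text \<open>A good with one eligible player contributes to \<open>base\<close>; a fraction of a
  contested good is worth \<beta> times its weight to whichever eligible player receives it.\<close>

lemma util_PAR:
  assumes "PAR M a \<beta> x" shows "util M a x = point base \<beta> (share x)"
proof -
  have x: "allocation M x" "\<And>i j. j \<in> M \<Longrightarrow> i \<notin> E j \<Longrightarrow> x i j = 0"
    using assms by (auto simp: PAR_iff)
  have "(\<Sum>j\<in>M. a i j * x i j) = base $ i + \<beta> $ i * share x i" for i
  proof -
    have "a i j * x i j = (if E j = {i} then a i j else 0) +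
        \<beta> $ i * (if \<forall>i. E j \<noteq> {i} then w j * x i j else 0)" if j: "j \<in> M" for j
    proof (cases "\<exists>k. E j = {k}")
      case True
      then obtain k where k: "E j = {k}" by blast
      then have "x k j = 1" using allocation_eq_1_iff[OF x(1) j] x(2)[OF j] by simp
      then show ?thesis using k x(2)[OF j] by auto
    next
      case False
      then show ?thesis using x(2)[OF j, of i] E_iff[of i j] by auto
    qed
    then have "(\<Sum>j\<in>M. a i j * x i j) = (\<Sum>j\<in>M. if E j = {i} then a i j else 0) +
        \<beta> $ i * (\<Sum>j\<in>M. if \<forall>i. E j \<noteq> {i} then w j * x i j else 0)"
      by (simp add: sum.distrib sum_distrib_left)
    then show ?thesis
      using finite_M by (simp add: base_def share_def contested_def sum.inter_filter)
  qed
  then show ?thesis by (simp add: util_def point_def vec_eq_iff)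
qed

text \<open>A player may receive every contested good except those on the player's own disputing
  segment, which yields the upper bound in \<open>region\<close>.\<close>

lemma sum_contested_split:
  "(\<Sum>j\<in>contested. if i \<in> E j then w j else 0) = ss - dd i" "(\<Sum>j\<in>contested. w j) = ss"
proof -
  have *: "(if \<forall>i. E j \<noteq> {i} then w j else 0) =
      (if E j = UNIV then w j else 0) + (\<Sum>i\<in>UNIV. if E j = UNIV - {i} then w j else 0)" for j
    by (cases rule: E_cases[of j]) auto
  have "(\<Sum>j\<in>contested. w j) = (\<Sum>j\<in>M. if \<forall>i. E j \<noteq> {i} then w j else 0)"
    using finite_M by (simp add: contested_def sum.inter_filter)
  also have "\<dots> = (\<Sum>j\<in>M. if E j = UNIV then w j else 0) +
      (\<Sum>i\<in>UNIV. \<Sum>j\<in>M. if E j = UNIV - {i} then w j else 0)"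
    by (subst sum.swap) (simp only: * sum.distrib)
  finally show ss: "(\<Sum>j\<in>contested. w j) = ss"
    using finite_M by (simp add: ss_def cc_def dd_def sum.inter_filter)
  have "(if E j = UNIV - {i} then w j else 0) = (if i \<in> E j then 0 else w j)"
    if "j \<in> contested" for j
    using that by (cases rule: E_cases[of j]) (auto simp: contested_def)
  then have "(\<Sum>j\<in>contested. w j - (if i \<in> E j then w j else 0)) =
      (\<Sum>j\<in>contested. if E j = UNIV - {i} then w j else 0)"
    by (intro sum.cong) auto
  also have "\<dots> = (\<Sum>j | j \<in> contested \<and> E j = UNIV - {i}. w j)"
    using finite_contested by (simp add: sum.inter_filter)
  also have "{j. j \<in> contested \<and> E j = UNIV - {i}} = {j. j \<in> M \<and> E j = UNIV - {i}}"
    unfolding contested_def by (intro Collect_cong) fastforce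
  finally show "(\<Sum>j\<in>contested. if i \<in> E j then w j else 0) = ss - dd i"
    using ss by (simp add: sum_subtractf dd_def)
qed

lemma dd_nonneg: "0 \<le> dd i" and cc_nonneg: "0 \<le> cc"
  unfolding dd_def cc_def by (auto intro!: sum_nonneg w_nonneg)

sublocale hexagon base \<beta> ss dd
  by unfold_locales (use \<beta>_pos dd_nonneg cc_nonneg in \<open>auto simp: ss_def\<close>)

lemma share_region:
  assumes "PAR M a \<beta> x" shows "share x \<in> region ss dd"
proof -
  have x: "allocation M x" "\<And>i j. j \<in> M \<Longrightarrow> i \<notin> E j \<Longrightarrow> x i j = 0"
    using assms by (auto simp: PAR_iff)
  then have x0: "0 \<le> x i j" "x i j \<le> 1" "(\<Sum>i\<in>UNIV. x i j) = 1" if "j \<in> contested" for i j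
    using that contested_subset allocation_le_1[OF x(1)] by (auto simp: allocation_def)
  have w0: "0 \<le> w j" if "j \<in> contested" for j
    using that contested_subset less_imp_le[OF w_pos] by blast
  have "0 \<le> share x i" for i
    unfolding share_def using x0 w0 by (intro sum_nonneg) auto
  moreover have "share x i \<le> ss - dd i" for i
    unfolding share_def sum_contested_split(1)[symmetric]
  proof (rule sum_mono)
    fix j assume "j \<in> contested"
    then show "w j * x i j \<le> (if i \<in> E j then w j else 0)"
      using x0 w0 x(2)[of j i] contested_subset by (auto simp: mult_left_le)
  qed
  moreover have "(\<Sum>i\<in>UNIV. share x i) = ss"
  proof -
    have "(\<Sum>i\<in>UNIV. share x i) = (\<Sum>j\<in>contested. w j * (\<Sum>i\<in>UNIV. x i j))"
      unfolding share_def by (subst sum.swap) (simp add: sum_distrib_left)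
    also have "\<dots> = ss" using x0 sum_contested_split(2) by simp
    finally show ?thesis .
  qed
  ultimately show ?thesis by (simp add: region_def)
qed

definition assign :: "('g \<Rightarrow> 3) \<Rightarrow> 3 \<Rightarrow> 'g \<Rightarrow> real" where
  "assign f i j = of_bool (j \<in> M \<and> f j = i)"

lemma allocation_assign: "allocation M (assign f)"
proof -
  have "(\<Sum>i\<in>UNIV. of_bool (k = i)) = (1::real)" for k :: 3
    by (simp add: of_bool_def)
  then show ?thesis by (auto simp: allocation_def assign_def)
qed

lemma assign_int_PAR:
  assumes "\<And>j. j \<in> M \<Longrightarrow> f j \<in> E j" shows "assign f \<in> int_PAR M a \<beta>"
  using assms allocation_assign by (auto simp: int_PAR_def PAR_iff integer_allocation_def assign_def)

text \<open>The greedy assignment offers each good first to \<open>p\<close>, then to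
  \<open>q\<close>. A contested good has at least two eligible players, so none is left for
  \<open>r\<close>.\<close>

lemma int_PAR_vertex:
  assumes "p \<noteq> q" shows "\<exists>x\<in>int_PAR M a \<beta>. util M a x = P (V p q)"
proof -
  obtain r where r: "three p q r" using ex_three2[OF assms] by blast
  define f where "f j = (if p \<in> E j then p else if q \<in> E j then q else r)" for j
  have "f j \<in> E j" for j
    using three_cases[OF r] E_nonempty[of j] unfolding f_def by (metis all_not_in_conv)
  then have int: "assign f \<in> int_PAR M a \<beta>" by (rule assign_int_PAR)
  then have PAR: "PAR M a \<beta> (assign f)" by (simp add: int_PAR_def)
  have "share (assign f) p = (\<Sum>j\<in>contested. if p \<in> E j then w j else 0)"
    unfolding share_def using contested_subset threeD[OF r]
    by (intro sum.cong) (auto simp: assign_def f_def)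
  then have p: "share (assign f) p = ss - dd p" by (simp add: sum_contested_split)
  have "w j * assign f r j = 0" if "j \<in> contested" for j
    using that threeD[OF r]
    by (cases rule: E_cases[of j]) (auto simp: contested_def assign_def f_def)
  then have r0: "share (assign f) r = 0" unfolding share_def by (intro sum.neutral ballI)
  have "share (assign f) p + share (assign f) q + share (assign f) r = ss"
    using share_region[OF PAR] by (simp add: region_def three_sum[OF r])
  then have "share (assign f) = V p q"
    using p r0 threeD[OF r] by (simp add: three_fun_eq[OF r])
  then show ?thesis using int util_PAR[OF PAR] by auto
qed

text \<open>The gap to the sum of the weights is a sum of nonnegative terms, one per good and
  player. It vanishes exactly when goods go only to players in \<open>E\<close>, so the maximizers
  are the allocations following the Pareto rule.\<close>

lemma weighted_util:
  assumes "allocation M x"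
  shows "(\<chi> i. 1 / \<beta> $ i) \<bullet> util M a x \<le> (\<Sum>j\<in>M. w j)"
    and "(\<chi> i. 1 / \<beta> $ i) \<bullet> util M a x = (\<Sum>j\<in>M. w j) \<longleftrightarrow> PAR M a \<beta> x"
proof -
  let ?t = "\<lambda>j i. (w j - a i j / \<beta> $ i) * x i j"
  have x: "0 \<le> x i j" "(\<Sum>i\<in>UNIV. x i j) = 1" if "j \<in> M" for i j
    using assms that by (auto simp: allocation_def)
  have "(\<chi> i. 1 / \<beta> $ i) \<bullet> util M a x = (\<Sum>j\<in>M. \<Sum>i\<in>UNIV. a i j / \<beta> $ i * x i j)"
    by (subst sum.swap) (simp add: inner_vec_def util_def sum_divide_distrib)
  also have "\<dots> = (\<Sum>j\<in>M. w j) - (\<Sum>j\<in>M. \<Sum>i\<in>UNIV. ?t j i)"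
    using x(2) by (simp add: left_diff_distrib sum_subtractf flip: sum_distrib_left)
  finally have eq: "(\<chi> i. 1 / \<beta> $ i) \<bullet> util M a x = (\<Sum>j\<in>M. w j) - (\<Sum>j\<in>M. \<Sum>i\<in>UNIV. ?t j i)" .
  have t0: "0 \<le> ?t j i" if "j \<in> M" for i j
    using x(1)[OF that] ratio_le by simp
  then have "0 \<le> (\<Sum>j\<in>M. \<Sum>i\<in>UNIV. ?t j i)" by (intro sum_nonneg) auto
  then show "(\<chi> i. 1 / \<beta> $ i) \<bullet> util M a x \<le> (\<Sum>j\<in>M. w j)" unfolding eq by simp
  have "(\<Sum>j\<in>M. \<Sum>i\<in>UNIV. ?t j i) = 0 \<longleftrightarrow> (\<forall>j\<in>M. \<forall>i. ?t j i = 0)"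
    using t0 finite_M by (simp add: sum_nonneg_eq_0_iff sum_nonneg)
  also have "\<dots> \<longleftrightarrow> (\<forall>j\<in>M. \<forall>i. i \<notin> E j \<longrightarrow> x i j = 0)"
  proof -
    have "w j = a i j / \<beta> $ i \<longleftrightarrow> i \<in> E j" for i j
      using \<beta>_pos[of i] by (auto simp: E_iff field_simps)
    then show ?thesis by auto
  qed
  finally show "(\<chi> i. 1 / \<beta> $ i) \<bullet> util M a x = (\<Sum>j\<in>M. w j) \<longleftrightarrow> PAR M a \<beta> x"
    using assms by (auto simp: eq PAR_iff)
qed

lemma ex_PAR: "\<exists>x. PAR M a \<beta> x"
proof -
  obtain q r where "three 1 q r" using ex_three by blast
  from int_PAR_vertex[OF threeD(1)[OF this]] show ?thesis by (auto simp: int_PAR_def)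
qed

lemma support_plane_eq:
  "support_plane M a (RD \<beta>) = {x. (\<chi> i. 1 / \<beta> $ i) \<bullet> x = (\<Sum>j\<in>M. w j)}"
proof -
  have "0 < (\<chi> i. 1 / \<beta> $ i) $ i" for i using \<beta>_pos[of i] by simp
  from simplex_to_simplex(2,3)[OF this] obtain c where c: "0 < c" "RD \<beta> = c *\<^sub>R (\<chi> i. 1 / \<beta> $ i)"
    unfolding RD_def by (metis zero_less_divide_1_iff)
  obtain x where x: "PAR M a \<beta> x" using ex_PAR by blast
  then have "allocation M x" by (simp add: PAR_iff)
  \<comment> \<open>The supremum is attained at any allocation that follows the rule; the
    normalizing constant of \<open>RD\<close> only scales it.\<close>
  have "(SUP y\<in>IPS M a. RD \<beta> \<bullet> y) = c * (\<Sum>j\<in>M. w j)"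
  proof (rule cSup_eq_maximum)
    have "c * (\<Sum>j\<in>M. w j) = RD \<beta> \<bullet> util M a x"
      using x weighted_util(2)[OF \<open>allocation M x\<close>] by (simp add: c)
    then show "c * (\<Sum>j\<in>M. w j) \<in> (\<bullet>) (RD \<beta>) ` IPS M a"
      using \<open>allocation M x\<close> unfolding IPS_def by blast
  next
    fix y assume "y \<in> (\<bullet>) (RD \<beta>) ` IPS M a"
    then show "y \<le> c * (\<Sum>j\<in>M. w j)" using weighted_util(1) c by (auto simp: IPS_def)
  qed
  then show ?thesis using c by (simp add: support_plane_def)
qed

lemma face_at_eq_PAR: "face_at M a \<beta> = util M a ` {x. PAR M a \<beta> x}"
proof -
  have "PAR M a \<beta> x \<longleftrightarrow> allocation M x \<and> (\<chi> i. 1 / \<beta> $ i) \<bullet> util M a x = (\<Sum>j\<in>M. w j)" for x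
    using weighted_util(2) PAR_iff by blast
  then show ?thesis unfolding face_at_def support_plane_eq IPS_def by blast
qed

lemma face_at_face_of: "face_at M a \<beta> face_of IPS M a"
proof -
  have "face_at M a \<beta> = IPS M a \<inter> {x. (\<chi> i. 1 / \<beta> $ i) \<bullet> x = (\<Sum>j\<in>M. w j)}"
    unfolding face_at_def support_plane_eq by (rule Int_commute)
  then show ?thesis
    using weighted_util(1)
    by (simp only:) (intro face_of_Int_supporting_hyperplane_le convex_IPS, auto simp: IPS_def)
qed

text \<open>Shares lie in the region. Conversely, the greedy vertices are values of integer
  allocations and the face is convex, so it contains their hull.\<close>

lemma face_at_eq_hex: "face_at M a \<beta> = hex"
proof
  show "face_at M a \<beta> \<subseteq> hex"
    unfolding face_at_eq_PAR hex_def using util_PAR share_region by auto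
  have "convex (face_at M a \<beta>)" using face_at_face_of face_of_imp_convex convex_IPS by blast
  moreover have "P (V p q) \<in> face_at M a \<beta>" if "p \<noteq> q" for p q
    using int_PAR_vertex[OF that] unfolding face_at_eq_PAR int_PAR_def by (auto intro!: rev_image_eqI)
  moreover obtain q r where qr: "three 1 q r" using ex_three by blast
  ultimately show "hex \<subseteq> face_at M a \<beta>"
    unfolding hex_eq_hull[OF qr] using threeD[OF qr] by (intro hull_minimal) auto
qed

text \<open>All coefficients are positive, so a Pareto improvement would push the functional above
  its maximum.\<close>

lemma face_at_pareto: "face_at M a \<beta> \<subseteq> pareto_boundary M a"
proof
  fix y assume "y \<in> face_at M a \<beta>"
  then obtain x where x: "y = util M a x" "PAR M a \<beta> x" by (auto simp: face_at_eq_PAR)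
  then have al: "allocation M x" by (simp add: PAR_iff)
  have "pareto_optimal M a x"
    unfolding pareto_optimal_def
  proof (intro conjI al notI)
    assume "\<exists>x'. allocation M x' \<and> (\<forall>i. util M a x' $ i \<ge> util M a x $ i) \<and>
      (\<exists>i. util M a x' $ i > util M a x $ i)"
    then obtain x' i where x': "allocation M x'" "\<forall>i. util M a x $ i \<le> util M a x' $ i"
      "util M a x $ i < util M a x' $ i" by blast
    have "(\<chi> i. 1 / \<beta> $ i) \<bullet> util M a x < (\<chi> i. 1 / \<beta> $ i) \<bullet> util M a x'"
      unfolding inner_vec_def
    proof (rule sum_strict_mono_ex1)
      show "\<forall>k\<in>UNIV. (\<chi> i. 1 / \<beta> $ i) $ k \<bullet> util M a x $ k \<le> (\<chi> i. 1 / \<beta> $ i) $ k \<bullet> util M a x' $ k"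
        using x'(2) \<beta>_pos by (simp add: divide_right_mono less_imp_le)
      show "\<exists>k\<in>UNIV. (\<chi> i. 1 / \<beta> $ i) $ k \<bullet> util M a x $ k < (\<chi> i. 1 / \<beta> $ i) $ k \<bullet> util M a x' $ k"
        using x'(3) \<beta>_pos by (intro bexI[of _ i]) (simp_all add: divide_strict_right_mono)
    qed simp
    then show False using weighted_util(1)[OF x'(1)] weighted_util(2)[OF al] x(2) by simp
  qed
  then show "y \<in> pareto_boundary M a" using x by (auto simp: pareto_boundary_def)
qed

end

section \<open>Counting integer allocations\<close>

text \<open>Peels off one good, so that counting assignments with a property becomes a nested sum
  over the receivers.\<close>

lemma card_PiE_insert:
  assumes "finite C" "j \<notin> C" "\<And>g. finite (E g)"
  shows "card {f \<in> PiE (insert j C) E. R f} = (\<Sum>u\<in>E j. card {f \<in> PiE C E. R (f(j := u))})"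
proof -
  have fin: "finite {f \<in> PiE C E. S f}" for S
    by (rule finite_subset[OF _ finite_PiE[of C E]]) (use assms in auto)
  have "{f \<in> PiE (insert j C) E. R f} = (\<Union>u\<in>E j. (\<lambda>f. f(j := u)) ` {f \<in> PiE C E. R (f(j := u))})"
    (is "?L = ?R")
  proof (intro set_eqI iffI)
    fix x assume "x \<in> ?L"
    then have "x \<in> (\<lambda>(y, g). g(j := y)) ` (E j \<times> PiE C E)" "R x"
      unfolding PiE_insert_eq by blast+
    then show "x \<in> ?R" by auto
  next
    fix x assume "x \<in> ?R"
    then obtain u f where f: "u \<in> E j" "f \<in> PiE C E" "R (f(j := u))" "x = f(j := u)" by blast
    then have "x \<in> (\<lambda>(y, g). g(j := y)) ` (E j \<times> PiE C E)"
      by (intro image_eqI[of _ _ "(u, f)"]) auto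
    then show "x \<in> ?L" using f(3) unfolding PiE_insert_eq f(4) by blast
  qed
  also have "card \<dots> = (\<Sum>u\<in>E j. card ((\<lambda>f. f(j := u)) ` {f \<in> PiE C E. R (f(j := u))}))"
  proof (rule card_UN_disjoint)
    show "\<forall>u\<in>E j. \<forall>v\<in>E j. u \<noteq> v \<longrightarrow> (\<lambda>f. f(j := u)) ` {f \<in> PiE C E. R (f(j := u))} \<inter>
        (\<lambda>f. f(j := v)) ` {f \<in> PiE C E. R (f(j := v))} = {}"
      by (auto dest: fun_cong[of _ _ j])
  qed (use assms(3) fin in auto)
  also have "\<dots> = (\<Sum>u\<in>E j. card {f \<in> PiE C E. R (f(j := u))})"
  proof (intro sum.cong refl card_image inj_onI)
    fix u f g assume "f \<in> {f \<in> PiE C E. R (f(j := u))}" "g \<in> {f \<in> PiE C E. R (f(j := u))}"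
      and eq: "f(j := u) = g(j := u)"
    \<comment> \<open>The update at \<open>j\<close> overwrites nothing but the default value that
      extensional functions take outside \<open>C\<close>, so it is injective.\<close>
    then have "f j = undefined" "g j = undefined" using assms(2) by (auto simp: PiE_def extensional_def)
    then show "f = g" using eq by (metis fun_upd_triv fun_upd_upd)
  qed
  finally show ?thesis .
qed

lemma image_Collect_eq: "B \<subseteq> f ` A \<Longrightarrow> f ` {x \<in> A. f x \<in> B} = B"
  by blast

lemma card_PiE_empty: "card {f \<in> PiE {} E. R f} = of_bool (R (\<lambda>_. undefined))"
proof -
  have "{f \<in> PiE {} E. R f} = (if R (\<lambda>_. undefined) then {\<lambda>_. undefined} else {})" by auto
  then show ?thesis by simp
qed

context division
begin

text \<open>Assignments are chosen on contested goods only; any other good of the problem goes to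
  its single eligible player.\<close>

definition extend :: "('g \<Rightarrow> 3) \<Rightarrow> 'g \<Rightarrow> 3" where
  "extend f j = (if j \<in> contested then f j else the_elem (E j))"

definition load :: "('g \<Rightarrow> 3) \<Rightarrow> 3 \<Rightarrow> real" where
  "load f i = (\<Sum>j\<in>contested. w j * of_bool (f j = i))"

lemma share_assign_extend: "share (assign (extend f)) = load f"
  unfolding share_def load_def fun_eq_iff using contested_subset
  by (intro allI sum.cong) (auto simp: assign_def extend_def)

lemma extend_E: "f \<in> PiE contested E \<Longrightarrow> j \<in> M \<Longrightarrow> extend f j \<in> E j"
  by (auto simp: extend_def contested_def)

text \<open>An integer allocation following the rule amounts to a free choice of an eligible
  receiver for each contested good, so all counts become counts in a finite product.\<close>

lemma bij_betw_int_PAR: "bij_betw (\<lambda>f. assign (extend f)) (PiE contested E) (int_PAR M a \<beta>)"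
proof (rule bij_betwI')
  fix f g assume f: "f \<in> PiE contested E" and g: "g \<in> PiE contested E"
  show "assign (extend f) = assign (extend g) \<longleftrightarrow> f = g"
  proof
    assume eq: "assign (extend f) = assign (extend g)"
    show "f = g"
    proof (rule PiE_ext[OF f g])
      fix j assume j: "j \<in> contested"
      have "assign (extend f) (f j) j = assign (extend g) (f j) j" using eq by simp
      then show "f j = g j" using j contested_subset by (auto simp: assign_def extend_def)
    qed
  qed simp
next
  fix f assume "f \<in> PiE contested E"
  then show "assign (extend f) \<in> int_PAR M a \<beta>" by (intro assign_int_PAR extend_E)
next
  fix x assume "x \<in> int_PAR M a \<beta>"
  then have al: "allocation M x" and zero: "\<And>i j. j \<in> M \<Longrightarrow> i \<notin> E j \<Longrightarrow> x i j = 0"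
    and int: "\<And>i j. j \<in> M \<Longrightarrow> x i j = 0 \<or> x i j = 1"
    by (auto simp: int_PAR_def PAR_iff integer_allocation_def)
  have "\<exists>i. x i j = 1" if "j \<in> M" for j
  proof (rule ccontr)
    assume "\<nexists>i. x i j = 1"
    then have "\<And>i. x i j = 0" using int[OF that] by blast
    moreover have "(\<Sum>i\<in>UNIV. x i j) = 1" using al that by (simp add: allocation_def)
    ultimately show False by simp
  qed
  then obtain f where f: "\<And>j. j \<in> M \<Longrightarrow> x (f j) j = 1" by metis
  have fE: "f j \<in> E j" if "j \<in> M" for j using zero[OF that, of "f j"] f[OF that] by auto
  have "x = assign (extend (restrict f contested))"
  proof (intro ext)
    fix i j
    show "x i j = assign (extend (restrict f contested)) i j"
    proof (cases "j \<in> M")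
      case True
      have "extend (restrict f contested) j = f j"
        using fE[OF True] True by (auto simp: extend_def contested_def)
      moreover have "x i j = of_bool (f j = i)"
        using f[OF True] allocation_eq_1_iff[OF al True, of "f j"] by auto
      ultimately show ?thesis using True by (simp add: assign_def)
    next
      case False
      then show ?thesis using al by (simp add: assign_def allocation_def)
    qed
  qed
  moreover have "restrict f contested \<in> PiE contested E" using fE contested_subset by auto
  ultimately show "\<exists>f\<in>PiE contested E. x = assign (extend f)" by blast
qed

lemma load_region:
  assumes "f \<in> PiE contested E" shows "load f \<in> region ss dd"
proof -
  have "assign (extend f) \<in> int_PAR M a \<beta>" using assms by (intro assign_int_PAR extend_E)
  then show ?thesis
    using share_region[of "assign (extend f)"] by (simp add: int_PAR_def share_assign_extend)
qed

lemma util_assign_extend: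
  assumes "f \<in> PiE contested E" shows "util M a (assign (extend f)) = P (load f)"
proof -
  have "assign (extend f) \<in> int_PAR M a \<beta>" using assms by (intro assign_int_PAR extend_E)
  then show ?thesis using util_PAR share_assign_extend by (auto simp: int_PAR_def)
qed

lemma finite_int_PAR: "finite (int_PAR M a \<beta>)"
proof -
  have "finite (PiE contested E)" by (intro finite_PiE finite_contested) simp
  then show ?thesis using bij_betw_finite[OF bij_betw_int_PAR] by simp
qed

definition count :: "((3 \<Rightarrow> real) \<Rightarrow> bool) \<Rightarrow> nat" where
  "count Q = card {f \<in> PiE contested E. Q (load f)}"

lemma int_count_eq:
  assumes "\<And>Y. Y \<in> region ss dd \<Longrightarrow> P Y \<in> S \<longleftrightarrow> Q Y"
  shows "int_count M a \<beta> S = count Q"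
proof -
  have "bij_betw (\<lambda>f. assign (extend f)) {f \<in> PiE contested E. Q (load f)}
      {x \<in> int_PAR M a \<beta>. util M a x \<in> S}"
    unfolding bij_betw_def
  proof
    show "inj_on (\<lambda>f. assign (extend f)) {f \<in> PiE contested E. Q (load f)}"
      using bij_betw_int_PAR by (auto simp: bij_betw_def intro: inj_on_subset)
    have "int_PAR M a \<beta> = (\<lambda>f. assign (extend f)) ` PiE contested E"
      using bij_betw_int_PAR by (simp add: bij_betw_def)
    then show "(\<lambda>f. assign (extend f)) ` {f \<in> PiE contested E. Q (load f)} =
        {x \<in> int_PAR M a \<beta>. util M a x \<in> S}"
      using util_assign_extend load_region assms by (auto simp: image_iff)
  qed
  then show ?thesis unfolding int_count_def count_def by (simp add: bij_betw_same_card)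
qed

text \<open>At \<open>V p q\<close> player \<open>r\<close> gets nothing and \<open>p\<close> the
  maximum. As all weights are positive, no contested good goes to \<open>r\<close> and every good
  open to \<open>p\<close> goes to \<open>p\<close>, which fixes each receiver.\<close>

lemma load_vertex_unique:
  assumes f: "f \<in> PiE contested E" and g: "g \<in> PiE contested E"
    and "p \<noteq> q" "load f = V p q" "load g = V p q"
  shows "f = g"
proof -
  obtain r where r: "three p q r" using ex_three2[OF assms(3)] by blast
  have greedy: "f j = (if p \<in> E j then p else q)"
    if f: "f \<in> PiE contested E" and load: "load f = V p q" and j: "j \<in> contested" for f j
  proof -
    have w: "0 < w j" if "j \<in> contested" for j using w_pos that contested_subset by blast
    have "(\<Sum>j\<in>contested. w j * of_bool (f j = r)) = 0"
      using fun_cong[OF load, of r] threeD[OF r] by (simp only: load_def) simp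
    then have "\<forall>j\<in>contested. w j * of_bool (f j = r) = 0"
      by (rule iffD1[OF sum_nonneg_eq_0_iff[OF finite_contested], rotated]) (simp add: w less_imp_le)
    then have "w j * of_bool (f j = r) = 0" using j by blast
    then have "f j \<noteq> r" using w[OF j] by auto
    have "load f p = ss - dd p" using load by simp
    then have "(\<Sum>j\<in>contested. (if p \<in> E j then w j else 0) - w j * of_bool (f j = p)) = 0"
      unfolding load_def by (simp only: sum_subtractf sum_contested_split)
    moreover have "0 \<le> (if p \<in> E j then w j else 0) - w j * of_bool (f j = p)"
      if "j \<in> contested" for j
      using PiE_mem[OF f that] w[OF that] by (cases "f j = p") auto
    ultimately have "\<forall>j\<in>contested. (if p \<in> E j then w j else 0) - w j * of_bool (f j = p) = 0"
      using finite_contested by (simp only: sum_nonneg_eq_0_iff)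
    then have "(if p \<in> E j then w j else 0) - w j * of_bool (f j = p) = 0" using j by blast
    then have "p \<in> E j \<longleftrightarrow> f j = p"
      using w[OF j] by (cases "p \<in> E j"; cases "f j = p") simp_all
    then show ?thesis using \<open>f j \<noteq> r\<close> three_cases[OF r, of "f j"] by auto
  qed
  show ?thesis by (rule PiE_ext[OF f g]) (simp only: greedy[OF f assms(4)] greedy[OF g assms(5)])
qed

lemma vertices_onceI:
  assumes "set Ys \<subseteq> {V p q |p q. p \<noteq> q}"
  shows "vertices_once M a \<beta> (map P Ys)"
  unfolding vertices_once_def bij_betw_def
proof
  show "inj_on (util M a) {x \<in> int_PAR M a \<beta>. util M a x \<in> set (map P Ys)}"
  proof (rule inj_onI)
    fix x y assume "x \<in> {x \<in> int_PAR M a \<beta>. util M a x \<in> set (map P Ys)}"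
      "y \<in> {x \<in> int_PAR M a \<beta>. util M a x \<in> set (map P Ys)}" "util M a x = util M a y"
    then obtain Y where xy: "x \<in> int_PAR M a \<beta>" "y \<in> int_PAR M a \<beta>" "util M a x = util M a y"
      and Y: "util M a y = P Y" "Y \<in> set Ys" by auto
    have im: "int_PAR M a \<beta> = (\<lambda>f. assign (extend f)) ` PiE contested E"
      using bij_betw_int_PAR by (simp add: bij_betw_def)
    obtain f where f: "x = assign (extend f)" "f \<in> PiE contested E"
      using xy(1) unfolding im by (rule imageE)
    obtain g where g: "y = assign (extend g)" "g \<in> PiE contested E"
      using xy(2) unfolding im by (rule imageE)
    obtain p q where "p \<noteq> q" "Y = V p q" using Y assms by blast
    then have "f = g"
      using load_vertex_unique[OF f(2) g(2)] xy Y f g by (simp add: util_assign_extend)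
    then show "x = y" using f g by simp
  qed
  have "P ` set Ys \<subseteq> util M a ` int_PAR M a \<beta>"
  proof
    fix y assume "y \<in> P ` set Ys"
    then obtain p q where "p \<noteq> q" "y = P (V p q)" using assms by blast
    then show "y \<in> util M a ` int_PAR M a \<beta>" using int_PAR_vertex by force
  qed
  then show "util M a ` {x \<in> int_PAR M a \<beta>. util M a x \<in> set (map P Ys)} = set (map P Ys)"
    unfolding set_map by (rule image_Collect_eq)
qed

text \<open>Each vertex has one allocation, so equal cardinalities leave no allocation whose value
  is not a vertex. This serves the triangle and the parallelogram.\<close>

lemma bij_betw_vertices:
  assumes "set Ys \<subseteq> {V p q |p q. p \<noteq> q}" "distinct Ys" "card (int_PAR M a \<beta>) = length Ys"
  shows "bij_betw (util M a) (int_PAR M a \<beta>) (set (map P Ys))"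
proof -
  let ?A = "{x \<in> int_PAR M a \<beta>. util M a x \<in> set (map P Ys)}"
  have bij: "bij_betw (util M a) ?A (set (map P Ys))"
    using vertices_onceI[OF assms(1)] by (simp add: vertices_once_def)
  have "card (P ` set Ys) = length Ys"
    using assms(2) by (simp add: card_image inj_on_def distinct_card)
  then have "card ?A = card (int_PAR M a \<beta>)" using bij_betw_same_card[OF bij] assms(3) by simp
  then have "?A = int_PAR M a \<beta>" using finite_int_PAR by (intro card_subset_eq) auto
  then show ?thesis using bij by simp
qed

lemma sums_contested:
  "dd i = (\<Sum>j\<in>contested. if E j = UNIV - {i} then w j else 0)"
  "cc = (\<Sum>j\<in>contested. if E j = UNIV then w j else 0)"
proof -
  have "{j \<in> M. E j = UNIV - {i}} = {j \<in> contested. E j = UNIV - {i}}"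
    unfolding contested_def by fastforce
  then show "dd i = (\<Sum>j\<in>contested. if E j = UNIV - {i} then w j else 0)"
    using finite_contested by (simp add: dd_def sum.inter_filter)
  have "{j \<in> M. E j = UNIV} = {j \<in> contested. E j = UNIV}"
    unfolding contested_def by fastforce
  then show "cc = (\<Sum>j\<in>contested. if E j = UNIV then w j else 0)"
    using finite_contested by (simp add: cc_def sum.inter_filter)
qed

lemma shared_between_E:
  assumes "j \<in> M" shows "shared_between M a \<beta> j (E j)"
proof -
  \<comment> \<open>Splitting every good equally among its eligible players gives each of them a
    positive part.\<close>
  let ?x = "\<lambda>i g. of_bool (g \<in> M \<and> i \<in> E g) / real (card (E g))"
  have card: "0 < real (card (E g))" for g using E_nonempty[of g] by (simp add: card_gt_0_iff)
  have "(\<Sum>i\<in>UNIV. of_bool (i \<in> E g) / real (card (E g))) = 1" for g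
    using card[of g] by (simp add: E_nonempty flip: sum_divide_distrib)
  then have "PAR M a \<beta> ?x" by (auto simp: PAR_iff allocation_def E_nonempty)
  moreover have "\<forall>i\<in>E j. 0 < ?x i j" using assms card by simp
  ultimately show ?thesis using assms unfolding shared_between_def PAR_iff by blast
qed

lemma open_side_count:
  assumes polygon: "polygon hex (map P Ys)" and k: "k < length Ys"
    and Z: "Ys ! k = Z" "Ys ! (Suc k mod length Ys) = Z'"
    and side: "Z i = 0" "Z' i = 0" "\<forall>Y\<in>set Ys - {Z, Z'}. 0 < Y i"
  shows "int_count M a \<beta> (open_side (map P Ys) k) = count (\<lambda>Y. Y i = 0 \<and> Y \<noteq> Z \<and> Y \<noteq> Z')"
proof (rule int_count_eq)
  have next_less: "Suc k mod length Ys < length Ys" using k by (intro mod_less_divisor) linarith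
  have "hex = convex hull set (map P Ys)" using polygon unfolding polygon_def by blast
  then have hull: "hex = convex hull P ` set Ys" by simp
  show "P Y \<in> open_side (map P Ys) k \<longleftrightarrow> Y i = 0 \<and> Y \<noteq> Z \<and> Y \<noteq> Z'" if "Y \<in> region ss dd" for Y
    unfolding Z[symmetric]
    by (rule open_side_points[OF hull k next_less _ _ _ that]) (use Z side in simp_all)
qed

lemma rel_interior_count:
  assumes "\<And>i. dd i < ss"
  shows "int_count M a \<beta> (rel_interior (face_at M a \<beta>)) = count (\<lambda>Y. \<forall>i. 0 < Y i \<and> Y i < ss - dd i)"
  by (rule int_count_eq) (simp add: face_at_eq_hex P_rel_interior assms)

lemma count_contested:
  assumes "contested = set js" "distinct js"
  shows "count Q = card {f \<in> PiE (set js) E. Q (\<lambda>i. \<Sum>j\<leftarrow>js. w j * of_bool (f j = i))}"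
proof -
  have "load f = (\<lambda>i. \<Sum>j\<leftarrow>js. w j * of_bool (f j = i))" for f
    using assms by (simp add: load_def fun_eq_iff sum_list_distinct_conv_sum_set)
  then show ?thesis by (simp add: count_def assms(1))
qed

lemma three_minus:
  assumes "three p q r"
  shows "UNIV - {p} = {q, r}" "UNIV - {q} = {p, r}" "UNIV - {r} = {p, q}"
  unfolding three_UNIV[OF assms] using threeD[OF assms] by auto

text \<open>Meant for \<open>simp only\<close>: together they unfold a count good by good into a
  nested sum of truth values.\<close>

lemmas count_simps = list.set sum_list.Cons sum_list.Nil list.map card_PiE_insert card_PiE_empty
  finite.emptyI finite_insert finite insert_iff empty_iff simp_thms fun_upd_apply if_True if_False
  add_0_right

section \<open>The six configurations\<close>

lemma card_UNIV_minus: "card (UNIV - {i :: 3}) = 2"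
  by (simp add: card_Diff_subset)

lemma card_int_PAR: "card (int_PAR M a \<beta>) = (\<Prod>j\<in>contested. card (E j))"
  using bij_betw_same_card[OF bij_betw_int_PAR] card_PiE[OF finite_contested, of E] by simp

lemma parallel_sides_commute: "parallel_sides vs k l \<Longrightarrow> parallel_sides vs l k"
  unfolding parallel_sides_def by (rule affine_parallel_commute)

lemma PAR_uncontested:
  assumes "PAR M a \<beta> x" "j \<in> M" "E j = {i}" shows "x k j = of_bool (k = i)"
proof -
  have "allocation M x" "\<And>k. k \<noteq> i \<Longrightarrow> x k j = 0" using assms by (auto simp: PAR_iff)
  then show ?thesis using allocation_eq_1_iff[of x j i] assms(2) by auto
qed

lemma PAR_eqI:
  assumes x: "PAR M a \<beta> x" and y: "PAR M a \<beta> y"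
    and eq: "\<And>i j. j \<in> contested \<Longrightarrow> x i j = y i j"
  shows "x = y"
proof (intro ext)
  fix i j
  consider "j \<in> contested" | k where "j \<in> M" "E j = {k}" | "j \<notin> M"
    unfolding contested_def by blast
  then show "x i j = y i j"
  proof cases
    case 2
    then show ?thesis using PAR_uncontested[OF x] PAR_uncontested[OF y] by simp
  next
    case 3
    then show ?thesis using x y by (simp add: PAR_iff allocation_def)
  qed (rule eq)
qed

lemma outcome1_holds:
  assumes con: "contested = {j}" and E: "E j = UNIV"
  shows "outcome1 M a \<beta> j"
proof -
  obtain p q r :: 3 where pqr: "three p q r" using ex_three by blast
  have pos: "0 < w j" using w_pos contested_subset con by auto
  have d: "dd i = 0" "cc = w j" for i
    by (simp_all add: sums_contested con E)
  then have s: "ss = w j" by (simp add: ss_def)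
  let ?Ys = "[V p q, V q r, V r p]"
  have polygon: "polygon hex (map P ?Ys)"
    by (rule polygon_triangle[OF pqr]) (use d s pos in simp_all)
  have distinct: "distinct ?Ys"
    using pos by (auto simp: threeD[OF pqr] three_fun_eq[OF pqr] d s)
  have "bij_betw (util M a) (int_PAR M a \<beta>) (set (map P ?Ys))"
  proof (rule bij_betw_vertices[OF _ distinct])
    show "set ?Ys \<subseteq> {V p q |p q. p \<noteq> q}" using threeD[OF pqr] by auto
    show "card (int_PAR M a \<beta>) = length ?Ys" by (simp add: card_int_PAR con E)
  qed
  then have polygons: "\<exists>vs. polygon (face_at M a \<beta>) vs \<and> length vs = 3 \<and>
      bij_betw (util M a) (int_PAR M a \<beta>) (set vs)"
    using polygon unfolding face_at_eq_hex by (intro exI[of _ "map P ?Ys"]) simp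
  have assign_j: "\<exists>!x. x \<in> int_PAR M a \<beta> \<and> x i j = 1" for i
  proof
    \<comment> \<open>The constant function only matters at \<open>j\<close>, because
      \<open>extend\<close> fixes the receivers of all other goods.\<close>
    let ?x = "assign (extend (\<lambda>_. i))"
    have "?x \<in> int_PAR M a \<beta>"
    proof (rule assign_int_PAR)
      fix g assume "g \<in> M"
      then show "extend (\<lambda>_. i) g \<in> E g" using E con by (auto simp: extend_def contested_def)
    qed
    then show "?x \<in> int_PAR M a \<beta> \<and> ?x i j = 1"
      using con contested_subset by (simp add: assign_def extend_def)
    fix y assume y: "y \<in> int_PAR M a \<beta> \<and> y i j = 1"
    have "j \<in> M" using con contested_subset by blast
    have other: "x k j = of_bool (k = i)" if "x \<in> int_PAR M a \<beta>" "x i j = 1" for x k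
      using that allocation_eq_1_iff[OF _ \<open>j \<in> M\<close>] by (auto simp: int_PAR_def PAR_iff)
    show "y = ?x"
    proof (rule PAR_eqI)
      show "PAR M a \<beta> y" "PAR M a \<beta> ?x"
        using y \<open>?x \<in> int_PAR M a \<beta> \<and> ?x i j = 1\<close> by (simp_all add: int_PAR_def)
    next
      fix k g assume "g \<in> contested"
      then have "g = j" using con by simp
      then show "y k g = ?x k g"
        using other[of y k] other[of ?x k] y \<open>?x \<in> int_PAR M a \<beta> \<and> ?x i j = 1\<close> by simp
    qed
  qed
  have others: "\<exists>!i. \<forall>x. PAR M a \<beta> x \<longrightarrow> x i h = 1" if "h \<in> M - {j}" for h
  proof -
    have "h \<in> M" "h \<notin> contested" using that con by simp_all
    then obtain i where i: "E h = {i}" unfolding contested_def by blast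
    have x: "x k h = of_bool (k = i)" if "PAR M a \<beta> x" for x k
      using PAR_uncontested[OF that _ i] \<open>h \<in> M - {j}\<close> by simp
    obtain x0 where x0: "PAR M a \<beta> x0" using ex_PAR by blast
    show ?thesis
    proof (rule ex1I)
      show "\<forall>x. PAR M a \<beta> x \<longrightarrow> x i h = 1" by (simp add: x)
      fix k assume "\<forall>x. PAR M a \<beta> x \<longrightarrow> x k h = 1"
      then have "x0 k h = 1" using x0 by blast
      then show "k = i" using x[OF x0, of k] by (simp add: of_bool_def split: if_splits)
    qed
  qed
  show ?thesis unfolding outcome1_def by (intro conjI allI ballI assign_j others polygons)
qed

lemma outcome2_holds:
  assumes pqr: "three p q r" and con: "contested = {j, k}"
    and E: "E j = UNIV - {p}" "E k = UNIV - {q}"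
  shows "outcome2 M a \<beta> j k"
proof -
  have dist: "j \<noteq> k" "k \<noteq> j" using E threeD[OF pqr] by auto
  have M: "j \<in> M" "k \<in> M" using contested_subset con by auto
  have pos: "0 < w j" "0 < w k" using w_pos M by auto
  have d: "dd p = w j" "dd q = w k" "dd r = 0" "cc = 0"
    by (simp_all add: sums_contested con dist E threeD[OF pqr])
  then have s: "ss = w j + w k" by (simp add: ss_def three_sum[OF pqr])
  let ?Ys = "[V p q, V q r, V r q, V p r]"
  have polygon: "polygon hex (map P ?Ys)"
    by (rule polygon_parallelogram[OF pqr]) (use d s pos in simp_all)
  have distinct: "distinct ?Ys"
    using pos by (auto simp: threeD[OF pqr] three_fun_eq[OF pqr] d s)
  have bij: "bij_betw (util M a) (int_PAR M a \<beta>) (set (map P ?Ys))"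
  proof (rule bij_betw_vertices[OF _ distinct])
    show "set ?Ys \<subseteq> {V p q |p q. p \<noteq> q}" using threeD[OF pqr] by auto
    show "card (int_PAR M a \<beta>) = length ?Ys"
      by (simp add: card_int_PAR con E dist card_UNIV_minus)
  qed
  \<comment> \<open>Two vertices have two names each, and \<open>opposite_sides_points\<close>
    expects the other name for one direction.\<close>
  have V: "V p q = V q p" "V r q = V r p"
    by (simp_all add: threeD[OF pqr] three_fun_eq[OF pqr] d s)
  have rot: "three q r p" "three r p q" using pqr by (auto simp: three_def)
  have pos': "0 < ss - dd q - dd r" "0 < ss - dd r - dd p" using d s pos by simp_all
  have "parallel_sides (map P ?Ys) 1 3"
    by (rule opposite_sides_points(1)[OF distinct _ _ _ rot(1) pos'(1)]) simp_all
  moreover have "parallel_sides (map P ?Ys) 2 0"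
    by (rule opposite_sides_points(1)[OF distinct _ _ _ rot(2) pos'(2)]) (simp_all add: V)
  then have "parallel_sides (map P ?Ys) 0 2" by (rule parallel_sides_commute)
  ultimately have "\<exists>vs. polygon (face_at M a \<beta>) vs \<and> length vs = 4 \<and>
      parallel_sides vs 0 2 \<and> parallel_sides vs 1 3 \<and>
      bij_betw (util M a) (int_PAR M a \<beta>) (set vs)"
    using polygon bij unfolding face_at_eq_hex
    by (intro exI[of _ "map P ?Ys"] conjI) simp_all
  moreover have "inj_on (\<lambda>x i. (x i j, x i k)) (int_PAR M a \<beta>)"
  proof (rule inj_onI, rule PAR_eqI)
    fix x y i g
    assume xy: "x \<in> int_PAR M a \<beta>" "y \<in> int_PAR M a \<beta>"
      and eq: "(\<lambda>i. (x i j, x i k)) = (\<lambda>i. (y i j, y i k))"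
    show "PAR M a \<beta> x" "PAR M a \<beta> y" using xy by (simp_all add: int_PAR_def)
    show "x i g = y i g" if "g \<in> contested"
      using that fun_cong[OF eq, of i] con by auto
  qed
  moreover have "\<exists>C D. shared_between M a \<beta> j C \<and> shared_between M a \<beta> k D \<and>
      card C = 2 \<and> card D = 2 \<and> card (C \<inter> D) = 1"
  proof (intro exI conjI)
    show "shared_between M a \<beta> j (E j)" "shared_between M a \<beta> k (E k)"
      using shared_between_E M by blast+
    have "E j \<inter> E k = {r}" unfolding E three_minus[OF pqr] using threeD[OF pqr] by auto
    then show "card (E j \<inter> E k) = 1" by simp
  qed (simp_all add: E card_UNIV_minus)
  ultimately show ?thesis unfolding outcome2_def by blast
qed

lemma outcome3_holds:
  assumes pqr: "three p q r" and con: "contested = {j, k, l}"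
    and E: "E j = UNIV - {p}" "E k = UNIV - {q}" "E l = UNIV - {r}"
  shows "outcome3 M a \<beta> j k l"
proof -
  have dist: "j \<noteq> k" "j \<noteq> l" "k \<noteq> l" "k \<noteq> j" "l \<noteq> j" "l \<noteq> k"
    using E threeD[OF pqr] by auto
  have count: "count Q = (\<Sum>u\<in>{q,r}. \<Sum>v\<in>{p,r}. \<Sum>z\<in>{p,q}. of_bool (Q (\<lambda>i.
      w j * of_bool (u = i) + (w k * of_bool (v = i) + w l * of_bool (z = i)))))" for Q
    by (subst count_contested[of "[j, k, l]"])
      (simp_all only: con dist distinct.simps count_simps E[unfolded three_minus[OF pqr]])
  have M: "j \<in> M" "k \<in> M" "l \<in> M" using contested_subset con by auto
  have pos: "0 < w j" "0 < w k" "0 < w l" using w_pos M by auto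
  have d: "dd p = w j" "dd q = w k" "dd r = w l" "cc = 0"
    by (simp_all add: sums_contested con dist E threeD[OF pqr])
  then have s: "ss = w j + w k + w l" by (simp add: ss_def three_sum[OF pqr])
  have lt: "dd i < ss" for i using three_cases[OF pqr, of i] d s pos by auto
  let ?Ys = "[V p q, V q p, V q r, V r q, V r p, V p r]"
  have polygon: "polygon hex (map P ?Ys)"
    by (rule polygon_hexagon[OF pqr]) (use d pos in simp_all)
  have distinct: "distinct ?Ys"
    using pos by (auto simp: threeD[OF pqr] three_fun_eq[OF pqr] d s)
  have vertices: "vertices_once M a \<beta> (map P ?Ys)"
    by (rule vertices_onceI) (use threeD[OF pqr] in auto)
  have eq: "dd p = ss - dd q - dd r" "dd q = ss - dd r - dd p" "dd r = ss - dd p - dd q"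
    and pos': "0 < ss - dd q - dd r" "0 < ss - dd r - dd p" "0 < ss - dd p - dd q"
    using d s pos by simp_all
  have rot: "three q r p" "three r p q" using pqr by (auto simp: three_def)
  note opp = opposite_sides_points[OF distinct _ _ _ pqr pos'(3), of 0 3]
      opposite_sides_points[OF distinct _ _ _ rot(1) pos'(1), of 2 5]
      opposite_sides_points[OF distinct _ _ _ rot(2) pos'(2), of 4 1]
  have sides: "parallel_sides (map P ?Ys) 0 3" "side_length (map P ?Ys) 3 = side_length (map P ?Ys) 0"
    by (rule opp(1) opp(2)[OF _ _ _ _ _ _ _ eq(3)]; simp)+
  have sides': "parallel_sides (map P ?Ys) 2 5" "side_length (map P ?Ys) 5 = side_length (map P ?Ys) 2"
    by (rule opp(4) opp(5)[OF _ _ _ _ _ _ _ eq(1)]; simp)+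
  have sides'': "parallel_sides (map P ?Ys) 4 1" "side_length (map P ?Ys) 1 = side_length (map P ?Ys) 4"
    by (rule opp(7) opp(8)[OF _ _ _ _ _ _ _ eq(2)]; simp)+
  have sides: "parallel_sides (map P ?Ys) i (i + 3) \<and>
      side_length (map P ?Ys) i = side_length (map P ?Ys) (i + 3)" if "i < 3" for i
  proof -
    consider "i = 0" | "i = 1" | "i = 2" using \<open>i < 3\<close> by linarith
    then show ?thesis
      by cases (use sides sides' sides'' parallel_sides_commute[OF sides''(1)] in simp_all)
  qed
  \<comment> \<open>The two interior values give each player exactly one of the three goods, in the
    two possible cyclic ways.\<close>
  have interior: "int_count M a \<beta> (rel_interior (face_at M a \<beta>)) = 2"
    unfolding rel_interior_count[OF lt] three_all[OF pqr] d s count using pos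
    by (simp add: threeD[OF pqr])
  have polygons: "\<exists>vs. polygon (face_at M a \<beta>) vs \<and> length vs = 6 \<and> vertices_once M a \<beta> vs \<and>
      (\<forall>i<3. parallel_sides vs i (i + 3) \<and> side_length vs i = side_length vs (i + 3)) \<and>
      int_count M a \<beta> (rel_interior (face_at M a \<beta>)) = 2"
  proof (intro exI conjI allI impI)
    show "polygon (face_at M a \<beta>) (map P ?Ys)" using polygon unfolding face_at_eq_hex .
  qed (use sides vertices interior in simp_all)
  have shared: "\<exists>C D F. shared_between M a \<beta> j C \<and> shared_between M a \<beta> k D \<and> shared_between M a \<beta> l F \<and>
      card C = 2 \<and> card D = 2 \<and> card F = 2 \<and>
      (\<forall>i. of_bool (i \<in> C) + of_bool (i \<in> D) + of_bool (i \<in> F) = (2::nat))"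
  proof (intro exI conjI)
    show "shared_between M a \<beta> j (E j)" "shared_between M a \<beta> k (E k)" "shared_between M a \<beta> l (E l)"
      using shared_between_E M by blast+
  qed (simp_all add: E card_UNIV_minus three_all[OF pqr] threeD[OF pqr])
  have "card (int_PAR M a \<beta>) = 8" by (simp add: card_int_PAR con E dist card_UNIV_minus)
  then show ?thesis unfolding outcome3_def by (intro conjI shared polygons)
qed

lemma outcome4_holds:
  assumes con: "contested = {h, j}" and E: "E h = UNIV" "E j = UNIV - {p}"
  shows "outcome4 M a \<beta>"
proof -
  obtain q r where pqr: "three p q r" using ex_three by blast
  have dist: "h \<noteq> j" "j \<noteq> h" using E by auto
  have count: "count Q = (\<Sum>t\<in>{p,q,r}. \<Sum>u\<in>{q,r}. of_bool (Q (\<lambda>i.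
      w h * of_bool (t = i) + w j * of_bool (u = i))))" for Q
    by (subst count_contested[of "[h, j]"])
      (simp_all only: con dist distinct.simps count_simps E(1)[unfolded three_UNIV[OF pqr]]
        E(2)[unfolded three_minus[OF pqr]])
  have pos: "0 < w h" "0 < w j" using w_pos contested_subset con by auto
  have d: "dd p = w j" "dd q = 0" "dd r = 0" "cc = w h"
    by (simp_all add: sums_contested con dist E threeD[OF pqr])
  then have s: "ss = w h + w j" by (simp add: ss_def three_sum[OF pqr])
  let ?Ys = "[V q r, V r q, V p r, V p q]"
  have polygon: "polygon hex (map P ?Ys)"
    by (rule polygon_trapezoid[OF pqr]) (use d s pos in simp_all)
  have distinct: "distinct ?Ys"
    using pos by (auto simp: threeD[OF pqr] three_fun_eq[OF pqr] d s)
  have vertices: "vertices_once M a \<beta> (map P ?Ys)"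
    by (rule vertices_onceI) (use threeD[OF pqr] in auto)
  have rot: "three q r p" using pqr by (auto simp: three_def)
  have "0 < ss - dd q - dd r" "dd p < ss - dd q - dd r" using d s pos by simp_all
  note opp = opposite_sides_points[OF distinct _ _ _ rot this(1), of 0 2] this(2)
  have sides: "parallel_sides (map P ?Ys) 0 2" "side_length (map P ?Ys) 2 < side_length (map P ?Ys) 0"
    by (rule opp(1) opp(3)[OF _ _ _ _ _ _ _ opp(4)]; simp)+
  have not_parallel: "\<not> parallel_sides (map P ?Ys) 1 3"
  proof
    assume "parallel_sides (map P ?Ys) 1 3"
    moreover have "1 < length ?Ys" "3 < length ?Ys" "2 \<le> length ?Ys" by simp_all
    ultimately obtain t where "\<forall>i. (?Ys ! (Suc 3 mod length ?Ys)) i - (?Ys ! 3) i =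
        t * ((?Ys ! (Suc 1 mod length ?Ys)) i - (?Ys ! 1) i)"
      unfolding parallel_sides_points[OF distinct \<open>1 < length ?Ys\<close> \<open>3 < length ?Ys\<close> \<open>2 \<le> length ?Ys\<close>]
      by blast
    \<comment> \<open>Player \<open>q\<close> gets nothing along side 1, whereas the share of
      \<open>q\<close> changes by \<open>w h\<close> along side 3, so no factor fits.\<close>
    from spec[OF this, of q] show False using d s pos by (simp add: threeD[OF pqr])
  qed
  \<comment> \<open>On the larger base player \<open>p\<close> gets nothing. The endpoints give both
    goods to \<open>q\<close> or both to \<open>r\<close>; the additional values split them.\<close>
  have "count (\<lambda>Y. Y p = 0 \<and> Y \<noteq> V q r \<and> Y \<noteq> V r q) = 2"
    using pos by (simp add: count threeD[OF pqr] three_fun_eq[OF pqr] d s)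
  moreover have side: "\<forall>Y\<in>set ?Ys - {V q r, V r q}. 0 < Y p"
    using pos by (auto simp: threeD[OF pqr] d s)
  ultimately have "int_count M a \<beta> (open_side (map P ?Ys) 0) = 2"
    by (subst open_side_count[OF polygon _ _ _ _ _ side]) (simp_all add: threeD[OF pqr])
  then have "\<exists>vs. polygon (face_at M a \<beta>) vs \<and> length vs = 4 \<and> vertices_once M a \<beta> vs \<and>
      parallel_sides vs 0 2 \<and> \<not> parallel_sides vs 1 3 \<and> side_length vs 2 < side_length vs 0 \<and>
      int_count M a \<beta> (open_side vs 0) = 2"
    using polygon vertices sides not_parallel unfolding face_at_eq_hex
    by (intro exI[of _ "map P ?Ys"] conjI) simp_all
  moreover have "card (int_PAR M a \<beta>) = 6" by (simp add: card_int_PAR con E dist card_UNIV_minus)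
  ultimately show ?thesis unfolding outcome4_def by blast
qed

lemma outcome5_holds:
  assumes pqr: "three p q r" and con: "contested = {h, j, k}"
    and E: "E h = UNIV" "E j = UNIV - {p}" "E k = UNIV - {q}"
  shows "outcome5 M a \<beta>"
proof -
  have dist: "h \<noteq> j" "h \<noteq> k" "j \<noteq> k" "j \<noteq> h" "k \<noteq> h" "k \<noteq> j"
    using E threeD[OF pqr] by auto
  have count: "count Q = (\<Sum>t\<in>{p,q,r}. \<Sum>u\<in>{q,r}. \<Sum>v\<in>{p,r}. of_bool (Q (\<lambda>i.
      w h * of_bool (t = i) + (w j * of_bool (u = i) + w k * of_bool (v = i)))))" for Q
    by (subst count_contested[of "[h, j, k]"])
      (simp_all only: con dist distinct.simps count_simps E(1)[unfolded three_UNIV[OF pqr]]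
        E(2-)[unfolded three_minus[OF pqr]])
  have pos: "0 < w h" "0 < w j" "0 < w k" using w_pos contested_subset con by auto
  have d: "dd p = w j" "dd q = w k" "dd r = 0" "cc = w h"
    by (simp_all add: sums_contested con dist E threeD[OF pqr])
  then have s: "ss = w h + w j + w k" by (simp add: ss_def three_sum[OF pqr])
  have lt: "dd i < ss" for i using three_cases[OF pqr, of i] d s pos by auto
  let ?Ys = "[V p q, V q p, V q r, V r q, V p r]"
  have polygon: "polygon hex (map P ?Ys)"
    by (rule polygon_pentagon[OF pqr]) (use d s pos in simp_all)
  have distinct: "distinct ?Ys"
    using pos by (auto simp: threeD[OF pqr] three_fun_eq[OF pqr] d s)
  have vertices: "vertices_once M a \<beta> (map P ?Ys)"
    by (rule vertices_onceI) (use threeD[OF pqr] in auto)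
  \<comment> \<open>The vertex where \<open>r\<close> takes everything lies on both long sides,
    under a different name on each.\<close>
  have V: "V r q = V r p"
    by (simp add: threeD[OF pqr] three_fun_eq[OF pqr] d s)
  have less: "dd p < ss - dd q - dd r" "dd q < ss - dd r - dd p"
    and pos': "0 < ss - dd q - dd r" "0 < ss - dd r - dd p"
    using d s pos by simp_all
  have rot: "three q r p" "three r p q" using pqr by (auto simp: three_def)
  note opp = opposite_sides_points[OF distinct _ _ _ rot(1) pos'(1), of 2 4]
      opposite_sides_points[OF distinct _ _ _ rot(2) pos'(2), of 3 1]
  have sides: "parallel_sides (map P ?Ys) 2 4" "side_length (map P ?Ys) 4 < side_length (map P ?Ys) 2"
    by (rule opp(1) opp(3)[OF _ _ _ _ _ _ _ less(1)]; simp)+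
  have sides': "parallel_sides (map P ?Ys) 3 1" "side_length (map P ?Ys) 1 < side_length (map P ?Ys) 3"
    by (rule opp(4) opp(6)[OF _ _ _ _ _ _ _ less(2)]; simp add: V)+
  have count_side: "count (\<lambda>Y. Y p = 0 \<and> Y \<noteq> V q r \<and> Y \<noteq> V r q) = 2"
    "count (\<lambda>Y. Y q = 0 \<and> Y \<noteq> V r q \<and> Y \<noteq> V p r) = 2"
    using pos by (simp_all add: count threeD[OF pqr] three_fun_eq[OF pqr] d s)
  have side: "\<forall>Y\<in>set ?Ys - {V q r, V r q}. 0 < Y p" "\<forall>Y\<in>set ?Ys - {V r q, V p r}. 0 < Y q"
    using pos by (auto simp: threeD[OF pqr] d s)
  have open_sides: "int_count M a \<beta> (open_side (map P ?Ys) 2) = 2"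
    "int_count M a \<beta> (open_side (map P ?Ys) 3) = 2"
    by (subst open_side_count[OF polygon _ _ _ _ _ side(1)] open_side_count[OF polygon _ _ _ _ _ side(2)];
        simp add: threeD[OF pqr] count_side d)+
  \<comment> \<open>Interior values give each player exactly one of the three contested
    goods.\<close>
  have interior: "int_count M a \<beta> (rel_interior (face_at M a \<beta>)) = 3"
    unfolding rel_interior_count[OF lt] three_all[OF pqr] d s count using pos
    by (simp add: threeD[OF pqr])
  have "\<exists>x y u v. distinct [x, y, u, v] \<and> {x, y, u, v} \<subseteq> {..<5} \<and>
      parallel_sides (map P ?Ys) x y \<and> side_length (map P ?Ys) y < side_length (map P ?Ys) x \<and>
      parallel_sides (map P ?Ys) u v \<and> side_length (map P ?Ys) v < side_length (map P ?Ys) u \<and>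
      int_count M a \<beta> (open_side (map P ?Ys) x) = 2 \<and> int_count M a \<beta> (open_side (map P ?Ys) u) = 2"
    by (intro exI[of _ "2 :: nat"] exI[of _ "4 :: nat"] exI[of _ "3 :: nat"] exI[of _ "1 :: nat"]
        conjI sides sides' open_sides) simp_all
  then have "\<exists>vs. polygon (face_at M a \<beta>) vs \<and> length vs = 5 \<and> vertices_once M a \<beta> vs \<and>
      (\<exists>x y u v. distinct [x, y, u, v] \<and> {x, y, u, v} \<subseteq> {..<5} \<and>
      parallel_sides vs x y \<and> side_length vs y < side_length vs x \<and>
      parallel_sides vs u v \<and> side_length vs v < side_length vs u \<and>
      int_count M a \<beta> (open_side vs x) = 2 \<and> int_count M a \<beta> (open_side vs u) = 2) \<and>
      int_count M a \<beta> (rel_interior (face_at M a \<beta>)) = 3"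
    using polygon vertices interior unfolding face_at_eq_hex
    by (intro exI[of _ "map P ?Ys"] conjI) simp_all
  moreover have "card (int_PAR M a \<beta>) = 12" by (simp add: card_int_PAR con E dist card_UNIV_minus)
  ultimately show ?thesis unfolding outcome5_def by blast
qed

lemma outcome6_holds:
  assumes pqr: "three p q r" and con: "contested = {h, j, k, l}"
    and E: "E h = UNIV" "E j = UNIV - {p}" "E k = UNIV - {q}" "E l = UNIV - {r}"
  shows "outcome6 M a \<beta>"
proof -
  have dist: "h \<noteq> j" "h \<noteq> k" "h \<noteq> l" "j \<noteq> k" "j \<noteq> l" "k \<noteq> l"
    "j \<noteq> h" "k \<noteq> h" "l \<noteq> h" "k \<noteq> j" "l \<noteq> j" "l \<noteq> k"
    using E threeD[OF pqr] by auto
  have count: "count Q = (\<Sum>t\<in>{p,q,r}. \<Sum>u\<in>{q,r}. \<Sum>v\<in>{p,r}. \<Sum>z\<in>{p,q}. of_bool (Q (\<lambda>i.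
      w h * of_bool (t = i) + (w j * of_bool (u = i) + (w k * of_bool (v = i) + w l * of_bool (z = i))))))" for Q
    by (subst count_contested[of "[h, j, k, l]"])
      (simp_all only: con dist distinct.simps count_simps E(1)[unfolded three_UNIV[OF pqr]]
        E(2-)[unfolded three_minus[OF pqr]])
  have pos: "0 < w h" "0 < w j" "0 < w k" "0 < w l" using w_pos contested_subset con by auto
  have d: "dd p = w j" "dd q = w k" "dd r = w l" "cc = w h"
    by (simp_all add: sums_contested con dist E threeD[OF pqr])
  then have s: "ss = w h + w j + w k + w l" by (simp add: ss_def three_sum[OF pqr])
  have lt: "dd i < ss" for i using three_cases[OF pqr, of i] d s pos by auto
  let ?Ys = "[V p q, V q p, V q r, V r q, V r p, V p r]"
  have polygon: "polygon hex (map P ?Ys)"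
    by (rule polygon_hexagon[OF pqr]) (use d pos in simp_all)
  have distinct: "distinct ?Ys"
    using pos by (auto simp: threeD[OF pqr] three_fun_eq[OF pqr] d s)
  have vertices: "vertices_once M a \<beta> (map P ?Ys)"
    by (rule vertices_onceI) (use threeD[OF pqr] in auto)
  have less: "dd p < ss - dd q - dd r" "dd q < ss - dd r - dd p" "dd r < ss - dd p - dd q"
    using d s pos by simp_all
  have pos': "0 < ss - dd q - dd r" "0 < ss - dd r - dd p" "0 < ss - dd p - dd q"
    using d s pos by simp_all
  have "three q r p" "three r p q" using pqr by (auto simp: three_def)
  note opp = opposite_sides_points[OF distinct _ _ _ pqr pos'(3), of 0 3]
      opposite_sides_points[OF distinct _ _ _ this(1) pos'(1), of 2 5]
      opposite_sides_points[OF distinct _ _ _ this(2) pos'(2), of 4 1]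
  have sides: "parallel_sides (map P ?Ys) 0 3 \<and> side_length (map P ?Ys) 3 < side_length (map P ?Ys) 0"
    "parallel_sides (map P ?Ys) 2 5 \<and> side_length (map P ?Ys) 5 < side_length (map P ?Ys) 2"
    "parallel_sides (map P ?Ys) 4 1 \<and> side_length (map P ?Ys) 1 < side_length (map P ?Ys) 4"
    by (intro conjI; (rule opp(1) opp(4) opp(7) opp(3)[OF _ _ _ _ _ _ _ less(3)]
        opp(6)[OF _ _ _ _ _ _ _ less(1)] opp(9)[OF _ _ _ _ _ _ _ less(2)]; simp))+
  have count_side: "count (\<lambda>Y. Y r = 0 \<and> Y \<noteq> V p q \<and> Y \<noteq> V q p) = 2"
    "count (\<lambda>Y. Y p = 0 \<and> Y \<noteq> V q r \<and> Y \<noteq> V r q) = 2"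
    "count (\<lambda>Y. Y q = 0 \<and> Y \<noteq> V r p \<and> Y \<noteq> V p r) = 2"
    using pos by (simp_all add: count threeD[OF pqr] three_fun_eq[OF pqr] d s)
  have side: "\<forall>Y\<in>set ?Ys - {V p q, V q p}. 0 < Y r" "\<forall>Y\<in>set ?Ys - {V q r, V r q}. 0 < Y p"
    "\<forall>Y\<in>set ?Ys - {V r p, V p r}. 0 < Y q"
    using pos by (auto simp: threeD[OF pqr] d s)
  have open_sides: "int_count M a \<beta> (open_side (map P ?Ys) 0) = 2"
    "int_count M a \<beta> (open_side (map P ?Ys) 2) = 2" "int_count M a \<beta> (open_side (map P ?Ys) 4) = 2"
    by (subst open_side_count[OF polygon _ _ _ _ _ side(1)] open_side_count[OF polygon _ _ _ _ _ side(2)]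
          open_side_count[OF polygon _ _ _ _ _ side(3)]; simp add: threeD[OF pqr] count_side)+
  have interior: "int_count M a \<beta> (rel_interior (face_at M a \<beta>)) = 12"
    unfolding rel_interior_count[OF lt] three_all[OF pqr] d s count using pos
    by (simp add: threeD[OF pqr])
  \<comment> \<open>Sides with even index have a vanishing coordinate and are the longer ones, so
    for \<open>i = 1\<close> the longer side of the pair is side 4.\<close>
  have pairs: "\<exists>x y. {x, y} = {i, i + 3} \<and>
      parallel_sides (map P ?Ys) x y \<and> side_length (map P ?Ys) y < side_length (map P ?Ys) x \<and>
      int_count M a \<beta> (open_side (map P ?Ys) x) = 2" if i: "i < 3" for i
  proof -
    consider "i = 0" | "i = 1" | "i = 2" using i by linarith
    then show ?thesis
    proof cases
      case 1
      then show ?thesis using sides(1) open_sides(1) by (intro exI[of _ 0] exI[of _ 3]) simp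
    next
      case 2
      then show ?thesis using sides(3) open_sides(3) by (intro exI[of _ 4] exI[of _ 1]) auto
    next
      case 3
      then show ?thesis using sides(2) open_sides(2) by (intro exI[of _ 2] exI[of _ 5]) simp
    qed
  qed
  have "\<exists>vs. polygon (face_at M a \<beta>) vs \<and> length vs = 6 \<and> vertices_once M a \<beta> vs \<and>
      (\<forall>i<3. \<exists>x y. {x, y} = {i, i + 3} \<and> parallel_sides vs x y \<and> side_length vs y < side_length vs x \<and>
        int_count M a \<beta> (open_side vs x) = 2) \<and>
      int_count M a \<beta> (rel_interior (face_at M a \<beta>)) = 12"
    using polygon vertices interior pairs unfolding face_at_eq_hex
    by (intro exI[of _ "map P ?Ys"] conjI allI impI) simp_all
  moreover have "card (int_PAR M a \<beta>) = 24" by (simp add: card_int_PAR con E dist card_UNIV_minus)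
  ultimately show ?thesis unfolding outcome6_def by blast
qed

section \<open>Configurations in terms of contested goods and their eligible players\<close>

lemma contested_cases:
  assumes "j \<in> contested"
  obtains "E j = UNIV" | i where "E j = UNIV - {i}"
  using assms by (cases rule: E_cases[of j]) (auto simp: contested_def)

lemma contestedI: "j \<in> M \<Longrightarrow> E j = UNIV \<Longrightarrow> j \<in> contested" "j \<in> M \<Longrightarrow> E j = UNIV - {i} \<Longrightarrow> j \<in> contested"
  by (simp_all add: contested_def)

lemma no_others_iff: "no_others M a \<beta> C \<longleftrightarrow> contested \<subseteq> C"
proof -
  have "(loc a h \<noteq> \<beta> \<and> (\<forall>i. loc a h \<notin> disputing_segment \<beta> i)) \<longleftrightarrow> h \<notin> contested" if "h \<in> M" for h
    using that contestedI[OF that] by (auto simp: loc_iff elim: contested_cases)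
  then show ?thesis unfolding no_others_def using contested_subset by blast
qed

lemma supporting_segments_iff:
  assumes "j \<in> M" shows "\<beta> \<in> supporting_segments a j \<longleftrightarrow> j \<in> contested"
proof -
  have "\<beta> \<in> supporting_segments a j \<longleftrightarrow> E j = UNIV \<or> (\<exists>i. E j = UNIV - {i})"
    unfolding supporting_segments_def using in_closed_segment_vertex_iff[OF \<beta> loc_simplex[OF assms]]
    by (simp add: loc_iff[OF assms])
  then show ?thesis using contestedI[OF assms] by (metis contested_cases)
qed

text \<open>A good at \<beta> lies on the supporting segments of every contested good, and of two
  goods on one disputing segment the nearer lies on a supporting segment of the farther. Hence
  s-independence of contested goods means different disputing segments.\<close>

lemma s_independent_iff:
  assumes "j \<in> contested" "k \<in> contested"
  shows "s_independent a j k \<longleftrightarrow> (\<exists>p q. p \<noteq> q \<and> E j = UNIV - {p} \<and> E k = UNIV - {q})"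
proof
  have M: "j \<in> M" "k \<in> M" using assms contested_subset by auto
  assume ind: "s_independent a j k"
  have "E j \<noteq> UNIV"
  proof
    assume "E j = UNIV"
    then have "loc a j = \<beta>" using loc_iff(1) M by blast
    moreover have "\<beta> \<in> supporting_segments a k" using supporting_segments_iff M assms by blast
    ultimately show False using ind by (simp add: s_independent_def)
  qed
  then obtain p where p: "E j = UNIV - {p}" using assms(1) by (metis contested_cases)
  have "E k \<noteq> UNIV"
  proof
    assume "E k = UNIV"
    then have "loc a k = \<beta>" using loc_iff(1) M by blast
    moreover have "\<beta> \<in> supporting_segments a j" using supporting_segments_iff M assms by blast
    ultimately show False using ind by (simp add: s_independent_def)
  qed
  then obtain q where q: "E k = UNIV - {q}" using assms(2) by (metis contested_cases)
  have "p \<noteq> q"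
  proof
    assume "p = q"
    then have "loc a j \<in> disputing_segment \<beta> p" "loc a k \<in> disputing_segment \<beta> p"
      using p q loc_iff(2) M by auto
    then show False using same_disputing_segment[OF \<beta>] ind
      unfolding s_independent_def supporting_segments_def by blast
  qed
  then show "\<exists>p q. p \<noteq> q \<and> E j = UNIV - {p} \<and> E k = UNIV - {q}" using p q by blast
next
  have M: "j \<in> M" "k \<in> M" using assms contested_subset by auto
  assume "\<exists>p q. p \<noteq> q \<and> E j = UNIV - {p} \<and> E k = UNIV - {q}"
  then obtain p q where pq: "p \<noteq> q" "loc a j \<in> disputing_segment \<beta> p" "loc a k \<in> disputing_segment \<beta> q"
    using loc_iff(2) M by blast
  then show "s_independent a j k"
    using disputing_segments_independent[OF \<beta> pq(2,3,1)] disputing_segments_independent[OF \<beta> pq(3,2)]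
    unfolding s_independent_def supporting_segments_def by blast
qed

lemma contested_in_M: "j \<in> contested \<Longrightarrow> j \<in> M"
  using contested_subset by blast

lemma contested_supporting: "j \<in> contested \<Longrightarrow> \<beta> \<in> supporting_segments a j"
  using supporting_segments_iff contested_in_M by blast

lemma s_independentI:
  assumes "j \<in> contested" "k \<in> contested" "E j = UNIV - {p}" "E k = UNIV - {q}" "p \<noteq> q"
  shows "s_independent a j k"
  unfolding s_independent_iff[OF assms(1,2)] using assms(3-5) by (intro exI conjI)

lemma s_independentE:
  assumes "s_independent a j k" "j \<in> contested" "k \<in> contested"
  obtains p q where "p \<noteq> q" "E j = UNIV - {p}" "E k = UNIV - {q}"
  using assms(1) unfolding s_independent_iff[OF assms(2,3)] by (elim exE conjE)

lemma s_independent_three: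
  assumes "s_independent a j k" "s_independent a j l" "s_independent a k l"
    and con: "j \<in> contested" "k \<in> contested" "l \<in> contested"
  obtains p q r where "three p q r" "E j = UNIV - {p}" "E k = UNIV - {q}" "E l = UNIV - {r}"
proof -
  obtain p q where 1: "p \<noteq> q" "E j = UNIV - {p}" "E k = UNIV - {q}"
    by (rule s_independentE[OF assms(1) con(1,2)])
  obtain p' r where 2: "p' \<noteq> r" "E j = UNIV - {p'}" "E l = UNIV - {r}"
    by (rule s_independentE[OF assms(2) con(1,3)])
  obtain q' r' where 3: "q' \<noteq> r'" "E k = UNIV - {q'}" "E l = UNIV - {r'}"
    by (rule s_independentE[OF assms(3) con(2,3)])
  have "p' = p" "q' = q" "r' = r" using 1 2 3 UNIV_minus_inj(1) by metis+
  then have "three p q r" using 1 2 3 by (simp add: three_def)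
  then show thesis using that 1 2 by blast
qed

lemma three_independent:
  assumes "three p q r" "E j = UNIV - {p}" "E k = UNIV - {q}" "E l = UNIV - {r}"
    and con: "j \<in> contested" "k \<in> contested" "l \<in> contested"
  shows "s_independent a j k" "s_independent a j l" "s_independent a k l"
  using s_independentI[OF con(1,2) assms(2,3)] s_independentI[OF con(1,3) assms(2,4)]
    s_independentI[OF con(2,3) assms(3,4)] threeD[OF assms(1)] by simp_all

lemma loc_at: "j \<in> M \<Longrightarrow> \<beta> = loc a j \<longleftrightarrow> j \<in> contested \<and> E j = UNIV"
  using loc_iff(1)[of j] contestedI(1)[of j] by auto

text \<open>As in the five lemmas on configurations that follow, \<open>no_others\<close> bounds the
  contested set from above, and the position of the named goods puts them into it.\<close>

lemma config1_iff: "config1 M a \<beta> j \<longleftrightarrow> contested = {j} \<and> E j = UNIV"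
proof
  assume "config1 M a \<beta> j"
  then show "contested = {j} \<and> E j = UNIV"
    unfolding config1_def no_others_iff using loc_at[of j] by auto
next
  assume R: "contested = {j} \<and> E j = UNIV"
  then have "j \<in> M" using contested_in_M[of j] by simp
  then show "config1 M a \<beta> j"
    unfolding config1_def no_others_iff using R \<beta> loc_at[of j] by simp
qed

lemma config2_iff:
  "config2 M a \<beta> j k \<longleftrightarrow> contested = {j, k} \<and> (\<exists>p q. p \<noteq> q \<and> E j = UNIV - {p} \<and> E k = UNIV - {q})"
    (is "_ \<longleftrightarrow> ?R")
proof
  assume c: "config2 M a \<beta> j k"
  then have con: "j \<in> contested" "k \<in> contested" "contested \<subseteq> {j, k}"
    unfolding config2_def no_others_iff using supporting_segments_iff by auto
  have "s_independent a j k" using c by (simp add: config2_def)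
  then show ?R unfolding s_independent_iff[OF con(1,2)] using con by (intro conjI) auto
next
  assume R: ?R
  then have con: "j \<in> contested" "k \<in> contested" by auto
  moreover have "s_independent a j k" unfolding s_independent_iff[OF con] using R by (rule conjunct2)
  ultimately show "config2 M a \<beta> j k"
    using R by (simp add: config2_def no_others_iff \<beta> contested_supporting contested_in_M)
qed

lemma config3_iff:
  "config3 M a \<beta> j k l \<longleftrightarrow> contested = {j, k, l} \<and>
    (\<exists>p q r. three p q r \<and> E j = UNIV - {p} \<and> E k = UNIV - {q} \<and> E l = UNIV - {r})"
    (is "_ \<longleftrightarrow> ?R")
proof
  assume c: "config3 M a \<beta> j k l"
  then have con: "j \<in> contested" "k \<in> contested" "l \<in> contested" "contested \<subseteq> {j, k, l}"
    unfolding config3_def no_others_iff using supporting_segments_iff by auto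
  have "s_independent a j k" "s_independent a j l" "s_independent a k l"
    using c by (simp_all add: config3_def)
  then obtain p q r where "three p q r" "E j = UNIV - {p}" "E k = UNIV - {q}" "E l = UNIV - {r}"
    by (rule s_independent_three[OF _ _ _ con(1-3)])
  moreover have "contested = {j, k, l}" using con by auto
  ultimately show ?R by (intro conjI exI)
next
  assume R: ?R
  then have con: "j \<in> contested" "k \<in> contested" "l \<in> contested" by auto
  obtain p q r where "three p q r" "E j = UNIV - {p}" "E k = UNIV - {q}" "E l = UNIV - {r}"
    using R by (elim conjE exE)
  from three_independent[OF this con] show "config3 M a \<beta> j k l"
    using R con by (simp add: config3_def no_others_iff \<beta> contested_supporting contested_in_M)
qed

lemma config4_iff:
  "config4 M a \<beta> j k \<longleftrightarrow> contested = {j, k} \<and> E j = UNIV \<and> (\<exists>p. E k = UNIV - {p})"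
    (is "_ \<longleftrightarrow> ?R")
proof
  assume c: "config4 M a \<beta> j k"
  then have M: "j \<in> M" "k \<in> M" by (simp_all add: config4_def)
  obtain p where p: "E k = UNIV - {p}" using c loc_iff(2)[OF M(2)] by (auto simp: config4_def)
  then have "k \<in> contested" using contestedI(2) M by simp
  then show ?R using c loc_at[OF M(1)] p by (auto simp: config4_def no_others_iff)
next
  assume R: ?R
  then have M: "j \<in> M" "k \<in> M" using contested_in_M by auto
  have "loc a j = \<beta>" using R loc_iff(1)[OF M(1)] by simp
  then show "config4 M a \<beta> j k"
    using R M loc_iff(2)[OF M(2)] by (simp add: config4_def no_others_iff \<beta>)
qed

lemma config5_iff:
  "config5 M a \<beta> j k h \<longleftrightarrow> contested = {h, j, k} \<and> E h = UNIV \<and>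
    (\<exists>p q. p \<noteq> q \<and> E j = UNIV - {p} \<and> E k = UNIV - {q})"
    (is "_ \<longleftrightarrow> ?R")
proof
  assume c: "config5 M a \<beta> j k h"
  then have con: "j \<in> contested" "k \<in> contested" "contested \<subseteq> {h, j, k}"
    unfolding config5_def no_others_iff using supporting_segments_iff by auto
  have h: "h \<in> contested" "E h = UNIV" using c loc_at[of h] by (auto simp: config5_def)
  have "s_independent a j k" using c by (simp add: config5_def)
  then show ?R unfolding s_independent_iff[OF con(1,2)] using con h by (intro conjI) auto
next
  assume R: ?R
  then have con: "h \<in> contested" "j \<in> contested" "k \<in> contested" by auto
  moreover have "s_independent a j k" unfolding s_independent_iff[OF con(2,3)] using R by blast
  moreover have "loc a h = \<beta>" using R con loc_iff(1) contested_in_M by simp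
  ultimately show "config5 M a \<beta> j k h"
    using R \<beta> unfolding config5_def no_others_iff
    by (simp add: contested_supporting contested_in_M insert_commute)
qed

lemma config6_iff:
  "config6 M a \<beta> j k l h \<longleftrightarrow> contested = {h, j, k, l} \<and> E h = UNIV \<and>
    (\<exists>p q r. three p q r \<and> E j = UNIV - {p} \<and> E k = UNIV - {q} \<and> E l = UNIV - {r})"
    (is "_ \<longleftrightarrow> ?R")
proof
  assume c: "config6 M a \<beta> j k l h"
  then have con: "j \<in> contested" "k \<in> contested" "l \<in> contested" "contested \<subseteq> {h, j, k, l}"
    unfolding config6_def no_others_iff using supporting_segments_iff by auto
  have h: "h \<in> contested" "E h = UNIV" using c loc_at[of h] by (auto simp: config6_def)
  have "s_independent a j k" "s_independent a j l" "s_independent a k l"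
    using c by (simp_all add: config6_def)
  then obtain p q r where "three p q r" "E j = UNIV - {p}" "E k = UNIV - {q}" "E l = UNIV - {r}"
    by (rule s_independent_three[OF _ _ _ con(1-3)])
  moreover have "contested = {h, j, k, l}" using con h by auto
  ultimately show ?R using h by (intro conjI exI)
next
  assume R: ?R
  then have con: "h \<in> contested" "j \<in> contested" "k \<in> contested" "l \<in> contested" by auto
  obtain p q r where "three p q r" "E j = UNIV - {p}" "E k = UNIV - {q}" "E l = UNIV - {r}"
    using R by (elim conjE exE)
  note ind = three_independent[OF this con(2-4)]
  have "loc a h = \<beta>" using R con loc_iff(1) contested_in_M by simp
  then show "config6 M a \<beta> j k l h"
    using R con ind \<beta> unfolding config6_def no_others_iff
    by (simp add: contested_supporting contested_in_M insert_commute)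
qed

end

text \<open>Lists the players satisfying \<open>Z\<close> first, so that only their number remains
  to be distinguished.\<close>

lemma ex_three_pattern: "\<exists>p q r. three p q r \<and> (Z r \<longrightarrow> Z q) \<and> (Z q \<longrightarrow> Z p)"
proof -
  obtain p q r where "three p q r" "(if Z p then 0 else 1 :: real) \<le> (if Z q then 0 else 1)"
    "(if Z q then 0 else 1 :: real) \<le> (if Z r then 0 else 1)"
    using ex_three_sorted[of "\<lambda>i. if Z i then 0 else 1"] by blast
  then show ?thesis by (intro exI[of _ p] exI[of _ q] exI[of _ r]) (auto split: if_splits)
qed

section \<open>Outcomes of the configurations, and completeness of their list\<close>

context division
begin

lemma config_outcomes:
  "config1 M a \<beta> j \<Longrightarrow> outcome1 M a \<beta> j"
  "config2 M a \<beta> j k \<Longrightarrow> outcome2 M a \<beta> j k"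
  "config3 M a \<beta> j k l \<Longrightarrow> outcome3 M a \<beta> j k l"
  "config4 M a \<beta> j k \<Longrightarrow> outcome4 M a \<beta>"
  "config5 M a \<beta> j k h \<Longrightarrow> outcome5 M a \<beta>"
  "config6 M a \<beta> j k l h \<Longrightarrow> outcome6 M a \<beta>"
  unfolding config1_iff config2_iff config3_iff config4_iff config5_iff config6_iff
  by (metis outcome1_holds, metis outcome2_holds ex_three2, metis outcome3_holds,
      metis outcome4_holds, metis outcome5_holds ex_three2, metis outcome6_holds)

lemma outcome_polygon:
  "outcome1 M a \<beta> j \<Longrightarrow> \<exists>vs. polygon (face_at M a \<beta>) vs"
  "outcome2 M a \<beta> j k \<Longrightarrow> \<exists>vs. polygon (face_at M a \<beta>) vs"
  "outcome3 M a \<beta> j k l \<Longrightarrow> \<exists>vs. polygon (face_at M a \<beta>) vs"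
  "outcome4 M a \<beta> \<Longrightarrow> \<exists>vs. polygon (face_at M a \<beta>) vs"
  "outcome5 M a \<beta> \<Longrightarrow> \<exists>vs. polygon (face_at M a \<beta>) vs"
  "outcome6 M a \<beta> \<Longrightarrow> \<exists>vs. polygon (face_at M a \<beta>) vs"
  unfolding outcome1_def outcome2_def outcome3_def outcome4_def outcome5_def outcome6_def
  by (elim conjE exE, rule exI, assumption)+

lemma some_config_pareto_face:
  assumes "some_config M a \<beta>" shows "pareto_face M a (face_at M a \<beta>)"
proof -
  have "\<exists>vs. polygon (face_at M a \<beta>) vs"
    using assms unfolding some_config_def
    by (elim disjE exE) (erule config_outcomes(1)[THEN outcome_polygon(1)]
        config_outcomes(2)[THEN outcome_polygon(2)] config_outcomes(3)[THEN outcome_polygon(3)]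
        config_outcomes(4)[THEN outcome_polygon(4)] config_outcomes(5)[THEN outcome_polygon(5)]
        config_outcomes(6)[THEN outcome_polygon(6)])+
  then obtain vs where "polygon (face_at M a \<beta>) vs" ..
  then have "aff_dim (face_at M a \<beta>) = 2" unfolding polygon_def by (elim conjE)
  then show ?thesis using face_at_face_of face_at_pareto by (simp add: pareto_face_def)
qed

lemma outcomes_hold: "outcomes M a \<beta>"
  unfolding outcomes_def
  by (intro conjI allI impI some_config_pareto_face; (rule config_outcomes)?; assumption)

text \<open>If all contested weight lies on one disputing segment, only \<open>q\<close> and
  \<open>r\<close> compete, and the face is at most a segment.\<close>

lemma aff_dim_hex_le_1:
  assumes pqr: "three p q r" and "dd q = 0" "dd r = 0" "cc = 0"
  shows "aff_dim hex \<le> 1"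
proof -
  have "V p q = V q r" "V q p = V q r" "V p r = V r q" "V r p = V r q"
    using assms(2-4) by (simp_all add: threeD[OF pqr] three_fun_eq[OF pqr] ss_def three_sum[OF pqr])
  then have "hex = convex hull {P (V q r), P (V r q)}"
    using hex_eq_hull[OF pqr] by (simp add: insert_commute)
  then have "aff_dim hex = aff_dim {P (V q r), P (V r q)}" by (simp only: aff_dim_convex_hull)
  then show ?thesis by simp
qed

text \<open>Injectivity leaves at most one good at \<beta> and one on each disputing segment. Which
  of these four places are occupied decides the configuration.\<close>

lemma some_config_if_aff_dim:
  assumes inj: "inj_on E contested" and dim: "aff_dim (face_at M a \<beta>) = 2"
  shows "some_config M a \<beta>"
proof -
  define Z where "Z i \<longleftrightarrow> (\<exists>j\<in>contested. E j = UNIV - {i})" for i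
  obtain p q r where pqr: "three p q r" and Z: "Z r \<longrightarrow> Z q" "Z q \<longrightarrow> Z p"
    using ex_three_pattern[of Z] by blast
  \<comment> \<open>The good on the disputing segment of \<open>i\<close>, meaningful only under
    \<open>Z i\<close>.\<close>
  define g where "g i = (SOME j. j \<in> contested \<and> E j = UNIV - {i})" for i
  have g: "g i \<in> contested \<and> E (g i) = UNIV - {i}" if "Z i" for i
    using that unfolding Z_def g_def by (intro someI_ex[of "\<lambda>j. j \<in> contested \<and> E j = UNIV - {i}"]) blast
  define U where "U = {j \<in> contested. E j = UNIV}"
  have con: "contested = U \<union> g ` {i. Z i}"
  proof (intro set_eqI iffI)
    fix x assume x: "x \<in> contested"
    then show "x \<in> U \<union> g ` {i. Z i}"
    proof (cases rule: contested_cases)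
      case (2 i)
      then have Zi: "Z i" using x unfolding Z_def by blast
      then have "x = g i" using g[OF Zi] inj_onD[OF inj, of x "g i"] x 2 by simp
      then show ?thesis using Zi by blast
    qed (use x in \<open>simp add: U_def\<close>)
  next
    fix x assume "x \<in> U \<union> g ` {i. Z i}"
    then show "x \<in> contested" using g by (auto simp: U_def)
  qed
  have dd0: "dd i = 0" if "\<not> Z i" for i
    unfolding sums_contested(1) by (rule sum.neutral) (use that in \<open>simp add: Z_def\<close>)
  note ZI = set_eq_iff three_all[OF pqr] threeD[OF pqr]
  have Zs: "\<not> Z p \<Longrightarrow> {i. Z i} = {}" "Z p \<Longrightarrow> \<not> Z q \<Longrightarrow> {i. Z i} = {p}"
    "Z q \<Longrightarrow> \<not> Z r \<Longrightarrow> {i. Z i} = {p, q}" "Z r \<Longrightarrow> {i. Z i} = {p, q, r}"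
    using Z by (simp_all add: ZI)
  show ?thesis
  proof (cases "\<exists>h\<in>contested. E h = UNIV")
    case True
    then obtain h where h: "h \<in> contested" "E h = UNIV" by blast
    have "x = h" if "x \<in> contested" "E x = UNIV" for x
      using inj_onD[OF inj, of x h] that h by simp
    then have "U = {h}" unfolding U_def using h by blast
    then have con: "contested = insert h (g ` {i. Z i})" using con by simp
    consider "\<not> Z p" | "Z p" "\<not> Z q" | "Z q" "\<not> Z r" | "Z r" using Z by blast
    then show ?thesis
    proof cases
      case 1
      then have "contested = {h}" using con by (simp add: Zs)
      then have "config1 M a \<beta> h" using h unfolding config1_iff by (intro conjI)
      then show ?thesis unfolding some_config_def by blast
    next
      case 2
      then have "contested = {h, g p}" using con by (simp add: Zs)
      moreover have "E (g p) = UNIV - {p}" using 2 g by simp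
      ultimately have "config4 M a \<beta> h (g p)" using h unfolding config4_iff by (intro conjI exI)
      then show ?thesis unfolding some_config_def by blast
    next
      case 3
      then have "contested = {h, g p, g q}" using con by (simp add: Zs)
      moreover have "E (g p) = UNIV - {p}" "E (g q) = UNIV - {q}" using 3 Z g by simp_all
      ultimately have "config5 M a \<beta> (g p) (g q) h"
        using h threeD(1)[OF pqr] unfolding config5_iff by (intro conjI exI)
      then show ?thesis unfolding some_config_def by blast
    next
      case 4
      then have "contested = {h, g p, g q, g r}" using con by (simp add: Zs)
      moreover have "E (g p) = UNIV - {p}" "E (g q) = UNIV - {q}" "E (g r) = UNIV - {r}"
        using 4 Z g by simp_all
      ultimately have "config6 M a \<beta> (g p) (g q) (g r) h"
        using h pqr unfolding config6_iff by (intro conjI exI)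
      then show ?thesis unfolding some_config_def by blast
    qed
  next
    case False
    then have "U = {}" unfolding U_def by blast
    then have con: "contested = g ` {i. Z i}" using con by simp
    have "cc = 0" unfolding sums_contested(2) by (rule sum.neutral) (use False in simp)
    \<comment> \<open>Without a good at \<beta>, dimension two requires at least two occupied
      disputing segments.\<close>
    then have "Z q"
      using aff_dim_hex_le_1[OF pqr] dim dd0[of q] dd0[of r] Z(1) unfolding face_at_eq_hex by force
    show ?thesis
    proof (cases "Z r")
      case True
      then have "contested = {g p, g q, g r}" using con by (simp add: Zs)
      moreover have "E (g p) = UNIV - {p}" "E (g q) = UNIV - {q}" "E (g r) = UNIV - {r}"
        using True Z g by simp_all
      ultimately have "config3 M a \<beta> (g p) (g q) (g r)"
        using pqr unfolding config3_iff by (intro conjI exI)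
      then show ?thesis unfolding some_config_def by blast
    next
      case nr: False
      then have "contested = {g p, g q}" using con \<open>Z q\<close> by (simp add: Zs)
      moreover have "E (g p) = UNIV - {p}" "E (g q) = UNIV - {q}" using \<open>Z q\<close> Z g by simp_all
      ultimately have "config2 M a \<beta> (g p) (g q)"
        using threeD(1)[OF pqr] unfolding config2_iff by (intro conjI exI)
      then show ?thesis unfolding some_config_def by blast
    qed
  qed
qed

section \<open>Merging goods\<close>

abbreviation "N \<equiv> merged_goods M a \<beta>"
abbreviation "A \<equiv> merged_val a"

lemma same_dispute_iff:
  "(j, k) \<in> same_dispute M a \<beta> \<longleftrightarrow> j \<in> M \<and> k \<in> M \<and> (j = k \<or> j \<in> contested \<and> E j = E k)"
proof -
  have "(loc a j = \<beta> \<and> loc a k = \<beta> \<or> (\<exists>i. loc a j \<in> disputing_segment \<beta> i \<and> loc a k \<in> disputing_segment \<beta> i))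
      \<longleftrightarrow> j \<in> contested \<and> E j = E k" if "j \<in> M" "k \<in> M"
    unfolding loc_iff(1)[OF that(1)] loc_iff(1)[OF that(2)] loc_iff(2)[OF that(1)] loc_iff(2)[OF that(2)]
    using contestedI[OF that(1)] by (metis contested_cases)
  then show ?thesis unfolding same_dispute_def by auto
qed

lemma equiv_same_dispute: "equiv M (same_dispute M a \<beta>)"
proof (rule equivI)
  show "same_dispute M a \<beta> \<subseteq> M \<times> M" by (auto simp: same_dispute_iff)
  show "refl_on M (same_dispute M a \<beta>)" by (auto simp: refl_on_def same_dispute_iff)
  show "sym (same_dispute M a \<beta>)" by (auto intro!: symI simp: same_dispute_iff contested_def)
  show "trans (same_dispute M a \<beta>)" by (auto intro!: transI simp: same_dispute_iff)
qed

lemma merged_subset: "B \<in> N \<Longrightarrow> B \<subseteq> M"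
  unfolding merged_goods_def by (rule in_quotient_imp_subset[OF equiv_same_dispute])

lemma merged_nonempty: "B \<in> N \<Longrightarrow> B \<noteq> {}"
  unfolding merged_goods_def by (rule in_quotient_imp_non_empty[OF equiv_same_dispute])

lemma merged_disjoint: "B \<in> N \<Longrightarrow> C \<in> N \<Longrightarrow> B \<noteq> C \<Longrightarrow> B \<inter> C = {}"
  unfolding merged_goods_def using quotient_disj[OF equiv_same_dispute, of B C] by blast

lemma merged_same_dispute: "B \<in> N \<Longrightarrow> j \<in> B \<Longrightarrow> k \<in> B \<Longrightarrow> (j, k) \<in> same_dispute M a \<beta>"
  unfolding merged_goods_def using quotient_eq_iff[OF equiv_same_dispute, of B B j k] by simp

lemma merged_E: "B \<in> N \<Longrightarrow> j \<in> B \<Longrightarrow> k \<in> B \<Longrightarrow> E j = E k"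
  using merged_same_dispute[of B j k] same_dispute_iff[of j k] by blast

lemma Union_merged: "\<Union>N = M"
  unfolding merged_goods_def by (rule Union_quotient[OF equiv_same_dispute])

lemma finite_merged: "finite N"
  unfolding merged_goods_def using finite_M equiv_same_dispute by (intro finite_quotient equiv_type)

lemma division_merged: "division N A \<beta>"
proof
  fix B i assume "B \<in> N"
  then show "0 < A i B"
    using merged_subset[of B] merged_nonempty[of B] finite_M a_pos unfolding merged_val_def
    by (intro sum_pos) (auto intro: finite_subset)
qed (use finite_merged \<beta> in auto)

context
begin

interpretation merged: division N A \<beta>
  by (rule division_merged)

text \<open>Goods in one class have the same eligible players, so the same player attains the
  maximal ratio for all of them and the maximum of the sum is the sum of the maxima.\<close>

lemma merged_E_w:
  assumes "B \<in> N" "j \<in> B"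
  shows "merged.E B = E j" and "merged.w B = (\<Sum>k\<in>B. w k)"
proof -
  have fin: "finite B" using merged_subset[OF assms(1)] finite_M finite_subset by blast
  have le: "A i B \<le> \<beta> $ i * (\<Sum>k\<in>B. w k)" for i
    unfolding merged_val_def sum_distrib_left by (intro sum_mono a_le)
  have eq: "A i B = \<beta> $ i * (\<Sum>k\<in>B. w k) \<longleftrightarrow> i \<in> E j" for i
  proof
    assume "A i B = \<beta> $ i * (\<Sum>k\<in>B. w k)"
    then have "(\<Sum>k\<in>B. \<beta> $ i * w k - a i k) = 0"
      by (simp add: merged_val_def sum_subtractf sum_distrib_left)
    then have "\<forall>k\<in>B. \<beta> $ i * w k - a i k = 0"
      using fin a_le by (subst (asm) sum_nonneg_eq_0_iff) auto
    then show "i \<in> E j" using assms(2) by (simp add: E_iff)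
  next
    assume "i \<in> E j"
    then have "a i k = \<beta> $ i * w k" if "k \<in> B" for k
      using merged_E[OF assms(1) that assms(2)] E_iff by blast
    then show "A i B = \<beta> $ i * (\<Sum>k\<in>B. w k)" by (simp add: merged_val_def sum_distrib_left)
  qed
  obtain i where i: "i \<in> E j" using E_nonempty by blast
  have "\<beta> $ i * (\<Sum>k\<in>B. w k) \<le> \<beta> $ i * merged.w B"
    using merged.a_le[of i B] eq[of i] i by simp
  then have "(\<Sum>k\<in>B. w k) \<le> merged.w B" using \<beta>_pos[of i] by simp
  moreover obtain k where "k \<in> merged.E B" using merged.E_nonempty by blast
  then have "\<beta> $ k * merged.w B \<le> \<beta> $ k * (\<Sum>k\<in>B. w k)" using merged.E_iff le[of k] by simp
  then have "merged.w B \<le> (\<Sum>k\<in>B. w k)" using \<beta>_pos[of k] by simp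
  ultimately show w: "merged.w B = (\<Sum>k\<in>B. w k)" by simp
  show "merged.E B = E j" using merged.E_iff[of _ B] eq unfolding w by blast
qed

lemma sum_merged: "(\<Sum>B | B \<in> N \<and> merged.E B = S. \<Sum>j\<in>B. f j) = (\<Sum>j | j \<in> M \<and> E j = S. f j)"
proof -
  let ?N = "{B \<in> N. merged.E B = S}"
  have "{j \<in> M. E j = S} = \<Union>?N"
  proof (intro set_eqI iffI)
    fix j assume j: "j \<in> {j \<in> M. E j = S}"
    then obtain B where "B \<in> N" "j \<in> B" using Union_merged by blast
    then show "j \<in> \<Union>?N" using merged_E_w(1) j by blast
  next
    fix j assume "j \<in> \<Union>?N"
    then obtain B where "B \<in> N" "merged.E B = S" "j \<in> B" by blast
    then show "j \<in> {j \<in> M. E j = S}" using merged_E_w(1) merged_subset by blast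
  qed
  moreover have "sum f (\<Union>?N) = (sum \<circ> sum) f ?N"
  proof (rule sum.Union_disjoint)
    show "\<forall>B\<in>?N. finite B" using merged_subset finite_M finite_subset by blast
    show "\<forall>B\<in>?N. \<forall>C\<in>?N. B \<noteq> C \<longrightarrow> B \<inter> C = {}" using merged_disjoint by blast
  qed
  ultimately show ?thesis by simp
qed

lemma sum_w_merged: "(\<Sum>B | B \<in> N \<and> merged.E B = S. merged.w B) = (\<Sum>j | j \<in> M \<and> E j = S. w j)"
proof -
  have "merged.w B = (\<Sum>j\<in>B. w j)" if "B \<in> N" for B
    using merged_E_w(2)[OF that] merged_nonempty[OF that] by blast
  then show ?thesis unfolding sum_merged[symmetric] by (intro sum.cong) auto
qed

lemma face_at_merged: "face_at N A \<beta> = face_at M a \<beta>"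
proof -
  have "merged.dd = dd" "merged.cc = cc"
    unfolding fun_eq_iff merged.dd_def dd_def merged.cc_def cc_def sum_w_merged by simp_all
  moreover have "merged.ss = ss" unfolding merged.ss_def ss_def calculation ..
  moreover have "merged.base = base"
    unfolding merged.base_def base_def by (simp add: merged_val_def sum_merged)
  ultimately show ?thesis unfolding face_at_eq_hex merged.face_at_eq_hex by simp
qed

text \<open>The classes merge precisely the contested goods with equal \<open>E\<close>, which
  supplies the injectivity required for the completeness of the list.\<close>

lemma merged_inj: "inj_on merged.E merged.contested"
proof (rule inj_onI)
  fix B C assume B: "B \<in> merged.contested" and C: "C \<in> merged.contested" and eq: "merged.E B = merged.E C"
  then have N: "B \<in> N" "C \<in> N" by (simp_all add: merged.contested_in_M)
  obtain j k where j: "j \<in> B" and k: "k \<in> C" using merged_nonempty N by blast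
  have jM: "j \<in> M" and kM: "k \<in> M" using j k merged_subset N by blast+
  have E: "E j = E k" "\<And>i. E j \<noteq> {i}"
    using merged_E_w(1)[OF N(1) j] merged_E_w(1)[OF N(2) k] eq B by (auto simp: merged.contested_def)
  then have "(j, k) \<in> same_dispute M a \<beta>" using jM kM by (simp add: same_dispute_iff contested_def)
  then show "B = C"
    using quotient_eq_iff[OF equiv_same_dispute, of B C j k] N j k unfolding merged_goods_def by simp
qed

lemma pareto_face_iff_some_config:
  "pareto_face M a (face_at M a \<beta>) \<longleftrightarrow> some_config N A \<beta>"
proof
  assume "pareto_face M a (face_at M a \<beta>)"
  then have "aff_dim (face_at N A \<beta>) = 2" by (simp add: pareto_face_def face_at_merged)
  then show "some_config N A \<beta>" by (rule merged.some_config_if_aff_dim[OF merged_inj])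
next
  assume "some_config N A \<beta>"
  then have "aff_dim (face_at M a \<beta>) = 2"
    using merged.some_config_pareto_face by (simp add: pareto_face_def face_at_merged)
  then show "pareto_face M a (face_at M a \<beta>)"
    using face_at_face_of face_at_pareto by (simp add: pareto_face_def)
qed

end

end

section \<open>Pareto faces\<close>

text \<open>Pareto optimality keeps \<open>IPS M a\<close> disjoint from the open orthant above the
  optimal value, and separating these convex sets yields \<open>g\<close>.\<close>

lemma pareto_optimal_support:
  assumes "pareto_optimal M a x"
  obtains g where "g \<noteq> 0" "\<And>i. 0 \<le> g $ i" "\<And>y. y \<in> IPS M a \<Longrightarrow> g \<bullet> y \<le> g \<bullet> util M a x"
proof -
  let ?u = "util M a x"
  let ?O = "{z. \<forall>i. ?u $ i < z $ i}"
  have eq: "?O = (\<Inter>i. {z. axis i 1 \<bullet> z > ?u $ i})" by (auto simp: inner_axis')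
  have conv: "convex ?O" unfolding eq by (intro convex_INT convex_halfspace_gt)
  have plus: "?u + (\<chi> i. e i) \<in> ?O" if "\<And>i. 0 < e i" for e using that by simp
  have "?O \<noteq> {}" using plus[of "\<lambda>_. 1", OF zero_less_one] by blast
  moreover have "IPS M a \<noteq> {}" using assms by (auto simp: pareto_optimal_def IPS_def)
  moreover have "IPS M a \<inter> ?O = {}"
  proof -
    have "\<not> (\<forall>i. ?u $ i < util M a x' $ i)" if "allocation M x'" for x'
      using assms that unfolding pareto_optimal_def by (meson less_imp_le)
    then show ?thesis unfolding IPS_def by blast
  qed
  ultimately have "\<exists>g b. g \<noteq> 0 \<and> (\<forall>y\<in>IPS M a. g \<bullet> y \<le> b) \<and> (\<forall>z\<in>?O. b \<le> g \<bullet> z)"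
    by (intro separating_hyperplane_sets convex_IPS conv)
  then obtain g b where g0: "g \<noteq> 0" "\<forall>y\<in>IPS M a. g \<bullet> y \<le> b" "\<forall>z\<in>?O. b \<le> g \<bullet> z"
    by (elim exE conjE)
  note g = g0(1) bspec[OF g0(2)] bspec[OF g0(3)]
  have bound: "b \<le> g \<bullet> ?u + (\<Sum>i\<in>UNIV. g $ i * e i)" if "\<And>i. 0 < e i" for e
    using g(3)[OF plus[of e, OF that]] by (simp add: inner_add_right inner_vec_def[of g "\<chi> i. e i"])
  have u: "g \<bullet> ?u \<le> b" using assms by (intro g(2)) (auto simp: pareto_optimal_def IPS_def)
  have "b \<le> g \<bullet> ?u"
  \<comment> \<open>The value lies only on the boundary of the orthant. Raising each coordinate by
    \<open>e / (1 + ?s)\<close> enters the orthant and raises the functional by at most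
    \<open>e\<close>.\<close>
  proof (rule field_le_epsilon)
    fix e :: real assume e: "0 < e"
    let ?s = "\<Sum>i\<in>UNIV. \<bar>g $ i\<bar>"
    have s: "0 \<le> ?s" by (simp add: sum_nonneg)
    have frac: "S * (e / (1 + S)) \<le> e" if "0 \<le> S" for S :: real
      using e that by (simp add: field_simps)
    have "0 < e / (1 + ?s)" using e s by (intro divide_pos_pos) linarith+
    have "b \<le> g \<bullet> ?u + (\<Sum>i\<in>UNIV. g $ i * (e / (1 + ?s)))" by (rule bound) fact
    also have "(\<Sum>i\<in>UNIV. g $ i * (e / (1 + ?s))) \<le> ?s * (e / (1 + ?s))"
      unfolding sum_distrib_right using e s by (intro sum_mono mult_right_mono) auto
    also have "\<dots> \<le> e" by (rule frac[OF s])
    finally show "b \<le> g \<bullet> ?u + e" by simp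
  qed
  then have b: "b = g \<bullet> ?u" using u by simp
  have "0 \<le> g $ i" for i
  proof (rule ccontr)
    assume neg: "\<not> 0 \<le> g $ i"
    obtain q r where qr: "three i q r" using ex_three by blast
    \<comment> \<open>Chosen so that moving by \<open>t\<close> in coordinate \<open>i\<close> and
      by 1 in the others lowers the functional by at least 1, although it should be at least
      \<open>b\<close> on the orthant.\<close>
    define t where "t = (\<bar>g $ q\<bar> + \<bar>g $ r\<bar> + 1) / - (g $ i)"
    have t: "0 < t" "g $ i * t = - (\<bar>g $ q\<bar> + \<bar>g $ r\<bar> + 1)" using neg by (simp_all add: t_def divide_pos_neg)
    have "0 \<le> (\<Sum>k\<in>UNIV. g $ k * (if k = i then t else 1))"
      using bound[of "\<lambda>k. if k = i then t else 1"] t(1) b by simp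
    also have "\<dots> = - (\<bar>g $ q\<bar> + \<bar>g $ r\<bar> + 1) + g $ q + g $ r"
      using threeD[OF qr] t(2) by (simp add: three_sum[OF qr])
    finally show False by linarith
  qed
  then show thesis using that g(1,2) b by blast
qed

lemma pareto_face_eq_face_at:
  assumes "finite M" and a_pos: "\<And>i j. j \<in> M \<Longrightarrow> 0 < a i j" and F: "pareto_face M a F"
  obtains \<beta> where "\<beta> \<in> open_simplex2" "F = face_at M a \<beta>"
proof -
  have face: "F face_of IPS M a" and dim: "aff_dim F = 2" and pareto: "F \<subseteq> pareto_boundary M a"
    using F by (simp_all add: pareto_face_def)
  have convF: "convex F" using face face_of_imp_convex convex_IPS by blast
  have "F \<noteq> {}" using dim by auto
  then obtain x0 where x0: "x0 \<in> rel_interior F" using rel_interior_eq_empty[OF convF] by blast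
  then have x0F: "x0 \<in> F" using rel_interior_subset by blast
  then obtain x where "x0 = util M a x" "pareto_optimal M a x" using pareto by (auto simp: pareto_boundary_def)
  then obtain g where g: "g \<noteq> 0" "\<And>i. 0 \<le> g $ i" and max: "\<And>y. y \<in> IPS M a \<Longrightarrow> g \<bullet> y \<le> g \<bullet> x0"
    using pareto_optimal_support by metis
  define b where "b = g \<bullet> x0"
  \<comment> \<open>A functional that is maximal at a relative interior point of \<open>F\<close> is
    constant on \<open>F\<close>.\<close>
  have F_plane: "F \<subseteq> {y. g \<bullet> y = b}"
  proof -
    have "F \<inter> {y. g \<bullet> y = b} face_of F"
      using max face face_of_imp_subset unfolding b_def
      by (intro face_of_Int_supporting_hyperplane_le convF) blast
    then have "F \<inter> {y. g \<bullet> y = b} = F"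
      using face_of_disjoint_rel_interior x0 x0F unfolding b_def by blast
    then show ?thesis by blast
  qed
  have g_pos: "0 < g $ i" for i
  proof (rule ccontr)
    assume "\<not> 0 < g $ i"
    then have gi: "g $ i = 0" using g(2)[of i] by linarith
    have "\<exists>k. g $ k \<noteq> 0" using g(1) by (simp add: vec_eq_iff)
    then obtain k where gk: "0 < g $ k" using g(2) by (metis order_le_less)
    then have ki: "k \<noteq> i" using gi by auto
    then obtain r where kir: "three k i r" using ex_three2 by blast
    have "y $ i = 0" if "y \<in> F" for y
    proof -
      have "y \<in> IPS M a" using face face_of_imp_subset that by blast
      then obtain z where z: "allocation M z" "y = util M a z" by (auto simp: IPS_def)
      \<comment> \<open>handing everything \<open>i\<close> receives to \<open>k\<close> cannot increase the functional \<open>g\<close>\<close>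
      define z' where "z' l j = (if l = i then 0 else if l = k then z k j + z i j else z l j)" for l j
      have "allocation M z'"
        using z(1) threeD[OF kir] unfolding allocation_def three_all[OF kir] three_sum[OF kir]
        by (simp add: z'_def add.commute add.left_commute)
      then have "g \<bullet> util M a z' \<le> g \<bullet> util M a z"
        using max F_plane that z by (auto simp: IPS_def b_def)
      then have "g $ k * (\<Sum>j\<in>M. a k j * z' k j) \<le> g $ k * (\<Sum>j\<in>M. a k j * z k j)"
        using threeD[OF kir] gi by (simp add: inner_vec_def three_sum[OF kir] util_def z'_def)
      then have "(\<Sum>j\<in>M. a k j * z i j) \<le> 0"
        using gk by (simp add: z'_def ki sum.distrib distrib_left mult_le_0_iff)
      moreover have nonneg: "0 \<le> a l j * z i j" if "j \<in> M" for l j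
        using a_pos[OF that] z(1) that by (simp add: allocation_def less_imp_le)
      then have "0 \<le> (\<Sum>j\<in>M. a k j * z i j)" by (intro sum_nonneg)
      ultimately have "(\<Sum>j\<in>M. a k j * z i j) = 0" by simp
      then have "\<forall>j\<in>M. a k j * z i j = 0" using assms(1) nonneg by (simp add: sum_nonneg_eq_0_iff)
      then have "\<forall>j\<in>M. z i j = 0" using a_pos by (metis less_irrefl mult_eq_0_iff)
      then show ?thesis by (simp add: z(2) util_def)
    qed
    then have "F \<subseteq> {y. g \<bullet> y = b} \<inter> {y. axis i 1 \<bullet> y = 0}" using F_plane by (auto simp: inner_axis')
    then have "aff_dim F \<le> aff_dim ({y. g \<bullet> y = b} \<inter> {y. axis i 1 \<bullet> y = 0})" by (rule aff_dim_subset)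
    also have "\<dots> < aff_dim {y. g \<bullet> y = b}"
    proof -
      \<comment> \<open>As \<open>g $ i = 0\<close>, changing coordinate \<open>i\<close> stays in
        the plane of \<open>g\<close> but can leave the plane where this coordinate vanishes. The
        planes thus differ and meet in a lower dimension.\<close>
      have "x0 + axis i (1 - x0 $ i) \<in> {y. g \<bullet> y = b} - {y. axis i 1 \<bullet> y = 0}"
        using gi by (simp add: inner_add_right inner_axis inner_axis' b_def)
      moreover have "x0 \<in> {y. g \<bullet> y = b}" by (simp add: b_def)
      ultimately show ?thesis
        using aff_dim_affine_Int_hyperplane[OF affine_hyperplane[of g b], of "axis i 1" 0] g(1)
        by (auto split: if_splits)
    qed
    finally show False using dim g(1) by simp
  qed
  \<comment> \<open>Taking reciprocals twice returns to \<open>g\<close> up to a positive factor, so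
    this \<beta> has \<open>g\<close> as its functional.\<close>
  define \<beta> where "\<beta> = RD g"
  have "0 < (\<chi> i. 1 / g $ i) $ i" for i using g_pos[of i] by simp
  note simplex = simplex_to_simplex[OF this]
  obtain c where c: "0 < c" "\<And>i. \<beta> $ i = c / g $ i"
  proof -
    have "0 < 1 / (\<Sum>i\<in>UNIV. (\<chi> i. 1 / g $ i) $ i)" using simplex(3) by simp
    moreover have "\<beta> $ i = 1 / (\<Sum>i\<in>UNIV. (\<chi> i. 1 / g $ i) $ i) / g $ i" for i
      unfolding \<beta>_def RD_def simplex(2) by simp
    ultimately show thesis by (rule that)
  qed
  have \<beta>: "\<beta> \<in> open_simplex2"
    using simplex(1) c g_pos unfolding \<beta>_def[symmetric] RD_def[of g, symmetric] open_simplex2_def by simp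
  interpret division M a \<beta> using assms(1) a_pos \<beta> by unfold_locales
  have inv: "(\<chi> i. 1 / \<beta> $ i) = (1 / c) *\<^sub>R g" using c g_pos by (simp add: vec_eq_iff)
  have plane: "{y. (\<chi> i. 1 / \<beta> $ i) \<bullet> y = W} = {y. g \<bullet> y = c * W}" for W
    unfolding inv using c(1) by (auto simp: field_simps)
  \<comment> \<open>Both sides are the maximum of \<open>g\<close> over \<open>IPS M a\<close>: one
    is attained by any allocation following the rule, the other at \<open>x0\<close>.\<close>
  have "c * (\<Sum>j\<in>M. w j) = b"
  proof -
    obtain x where x: "PAR M a \<beta> x" using ex_PAR by blast
    then have "allocation M x" by (simp add: PAR_iff)
    then have "g \<bullet> util M a x = c * (\<Sum>j\<in>M. w j)" using x weighted_util(2) plane by blast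
    moreover have "g \<bullet> util M a x \<le> b" unfolding b_def using \<open>allocation M x\<close> by (intro max) (auto simp: IPS_def)
    moreover obtain y where y: "allocation M y" "x0 = util M a y"
      using x0F face face_of_imp_subset by (fastforce simp: IPS_def)
    have "(1 / c) * b \<le> (\<Sum>j\<in>M. w j)" using weighted_util(1)[OF y(1)] unfolding inv b_def y(2) by simp
    then have "b \<le> c * (\<Sum>j\<in>M. w j)" using c(1) by (simp add: field_simps)
    ultimately show ?thesis by simp
  qed
  then have G: "face_at M a \<beta> = {y. g \<bullet> y = b} \<inter> IPS M a"
    unfolding face_at_def support_plane_eq plane by simp
  \<comment> \<open>A proper face has smaller dimension, so a two-dimensional face of this set,
    itself contained in a plane, must be all of it.\<close>
  have "F face_of face_at M a \<beta>"
    using face F_plane face_of_imp_subset[OF face] unfolding G by (intro face_of_subset[OF face]) auto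
  moreover have "aff_dim (face_at M a \<beta>) \<le> 2"
    using aff_dim_subset[of "face_at M a \<beta>" "{y. g \<bullet> y = b}"] g(1) unfolding G by simp
  moreover have "convex (face_at M a \<beta>)" using face_at_face_of face_of_imp_convex convex_IPS by blast
  ultimately have "F = face_at M a \<beta>" using face_of_aff_dim_lt dim by fastforce
  then show thesis using that \<beta> by blast
qed

theorem theorem4:
  fixes m :: nat and a :: "3 \<Rightarrow> nat \<Rightarrow> real" and M :: "nat set"
  defines "M \<equiv> {1..m}"
  assumes sum1: "\<And>i. (\<Sum>j\<in>M. a i j) = 1"
    and MAC: "\<And>i j. j \<in> M \<Longrightarrow> 0 < a i j"
  shows
    "(\<forall>F. pareto_face M a F \<longleftrightarrow>
        (\<exists>\<beta>\<in>open_simplex2. F = face_at M a \<beta> \<and> some_config (merged_goods M a \<beta>) (merged_val a) \<beta>)) \<and>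
     (\<forall>\<beta>\<in>open_simplex2.
        face_at (merged_goods M a \<beta>) (merged_val a) \<beta> = face_at M a \<beta> \<and>
        outcomes M a \<beta> \<and> outcomes (merged_goods M a \<beta>) (merged_val a) \<beta>)"
proof -
  have fin: "finite M" by (simp add: M_def)
  have division: "division M a \<beta>" if "\<beta> \<in> open_simplex2" for \<beta>
    using fin MAC that by unfold_locales
  show ?thesis
  proof (intro conjI allI iffI ballI)
    fix F assume F: "pareto_face M a F"
    obtain \<beta> where \<beta>: "\<beta> \<in> open_simplex2" "F = face_at M a \<beta>"
      by (rule pareto_face_eq_face_at[of M a F, OF fin MAC F])
    then show "\<exists>\<beta>\<in>open_simplex2. F = face_at M a \<beta> \<and>
        some_config (merged_goods M a \<beta>) (merged_val a) \<beta>"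
      using F division.pareto_face_iff_some_config[OF division] by blast
  next
    fix F assume "\<exists>\<beta>\<in>open_simplex2. F = face_at M a \<beta> \<and>
        some_config (merged_goods M a \<beta>) (merged_val a) \<beta>"
    then show "pareto_face M a F"
      using division.pareto_face_iff_some_config[OF division] by blast
  next
    fix \<beta> assume "\<beta> \<in> open_simplex2"
    note div = division[OF this]
    show "face_at (merged_goods M a \<beta>) (merged_val a) \<beta> = face_at M a \<beta>"
      by (rule division.face_at_merged[OF div])
    show "outcomes M a \<beta>" by (rule division.outcomes_hold[OF div])
    show "outcomes (merged_goods M a \<beta>) (merged_val a) \<beta>"
      by (rule division.outcomes_hold[OF division.division_merged[OF div]])
  qed
qed

end
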